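(* Let $\kappa\leqslant\lambda$ be cardinals with $\kappa$ regular (infinite). The functor \[ R_\bullet:(\mathrm{Set}^m_{<\kappa})^{op}\to \mathbb{S}_\kappa \mathrm{Set}^m_{\geqslant\lambda},\qquad V\mapsto R_V, \] is fully faithful and dense. The topology it induces on $(\mathrm{Set}^m_{<\kappa})^{op}$ is the atomic topology $J_{at}$ (every non-empty sieve is a cover), and hence the functor $\mathcal{F}\mapsto (V\mapsto \mathrm{Hom}(R_V,\mathcal{F}))$ is an equivalence \[ \mathbb{S}_\kappa \mathrm{Set}^m_{\geqslant\lambda}\overset{\simeq}{\longrightarrow} \mathrm{Sh}\big((\mathrm{Set}^m_{<\kappa})^{op},J_{at}\big). \] Finally, if $\lambda\leqslant\lambda'$, the inclusion $i:\mathrm{Set}^m_{\geqslant\lambda'}\to \mathrm{Set}^m_{\geqslant\lambda}$ is compatible with these equivalences: the induced geometric morphism $\mathbb{S}_\kappa i:\mathbb{S}_\kappa \mathrm{Set}^m_{\geqslant\lambda'}\to \mathbb{S}_\kappa \mathrm{Set}^m_{\geqslant\lambda}$ (whose inverse image functor is restriction along $i$) is an equivalence, and the triangle formed by $\mathbb{S}_\kappa i$ and the two equivalences of $\mathbb{S}_\kappa \mathrm{Set}^m_{\geqslant\lambda'}$ and $\mathbb{S}_\kappa \mathrm{Set}^m_{\geqslant\lambda}$ with $\mathrm{Sh}((\mathrm{Set}^m_{<\kappa})^{op},J_{at})$ commutes up to natural isomorphism.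
   Context: $\mathrm{Set}^m_{\geqslant\lambda}$ is the category of sets of cardinality at least $\lambda$ and monomorphisms (injective maps); $\mathrm{Set}^m_{<\kappa}$ is the (essentially small) category of sets of cardinality strictly less than $\kappa$ and monomorphisms. For an accessible category $A$ with $\kappa$-filtered colimits, $\mathbb{S}_\kappa A$ is the category of functors $A\to\mathrm{Set}$ preserving $\kappa$-filtered colimits, with natural transformations as morphisms; it is a Grothendieck topos, with colimits and finite limits computed objectwise. For $V\in\mathrm{Set}^m_{<\kappa}$, $R_V\in\mathbb{S}_\kappa\mathrm{Set}^m_{\geqslant\lambda}$ is the functor sending $S$ to the set of monomorphisms $V\to S$ (acting on morphisms by postcomposition); $V\mapsto R_V$ is contravariantly functorial in $V$ by precomposition. "Dense" means that every object of the topos admits a jointly epimorphic family of morphisms from objects of the form $R_V$. The induced topology on $(\mathrm{Set}^m_{<\kappa})^{op}$ is the one for which a sieve is covering if and only if its image under $R_\bullet$ is a jointly epimorphic family. *)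

theory Defs
  imports Main "HOL-Library.FuncSet"
begin

unbundle cardinal_syntax

section \<open>Categories\<close>

text \<open>Hom-sets are indexed by their source and target and need not be disjoint;
  composition \<open>cmp C a b c g f\<close> is \<open>g\<close> after \<open>f\<close> for \<open>f : a \<rightarrow> b\<close> and \<open>g : b \<rightarrow> c\<close>.\<close>

record ('o, 'm) category =
  Ob :: "'o set"
  Hom :: "'o \<Rightarrow> 'o \<Rightarrow> 'm set"
  ident :: "'o \<Rightarrow> 'm"
  cmp :: "'o \<Rightarrow> 'o \<Rightarrow> 'o \<Rightarrow> 'm \<Rightarrow> 'm \<Rightarrow> 'm"

definition is_category :: "('o, 'm) category \<Rightarrow> bool" where
  "is_category C \<longleftrightarrow>
     (\<forall>a\<in>Ob C. ident C a \<in> Hom C a a) \<and>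
     (\<forall>a\<in>Ob C. \<forall>b\<in>Ob C. \<forall>c\<in>Ob C. \<forall>f\<in>Hom C a b. \<forall>g\<in>Hom C b c.
        cmp C a b c g f \<in> Hom C a c) \<and>
     (\<forall>a\<in>Ob C. \<forall>b\<in>Ob C. \<forall>f\<in>Hom C a b.
        cmp C a a b f (ident C a) = f \<and> cmp C a b b (ident C b) f = f) \<and>
     (\<forall>a\<in>Ob C. \<forall>b\<in>Ob C. \<forall>c\<in>Ob C. \<forall>d\<in>Ob C.
        \<forall>f\<in>Hom C a b. \<forall>g\<in>Hom C b c. \<forall>h\<in>Hom C c d.
        cmp C a b d (cmp C b c d h g) f = cmp C a c d h (cmp C a b c g f))"

definition arrows :: "('o, 'm) category \<Rightarrow> ('o \<times> 'o \<times> 'm) set" where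
  "arrows C = {(a, b, f). a \<in> Ob C \<and> b \<in> Ob C \<and> f \<in> Hom C a b}"

definition op_cat :: "('o, 'm) category \<Rightarrow> ('o, 'm) category" where
  "op_cat C = \<lparr>Ob = Ob C, Hom = (\<lambda>a b. Hom C b a), ident = ident C,
               cmp = (\<lambda>a b c g f. cmp C c b a f g)\<rparr>"

definition full_subcat :: "('o, 'm) category \<Rightarrow> 'o set \<Rightarrow> ('o, 'm) category" where
  "full_subcat C P = C\<lparr>Ob := Ob C \<inter> P\<rparr>"

definition is_iso :: "('o, 'm) category \<Rightarrow> 'o \<Rightarrow> 'o \<Rightarrow> 'm \<Rightarrow> bool" where
  "is_iso C a b f \<longleftrightarrow> f \<in> Hom C a b \<and>
     (\<exists>g\<in>Hom C b a. cmp C a b a g f = ident C a \<and> cmp C b a b f g = ident C b)"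

record ('o, 'm, 'p, 'n) func =
  fob :: "'o \<Rightarrow> 'p"
  farr :: "'o \<Rightarrow> 'o \<Rightarrow> 'm \<Rightarrow> 'n"

definition is_functor ::
  "('o, 'm) category \<Rightarrow> ('p, 'n) category \<Rightarrow> ('o, 'm, 'p, 'n) func \<Rightarrow> bool" where
  "is_functor C D F \<longleftrightarrow> is_category C \<and> is_category D \<and>
     (\<forall>a\<in>Ob C. fob F a \<in> Ob D) \<and>
     (\<forall>a\<in>Ob C. \<forall>b\<in>Ob C. \<forall>f\<in>Hom C a b. farr F a b f \<in> Hom D (fob F a) (fob F b)) \<and>
     (\<forall>a\<in>Ob C. farr F a a (ident C a) = ident D (fob F a)) \<and>
     (\<forall>a\<in>Ob C. \<forall>b\<in>Ob C. \<forall>c\<in>Ob C. \<forall>f\<in>Hom C a b. \<forall>g\<in>Hom C b c.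
        farr F a c (cmp C a b c g f) =
          cmp D (fob F a) (fob F b) (fob F c) (farr F b c g) (farr F a b f))"

text \<open>Also serves as the inclusion functor of a full subcategory.\<close>
definition id_func :: "('o, 'm, 'o, 'm) func" where
  "id_func = \<lparr>fob = (\<lambda>a. a), farr = (\<lambda>a b f. f)\<rparr>"

definition comp_func ::
  "('p, 'n, 'q, 'k) func \<Rightarrow> ('o, 'm, 'p, 'n) func \<Rightarrow> ('o, 'm, 'q, 'k) func" where
  "comp_func G F = \<lparr>fob = (\<lambda>a. fob G (fob F a)),
                    farr = (\<lambda>a b f. farr G (fob F a) (fob F b) (farr F a b f))\<rparr>"

definition nat_trans ::
  "('o, 'm) category \<Rightarrow> ('p, 'n) category \<Rightarrow> ('o, 'm, 'p, 'n) func \<Rightarrow> ('o, 'm, 'p, 'n) func \<Rightarrow>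
   ('o \<Rightarrow> 'n) \<Rightarrow> bool" where
  "nat_trans C D F G t \<longleftrightarrow>
     (\<forall>a\<in>Ob C. t a \<in> Hom D (fob F a) (fob G a)) \<and>
     (\<forall>a\<in>Ob C. \<forall>b\<in>Ob C. \<forall>f\<in>Hom C a b.
        cmp D (fob F a) (fob F b) (fob G b) (t b) (farr F a b f) =
        cmp D (fob F a) (fob G a) (fob G b) (farr G a b f) (t a))"

definition nat_isomorphic ::
  "('o, 'm) category \<Rightarrow> ('p, 'n) category \<Rightarrow> ('o, 'm, 'p, 'n) func \<Rightarrow> ('o, 'm, 'p, 'n) func \<Rightarrow>
   bool" where
  "nat_isomorphic C D F G \<longleftrightarrow>
     (\<exists>t. nat_trans C D F G t \<and> (\<forall>a\<in>Ob C. is_iso D (fob F a) (fob G a) (t a)))"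

definition fully_faithful ::
  "('o, 'm) category \<Rightarrow> ('p, 'n) category \<Rightarrow> ('o, 'm, 'p, 'n) func \<Rightarrow> bool" where
  "fully_faithful C D F \<longleftrightarrow> is_functor C D F \<and>
     (\<forall>a\<in>Ob C. \<forall>b\<in>Ob C. bij_betw (farr F a b) (Hom C a b) (Hom D (fob F a) (fob F b)))"

definition is_equivalence ::
  "('o, 'm) category \<Rightarrow> ('p, 'n) category \<Rightarrow> ('o, 'm, 'p, 'n) func \<Rightarrow> bool" where
  "is_equivalence C D F \<longleftrightarrow> is_functor C D F \<and>
     (\<exists>G. is_functor D C G \<and> nat_isomorphic C C (comp_func G F) id_func \<and>
          nat_isomorphic D D (comp_func F G) id_func)"

text \<open>\<open>L : C \<rightarrow> D\<close> is left adjoint to \<open>R : D \<rightarrow> C\<close>.\<close>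
definition is_adjunction ::
  "('o, 'm) category \<Rightarrow> ('p, 'n) category \<Rightarrow> ('o, 'm, 'p, 'n) func \<Rightarrow> ('p, 'n, 'o, 'm) func \<Rightarrow>
   bool" where
  "is_adjunction C D L R \<longleftrightarrow> is_functor C D L \<and> is_functor D C R \<and>
     (\<exists>\<phi>. (\<forall>c\<in>Ob C. \<forall>d\<in>Ob D. bij_betw (\<phi> c d) (Hom D (fob L c) d) (Hom C c (fob R d))) \<and>
          (\<forall>c\<in>Ob C. \<forall>c'\<in>Ob C. \<forall>d\<in>Ob D. \<forall>d'\<in>Ob D.
             \<forall>f\<in>Hom C c' c. \<forall>h\<in>Hom D d d'. \<forall>g\<in>Hom D (fob L c) d.
             \<phi> c' d' (cmp D (fob L c') d d' h (cmp D (fob L c') (fob L c) d g (farr L c' c f))) =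
             cmp C c' (fob R d) (fob R d') (farr R d d' h)
               (cmp C c' c (fob R d) (\<phi> c d g) f)))"

definition functor_cat ::
  "('o, 'm) category \<Rightarrow> ('p, 'n) category \<Rightarrow> (('o, 'm, 'p, 'n) func, 'o \<Rightarrow> 'n) category" where
  "functor_cat C D = \<lparr>
     Ob = {F. is_functor C D F},
     Hom = (\<lambda>F G. {t \<in> extensional (Ob C). nat_trans C D F G t}),
     ident = (\<lambda>F. \<lambda>a\<in>Ob C. ident D (fob F a)),
     cmp = (\<lambda>F G H s t. \<lambda>a\<in>Ob C. cmp D (fob F a) (fob G a) (fob H a) (s a) (t a))\<rparr>"

section \<open>Limits, colimits, geometric morphisms\<close>

definition is_cocone ::
  "('i, 'j) category \<Rightarrow> ('o, 'm) category \<Rightarrow> ('i, 'j, 'o, 'm) func \<Rightarrow> 'o \<Rightarrow> ('i \<Rightarrow> 'm) \<Rightarrow> bool" where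
  "is_cocone J C D c k \<longleftrightarrow> c \<in> Ob C \<and>
     (\<forall>i\<in>Ob J. k i \<in> Hom C (fob D i) c) \<and>
     (\<forall>i\<in>Ob J. \<forall>j\<in>Ob J. \<forall>u\<in>Hom J i j. cmp C (fob D i) (fob D j) c (k j) (farr D i j u) = k i)"

definition is_colimit ::
  "('i, 'j) category \<Rightarrow> ('o, 'm) category \<Rightarrow> ('i, 'j, 'o, 'm) func \<Rightarrow> 'o \<Rightarrow> ('i \<Rightarrow> 'm) \<Rightarrow> bool" where
  "is_colimit J C D c k \<longleftrightarrow> is_cocone J C D c k \<and>
     (\<forall>c' k'. is_cocone J C D c' k' \<longrightarrow>
        (\<exists>!h. h \<in> Hom C c c' \<and> (\<forall>i\<in>Ob J. cmp C (fob D i) c c' h (k i) = k' i)))"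

definition is_cone ::
  "('i, 'j) category \<Rightarrow> ('o, 'm) category \<Rightarrow> ('i, 'j, 'o, 'm) func \<Rightarrow> 'o \<Rightarrow> ('i \<Rightarrow> 'm) \<Rightarrow> bool" where
  "is_cone J C D c p \<longleftrightarrow> c \<in> Ob C \<and>
     (\<forall>i\<in>Ob J. p i \<in> Hom C c (fob D i)) \<and>
     (\<forall>i\<in>Ob J. \<forall>j\<in>Ob J. \<forall>u\<in>Hom J i j. cmp C c (fob D i) (fob D j) (farr D i j u) (p i) = p j)"

definition is_limit ::
  "('i, 'j) category \<Rightarrow> ('o, 'm) category \<Rightarrow> ('i, 'j, 'o, 'm) func \<Rightarrow> 'o \<Rightarrow> ('i \<Rightarrow> 'm) \<Rightarrow> bool" where
  "is_limit J C D c p \<longleftrightarrow> is_cone J C D c p \<and>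
     (\<forall>c' p'. is_cone J C D c' p' \<longrightarrow>
        (\<exists>!h. h \<in> Hom C c' c \<and> (\<forall>i\<in>Ob J. cmp C c' c (fob D i) (p i) h = p' i)))"

text \<open>Every finite category is isomorphic to one with objects and arrows in \<^typ>\<open>nat\<close>.\<close>
definition preserves_finite_limits ::
  "('o, 'm) category \<Rightarrow> ('p, 'n) category \<Rightarrow> ('o, 'm, 'p, 'n) func \<Rightarrow> bool" where
  "preserves_finite_limits C D F \<longleftrightarrow>
     (\<forall>(J :: (nat, nat) category) G c p.
        finite (arrows J) \<and> is_functor J C G \<and> is_limit J C G c p \<longrightarrow>
        is_limit J D (comp_func F G) (fob F c) (\<lambda>i. farr F c (fob G i) (p i)))"

text \<open>A geometric morphism \<open>E \<rightarrow> F\<close>, given by its inverse image \<open>F \<rightarrow> E\<close> and its direct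
  image \<open>E \<rightarrow> F\<close>.\<close>
definition geometric_morphism ::
  "('o, 'm) category \<Rightarrow> ('p, 'n) category \<Rightarrow> ('p, 'n, 'o, 'm) func \<Rightarrow> ('o, 'm, 'p, 'n) func \<Rightarrow>
   bool" where
  "geometric_morphism E F inv_im dir_im \<longleftrightarrow>
     is_adjunction F E inv_im dir_im \<and> preserves_finite_limits F E inv_im"

text \<open>The test diagrams \<open>I\<close> range over the same types as \<open>J\<close>. This is no restriction in the use
  below, where these types have at least \<open>\<kappa>\<close> elements: every category with fewer than \<open>\<kappa>\<close>
  arrows then has an isomorphic copy there. The empty diagram forces \<open>J\<close> to be non-empty.\<close>
definition filtered :: "'k rel \<Rightarrow> ('i, 'j) category \<Rightarrow> bool" where
  "filtered \<kappa> J \<longleftrightarrow> is_category J \<and>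
     (\<forall>(I :: ('i, 'j) category) D. |arrows I| <o \<kappa> \<and> is_functor I J D \<longrightarrow>
        (\<exists>c k. is_cocone I J D c k))"

text \<open>Preservation of colimits indexed by small (fewer than \<open>\<nu>\<close> arrows) \<open>\<kappa>\<close>-filtered categories.
  Since \<open>\<nu>\<close> is a cardinal on \<open>'u\<close>, every small category has an isomorphic copy with
  objects and arrows in \<open>'u\<close>.\<close>
definition preserves_filtered_colimits ::
  "'k rel \<Rightarrow> 'u rel \<Rightarrow> ('o, 'm) category \<Rightarrow> ('p, 'n) category \<Rightarrow> ('o, 'm, 'p, 'n) func \<Rightarrow> bool" where
  "preserves_filtered_colimits \<kappa> \<nu> C D F \<longleftrightarrow>
     (\<forall>(J :: ('u, 'u) category) G c k.
        |arrows J| <o \<nu> \<and> filtered \<kappa> J \<and> is_functor J C G \<and> is_colimit J C G c k \<longrightarrow>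
        is_colimit J D (comp_func F G) (fob F c) (\<lambda>i. farr F (fob G i) c (k i)))"

section \<open>Sites and sheaves\<close>

text \<open>Arrows with a common target are given as pairs of their source and the arrow itself.\<close>
definition jointly_epi :: "('o, 'm) category \<Rightarrow> 'o \<Rightarrow> ('o \<times> 'm) set \<Rightarrow> bool" where
  "jointly_epi E c P \<longleftrightarrow>
     (\<forall>z\<in>Ob E. \<forall>g\<in>Hom E c z. \<forall>h\<in>Hom E c z.
        (\<forall>(d, f)\<in>P. cmp E d c z g f = cmp E d c z h f) \<longrightarrow> g = h)"

definition sieve :: "('o, 'm) category \<Rightarrow> 'o \<Rightarrow> ('o \<times> 'm) set \<Rightarrow> bool" where
  "sieve C c S \<longleftrightarrow> S \<subseteq> {(d, f). d \<in> Ob C \<and> f \<in> Hom C d c} \<and>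
     (\<forall>(d, f)\<in>S. \<forall>e\<in>Ob C. \<forall>g\<in>Hom C e d. (e, cmp C e d c f g) \<in> S)"

definition grothendieck_topology ::
  "('o, 'm) category \<Rightarrow> ('o \<Rightarrow> ('o \<times> 'm) set set) \<Rightarrow> bool" where
  "grothendieck_topology C J \<longleftrightarrow>
     (\<forall>c\<in>Ob C. J c \<subseteq> {S. sieve C c S}) \<and>
     (\<forall>c\<in>Ob C. {(d, f). d \<in> Ob C \<and> f \<in> Hom C d c} \<in> J c) \<and>
     (\<forall>c\<in>Ob C. \<forall>S\<in>J c. \<forall>d\<in>Ob C. \<forall>h\<in>Hom C d c.
        {(e, g). e \<in> Ob C \<and> g \<in> Hom C e d \<and> (e, cmp C e d c h g) \<in> S} \<in> J d) \<and>
     (\<forall>c\<in>Ob C. \<forall>S\<in>J c. \<forall>T. sieve C c T \<and>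
        (\<forall>(d, h)\<in>S. {(e, g). e \<in> Ob C \<and> g \<in> Hom C e d \<and> (e, cmp C e d c h g) \<in> T} \<in> J d) \<longrightarrow>
        T \<in> J c)"

definition atomic_topology :: "('o, 'm) category \<Rightarrow> 'o \<Rightarrow> ('o \<times> 'm) set set" where
  "atomic_topology C c = {S. sieve C c S \<and> S \<noteq> {}}"

definition induced_topology ::
  "('o, 'm) category \<Rightarrow> ('p, 'n) category \<Rightarrow> ('o, 'm, 'p, 'n) func \<Rightarrow> 'o \<Rightarrow> ('o \<times> 'm) set set" where
  "induced_topology C E R c =
     {S. sieve C c S \<and> jointly_epi E (fob R c) ((\<lambda>(d, f). (fob R d, farr R d c f)) ` S)}"

definition is_sheaf ::
  "('o, 'm) category \<Rightarrow> ('o \<Rightarrow> ('o \<times> 'm) set set) \<Rightarrow> ('o, 'm, 'x set, 'x \<Rightarrow> 'x) func \<Rightarrow> bool" where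
  "is_sheaf C J X \<longleftrightarrow>
     (\<forall>c\<in>Ob C. \<forall>S\<in>J c. \<forall>x.
        (\<forall>(d, f)\<in>S. x d f \<in> fob X d) \<and>
        (\<forall>(d, f)\<in>S. \<forall>e\<in>Ob C. \<forall>g\<in>Hom C e d. farr X d e g (x d f) = x e (cmp C e d c f g)) \<longrightarrow>
        (\<exists>!y. y \<in> fob X c \<and> (\<forall>(d, f)\<in>S. farr X c d f y = x d f)))"

section \<open>Categories of sets\<close>

text \<open>All sets are taken relative to a universe given by a cardinal \<open>\<nu>\<close> on a type \<open>'u\<close>: a set is
  small if it has fewer than \<open>\<nu>\<close> elements. Taking \<open>\<nu>\<close> inaccessible gives, up to equivalence of
  the categories concerned, the sets of a Grothendieck universe. Only closure under unions of small
  families and under powers with fewer than \<open>\<kappa>\<close> factors is demanded, and such \<open>\<nu>\<close> exist in HOL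
  (see \<open>universe_cardSuc_ctwo_cexp\<close>).\<close>
definition universe :: "'k rel \<Rightarrow> 'u rel \<Rightarrow> bool" where
  "universe \<kappa> \<nu> \<longleftrightarrow> Cinfinite \<nu> \<and> regularCard \<nu> \<and>
     (\<forall>(A :: 'u set) (B :: 'u set). |A| <o \<nu> \<and> |B| <o \<kappa> \<longrightarrow> |A| ^c |B| <o \<nu>)"

lemma universe_inaccessible:
  fixes \<nu> :: "'u rel"
  assumes "Cinfinite \<nu>" and "regularCard \<nu>" and "\<And>A :: 'u set. |A| <o \<nu> \<Longrightarrow> |Pow A| <o \<nu>"
    and "\<kappa> \<le>o \<nu>"
  shows "universe \<kappa> \<nu>"
  unfolding universe_def
proof (intro conjI allI impI; (elim conjE)?)
  fix A B :: "'u set" assume A: "|A| <o \<nu>" and B: "|B| <o \<kappa>"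
  have B': "|B| <o \<nu>" using B assms(4) by (rule ordLess_ordLeq_trans)
  have inf: "\<not> finite (Field \<nu>)" using assms(1) by (simp add: BNF_Cardinal_Arithmetic.cinfinite_def)
  have AB: "|A \<times> B| <o \<nu>"
  proof (cases "finite (A <+> B)")
    case True
    then show ?thesis using assms(1) inf
      by (intro finite_ordLess_infinite) (auto simp: Field_card_of card_of_well_order_on card_order_on_well_order_on)
  next
    case False
    have AB: "|A <+> B| <o \<nu>"
      using card_of_Plus_ordLess_infinite_Field[OF inf _ A B'] assms(1) by blast
    have "|A \<times> B| \<le>o |(A <+> B) \<times> (A <+> B)|"
      by (rule card_of_ordLeqI[where f = "\<lambda>(a, b). (Inl a, Inr b)"]) (auto simp: inj_on_def)
    also have "|(A <+> B) \<times> (A <+> B)| =o |A <+> B|"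
      using False by (rule card_of_Times_same_infinite)
    finally show ?thesis using AB ordLeq_ordLess_trans by blast
  qed
  then obtain Z :: "'u set" where Z: "|Z| =o |A \<times> B|"
    using internalize_card_of_ordLess[of "A \<times> B" \<nu>] by (metis ordIso_symmetric)
  have PZ: "|Pow Z| <o \<nu>" using assms(3) Z AB ordIso_ordLess_trans by blast
  have "|Func B A| \<le>o |Pow (A \<times> B)|"
  proof (rule card_of_ordLeqI[where f = "\<lambda>f. {(f b, b) |b. b \<in> B}"])
    show "inj_on (\<lambda>f. {(f b, b) |b. b \<in> B}) (Func B A)"
      by (rule inj_onI) (fastforce simp: Func_def fun_eq_iff set_eq_iff)
  qed (auto simp: Func_def)
  also have "|Pow (A \<times> B)| =o |Pow Z|"
    proof -
    obtain f where "bij_betw f (A \<times> B) Z" using Z card_of_ordIso ordIso_symmetric by metis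
    then have "bij_betw (image f) (Pow (A \<times> B)) (Pow Z)" by (rule bij_betw_Pow)
    then show ?thesis using card_of_ordIso by blast
  qed
  finally have "|Func B A| <o \<nu>" using PZ ordLeq_ordLess_trans by blast
  then show "|A| ^c |B| <o \<nu>" by (simp add: BNF_Cardinal_Arithmetic.cexp_def Field_card_of)
qed (use assms in auto)

lemma universe_cardSuc_ctwo_cexp:
  assumes "Cinfinite lam" and "\<kappa> \<le>o lam"
  shows "universe \<kappa> (cardSuc (BNF_Cardinal_Arithmetic.ctwo ^c lam))"
  unfolding universe_def
proof (intro conjI allI impI; (elim conjE)?)
  let ?p = "BNF_Cardinal_Arithmetic.ctwo ^c lam"
  have ci: "Cinfinite ?p" using assms(1) using Cinfinite_cexp[OF ordLeq_refl] ctwo_Cnotzero by blast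
  fix A B assume A: "|A| <o cardSuc ?p" and B: "|B| <o \<kappa>"
  have A': "|A| \<le>o ?p" using A ci by (simp add: cardSuc_ordLeq_ordLess card_of_Card_order)
  have B': "|B| \<le>o lam" using B assms(2) ordLess_ordLeq_trans ordLess_imp_ordLeq by blast
  have "|A| ^c |B| \<le>o ?p"
  proof (cases "B = {}")
    case True
    then have "finite (Field ( |A| ^c |B| ))"
      by (simp add: BNF_Cardinal_Arithmetic.cexp_def Field_card_of Func_empty)
    then show ?thesis using ci Card_order_cexp
      by (metis BNF_Cardinal_Arithmetic.cfinite_def Cfinite_ordLess_Cinfinite ordLess_imp_ordLeq)
  next
    case False
    have "|A| ^c |B| \<le>o ?p ^c |B|" using A' by (rule cexp_mono1) (rule card_of_Card_order)
    also have "?p ^c |B| \<le>o ?p ^c lam"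
      using B' False ci by (intro cexp_mono2') (auto simp: Field_card_of)
    also have "?p ^c lam =o ?p"
      using assms(1) by (intro cexp_cprod_ordLeq) (auto simp: Cinfinite_Cnotzero ctwo_Cnotzero intro: ordLeq_refl)
    finally show ?thesis .
  qed
  then show "|A| ^c |B| <o cardSuc ?p" using ci by (simp add: cardSuc_ordLeq_ordLess Card_order_cexp)
next
  have ci: "Cinfinite (BNF_Cardinal_Arithmetic.ctwo ^c lam)" using assms(1) using Cinfinite_cexp[OF ordLeq_refl] ctwo_Cnotzero by blast
  show "regularCard (cardSuc (BNF_Cardinal_Arithmetic.ctwo ^c lam))" "cinfinite (cardSuc (BNF_Cardinal_Arithmetic.ctwo ^c lam))"
   "Card_order (cardSuc (BNF_Cardinal_Arithmetic.ctwo ^c lam))" using ci regularCard_cardSuc Cinfinite_cardSuc by blast+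
qed

text \<open>The type \<open>'x\<close> of elements is immaterial as long as it has at least \<open>\<nu>\<close> elements.\<close>
definition Set_cat :: "'u rel \<Rightarrow> ('x set, 'x \<Rightarrow> 'x) category" where
  "Set_cat \<nu> = \<lparr>Ob = {X. |X| <o \<nu>}, Hom = (\<lambda>X Y. X \<rightarrow>\<^sub>E Y), ident = (\<lambda>X. \<lambda>x\<in>X. x),
                cmp = (\<lambda>X Y Z g f. compose X g f)\<rparr>"

definition Mono :: "'x set \<Rightarrow> 'x set \<Rightarrow> ('x \<Rightarrow> 'x) set" where
  "Mono V S = {f \<in> V \<rightarrow>\<^sub>E S. inj_on f V}"

definition Setm :: "'x set set \<Rightarrow> ('x set, 'x \<Rightarrow> 'x) category" where
  "Setm P = \<lparr>Ob = P, Hom = Mono, ident = (\<lambda>S. \<lambda>x\<in>S. x), cmp = (\<lambda>S T U g f. compose S g f)\<rparr>"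

definition Setm_ge :: "'l rel \<Rightarrow> 'u rel \<Rightarrow> ('u set, 'u \<Rightarrow> 'u) category" where
  "Setm_ge lam \<nu> = Setm {S. lam \<le>o |S| \<and> |S| <o \<nu>}"

definition Setm_less :: "'k rel \<Rightarrow> ('u set, 'u \<Rightarrow> 'u) category" where
  "Setm_less \<kappa> = Setm {V. |V| <o \<kappa>}"

section \<open>The toposes\<close>

definition Scott ::
  "'k rel \<Rightarrow> 'u rel \<Rightarrow> ('o, 'm) category \<Rightarrow>
   (('o, 'm, 'x set, 'x \<Rightarrow> 'x) func, 'o \<Rightarrow> 'x \<Rightarrow> 'x) category" where
  "Scott \<kappa> \<nu> A =
     full_subcat (functor_cat A (Set_cat \<nu>)) {F. preserves_filtered_colimits \<kappa> \<nu> A (Set_cat \<nu>) F}"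

definition Sh ::
  "'u rel \<Rightarrow> ('o, 'm) category \<Rightarrow> ('o \<Rightarrow> ('o \<times> 'm) set set) \<Rightarrow>
   (('o, 'm, 'x set, 'x \<Rightarrow> 'x) func, 'o \<Rightarrow> 'x \<Rightarrow> 'x) category" where
  "Sh \<nu> C J = full_subcat (functor_cat (op_cat C) (Set_cat \<nu>)) {X. is_sheaf C J X}"

text \<open>The elements of \<open>R\<^sub>V(S)\<close> are functions on \<open>'u\<close>, so \<open>'x\<close> is \<open>'u \<Rightarrow> 'u\<close> in the codomain of
  \<open>R\<close>.\<close>
type_synonym 'u scott_ob = "('u set, 'u \<Rightarrow> 'u, ('u \<Rightarrow> 'u) set, ('u \<Rightarrow> 'u) \<Rightarrow> ('u \<Rightarrow> 'u)) func"
type_synonym 'u scott_arr = "'u set \<Rightarrow> ('u \<Rightarrow> 'u) \<Rightarrow> ('u \<Rightarrow> 'u)"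

definition S_Setm_ge ::
  "'k rel \<Rightarrow> 'l rel \<Rightarrow> 'u rel \<Rightarrow> ('u scott_ob, 'u scott_arr) category" where
  "S_Setm_ge \<kappa> lam \<nu> = Scott \<kappa> \<nu> (Setm_ge lam \<nu>)"

definition Setm_less_op :: "'k rel \<Rightarrow> ('u set, 'u \<Rightarrow> 'u) category" where
  "Setm_less_op \<kappa> = op_cat (Setm_less \<kappa>)"

definition R_ob :: "'u set \<Rightarrow> 'u scott_ob" where
  "R_ob V = \<lparr>fob = (\<lambda>S. Mono V S), farr = (\<lambda>S T f. \<lambda>h\<in>Mono V S. compose V f h)\<rparr>"

text \<open>An arrow \<open>V \<rightarrow> W\<close> of the opposite category is an injection \<open>f : W \<rightarrow> V\<close>.\<close>
definition R_func :: "'l rel \<Rightarrow> 'u rel \<Rightarrow> ('u set, 'u \<Rightarrow> 'u, 'u scott_ob, 'u scott_arr) func" where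
  "R_func lam \<nu> = \<lparr>fob = R_ob,
     farr = (\<lambda>V W f. \<lambda>S\<in>Ob (Setm_ge lam \<nu>). \<lambda>h\<in>Mono V S. compose W h f)\<rparr>"

text \<open>Families are small: \<open>P\<close> has fewer than \<open>\<nu>\<close> members.\<close>
definition dense_functor ::
  "'u rel \<Rightarrow> ('o, 'm) category \<Rightarrow> ('p, 'n) category \<Rightarrow> ('o, 'm, 'p, 'n) func \<Rightarrow> bool" where
  "dense_functor \<nu> C E R \<longleftrightarrow> is_functor C E R \<and>
     (\<forall>F\<in>Ob E. \<exists>P. P \<subseteq> {(V, f). V \<in> Ob C \<and> f \<in> Hom E (fob R V) F} \<and> |P| <o \<nu> \<and>
        jointly_epi E F ((\<lambda>(V, f). (fob R V, f)) ` P))"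

text \<open>\<open>e \<mapsto> (c \<mapsto> Hom(R c, e))\<close>, with values in presheaves on \<open>C\<close>.\<close>
definition hom_func ::
  "('o, 'm) category \<Rightarrow> ('p, 'n) category \<Rightarrow> ('o, 'm, 'p, 'n) func \<Rightarrow>
   ('p, 'n, ('o, 'm, 'n set, 'n \<Rightarrow> 'n) func, 'o \<Rightarrow> 'n \<Rightarrow> 'n) func" where
  "hom_func C E R = \<lparr>
     fob = (\<lambda>e. \<lparr>
       fob = (\<lambda>c. Hom E (fob R c) e),
       farr = (\<lambda>c d f. \<lambda>t\<in>Hom E (fob R c) e. cmp E (fob R d) (fob R c) e t (farr R d c f))\<rparr>),
     farr = (\<lambda>e e' s. \<lambda>c\<in>Ob C. \<lambda>t\<in>Hom E (fob R c) e. cmp E (fob R c) e e' s t)\<rparr>"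

text \<open>Restriction along \<open>i : B \<rightarrow> A\<close>, on functors defined on \<open>A\<close>.\<close>
definition restriction ::
  "('q, 'k) category \<Rightarrow> ('q, 'k, 'o, 'm) func \<Rightarrow>
   (('o, 'm, 'p, 'n) func, 'o \<Rightarrow> 'n, ('q, 'k, 'p, 'n) func, 'q \<Rightarrow> 'n) func" where
  "restriction B i = \<lparr>fob = (\<lambda>F. comp_func F i), farr = (\<lambda>F G t. \<lambda>b\<in>Ob B. t (fob i b))\<rparr>"

definition Phi ::
  "'k rel \<Rightarrow> 'l rel \<Rightarrow> 'u rel \<Rightarrow>
   ('u scott_ob, 'u scott_arr,
    ('u set, 'u \<Rightarrow> 'u, 'u scott_arr set, 'u scott_arr \<Rightarrow> 'u scott_arr) func,
    'u set \<Rightarrow> 'u scott_arr \<Rightarrow> 'u scott_arr) func" where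
  "Phi \<kappa> lam \<nu> = hom_func (Setm_less_op \<kappa>) (S_Setm_ge \<kappa> lam \<nu>) (R_func lam \<nu>)"

definition Sh_atomic ::
  "'k rel \<Rightarrow> 'u rel \<Rightarrow>
   (('u set, 'u \<Rightarrow> 'u, 'x set, 'x \<Rightarrow> 'x) func, 'u set \<Rightarrow> 'x \<Rightarrow> 'x) category" where
  "Sh_atomic \<kappa> \<nu> = Sh \<nu> (Setm_less_op \<kappa>) (atomic_topology (Setm_less_op \<kappa>))"

text \<open>The inverse image of \<open>S\<^sub>\<kappa> i\<close> for \<open>i\<close> the inclusion of the full subcategory of sets of
  cardinality at least \<open>lam'\<close>.\<close>
definition restrict_ge ::
  "'l rel \<Rightarrow> 'u rel \<Rightarrow> ('u scott_ob, 'u scott_arr, 'u scott_ob, 'u scott_arr) func" where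
  "restrict_ge lam' \<nu> = restriction (Setm_ge lam' \<nu>) id_func"

end

theory Submission
  imports Defs
begin

text \<open>Writing a large set as the union of a base of size at least \<open>lam\<close> together with the small
  subsets of the rest, one sees that a functor \<open>F\<close> preserving \<open>\<kappa>\<close>-filtered colimits is determined on
  the sets of size \<open>lam\<close>. Split such a set as \<open>S = S0 \<union> S1\<close> into two halves of full size: an
  element \<open>x\<close> of \<open>F S\<close> comes both from \<open>F (S1 \<union> V)\<close> and from \<open>F (S0 \<union> W)\<close> with \<open>V\<close> and \<open>W\<close> small. If
  two injections \<open>g\<close> and \<open>h\<close> agree on \<open>V \<union> W\<close>, each of them is joined to one injection into a larger
  target by changing it first on \<open>S0\<close> and then on \<open>S1\<close>, so \<open>F g x = F h x\<close>; here one needs that \<open>F\<close>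
  sends injections to injections, which follows by retracting \<open>S \<union> V\<close> into \<open>S\<close>. Hence \<open>x\<close> has a small
  support and is the value at the inclusion of a unique \<open>R\<^sub>V \<rightarrow> F\<close>. Density, full faithfulness and the
  sheaf condition for \<open>V \<mapsto> Hom(R\<^sub>V, F)\<close> follow. Conversely, an atomic sheaf \<open>X\<close> extends to
  \<open>T \<mapsto> colim X(V)\<close>, over the small subsets \<open>V\<close> of \<open>T\<close>. Since supports do not depend on \<open>lam\<close>, the
  equivalences for \<open>lam\<close> and \<open>lam'\<close> are intertwined by restriction, which is thus itself an
  equivalence, and its quasi-inverse is its right adjoint.\<close>

section \<open>Cardinal arithmetic and injections\<close>

text \<open>A functor \<open>F\<close> in the topos has no values on small sets. The missing value
  at a small \<open>V\<close> is replaced by \<open>Hom E (R_ob V) F\<close>: the elements of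
  \<open>F S\<close>, for one large \<open>S\<close> containing \<open>V\<close>, that are supported
  in \<open>V\<close>. Such an element \<open>x\<close> becomes a transformation by sending
  \<open>k : V \<rightarrow> T\<close> to the image of \<open>x\<close> under an injection
  \<open>S \<rightarrow> T\<close> extending \<open>k\<close>. For this to exist for every large
  \<open>T\<close>, \<open>S\<close> must be no larger than any \<open>T\<close>; this is why
  elements are brought down to sets of size exactly \<open>lam\<close>. Larger \<open>S\<close> are
  handled by descent along an inclusion of small sets.

  Regularity of \<kappa> makes families of small subsets \<kappa>-directed; by \<kappa> \<le>
  \<open>lam\<close>, removing a small set from a large one keeps its size; closure of \<nu> under
  small powers bounds \<open>Mono V S\<close> and the number of small subsets.

  A second obstacle is typing: diagrams have indices in \<open>'u\<close> and values are sets of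
  functions on \<open>'u\<close>, so posets of subsets are relabelled by elements of
  \<open>'u\<close> and germs are coded by functions.\<close>

lemma card_of_image_ordLess: "|A| <o r \<Longrightarrow> |f ` A| <o r"
  using card_of_image ordLeq_ordLess_trans by blast

lemma card_of_subset_ordLess: "A \<subseteq> B \<Longrightarrow> |B| <o r \<Longrightarrow> |A| <o r"
  using card_of_mono1 ordLeq_ordLess_trans by blast

lemma card_of_subset_ordLeq: "A \<subseteq> B \<Longrightarrow> r \<le>o |A| \<Longrightarrow> r \<le>o |B|"
  using card_of_mono1 ordLeq_transitive by blast

lemma infinite_card_of_Un:
  assumes "infinite A" and "|B| \<le>o |A|"
  shows "|A \<union> B| =o |A|"
proof -
  have "|A \<union> B| \<le>o |A <+> B|" by (rule card_of_Un_Plus_ordLeq)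
  then have "|A \<union> B| \<le>o |A|" using card_of_Plus_infinite1[OF assms] ordLeq_ordIso_trans by blast
  moreover have "|A| \<le>o |A \<union> B|" by (rule card_of_mono1) simp
  ultimately show ?thesis by (simp add: ordIso_iff_ordLeq)
qed

lemma infinite_card_of_Diff:
  assumes "infinite A" and "|B| <o |A|"
  shows "|A - B| =o |A|"
proof -
  have "\<not> |A - B| <o |A|"
  proof
    assume "|A - B| <o |A|"
    then have "|(A - B) \<union> B| <o |A|" using assms by (intro card_of_Un_ordLess_infinite)
    moreover have "|A| \<le>o |(A - B) \<union> B|" by (rule card_of_mono1) auto
    ultimately show False using not_ordLess_ordLeq by blast
  qed
  then have "|A| \<le>o |A - B|" using not_ordLess_iff_ordLeq card_of_Well_order by blast
  moreover have "|A - B| \<le>o |A|" by (rule card_of_mono1) auto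
  ultimately show ?thesis by (simp add: ordIso_iff_ordLeq)
qed

text \<open>Transport of the two summands of \<open>A <+> A\<close> along a bijection with
  \<open>A\<close>.\<close>

lemma infinite_halves:
  assumes "infinite A"
  obtains A0 A1 where "A = A0 \<union> A1" "A0 \<inter> A1 = {}" "|A0| =o |A|" "|A1| =o |A|"
proof -
  have "|A| =o |A <+> A|"
    using card_of_Plus_infinite1[OF assms] ordIso_symmetric by (metis card_of_mono1 order_refl)
  then have "|A <+> A| =o |A|" by (rule ordIso_symmetric)
  then obtain f where f: "bij_betw f (A <+> A) A" by (metis card_of_ordIso)
  have inj: "inj_on f (A <+> A)" and im: "f ` (A <+> A) = A" using f by (auto simp: bij_betw_def)
  show thesis
  proof
    show "A = f ` Inl ` A \<union> f ` Inr ` A"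
      using im unfolding Plus_def image_Un by (rule sym)
    show "f ` Inl ` A \<inter> f ` Inr ` A = {}" using inj by (auto simp: inj_on_def)
    have "bij_betw (f \<circ> Inl) A (f ` Inl ` A)" "bij_betw (f \<circ> Inr) A (f ` Inr ` A)"
      using inj by (auto simp: bij_betw_def inj_on_def)
    then show "|f ` Inl ` A| =o |A|" "|f ` Inr ` A| =o |A|"
      using card_of_ordIso ordIso_symmetric by blast+
  qed
qed

text \<open>Any set with fewer than \<open>\<kappa>\<close> elements is the image of an initial segment of \<open>\<kappa>\<close>, so the
  subsets of \<open>T\<close> with fewer than \<open>\<kappa>\<close> elements are counted by the functions from initial segments
  to \<open>T\<close>.\<close>
lemma small_subsets_ordLess:
  fixes \<kappa> \<nu> :: "'u rel" and T :: "'u set"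
  assumes \<kappa>: "Card_order \<kappa>" and \<nu>: "universe \<kappa> \<nu>" and \<kappa>\<nu>: "\<kappa> <o \<nu>" and T: "|T| <o \<nu>"
  shows "|{V. V \<subseteq> T \<and> |V| <o \<kappa>}| <o \<nu>"
proof -
  have cov: "{V. V \<subseteq> T \<and> |V| <o \<kappa>} \<subseteq>
      (\<Union>a\<in>Field \<kappa>. (\<lambda>f. f ` underS \<kappa> a) ` Func (underS \<kappa> a) T)"
  proof
    fix V assume V: "V \<in> {V. V \<subseteq> T \<and> |V| <o \<kappa>}"
    have wo: "Well_order \<kappa>" using \<kappa> by (simp add: card_order_on_def)
    obtain a where a: "a \<in> Field \<kappa>" and "|V| =o Restr \<kappa> (underS \<kappa> a)"
      using V ordLess_iff_ordIso_Restr[OF wo card_of_Well_order] by blast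
    then obtain f where "iso (Restr \<kappa> (underS \<kappa> a)) |V| f"
      using ordIso_symmetric unfolding ordIso_def by blast
    then have "f ` Field (Restr \<kappa> (underS \<kappa> a)) = V"
      by (simp add: iso_def bij_betw_def Field_card_of)
    moreover have "Field (Restr \<kappa> (underS \<kappa> a)) = underS \<kappa> a"
      by (rule Refl_Field_Restr2)
         (use wo in \<open>auto simp: underS_def Field_def order_on_defs\<close>)
    ultimately have f: "f ` underS \<kappa> a = V" by simp
    \<comment> \<open>\<open>Func\<close> asks for the value \<open>undefined\<close> off the
      domain, so \<open>f\<close> is cut down to the segment before it is counted.\<close>
    let ?g = "\<lambda>b. if b \<in> underS \<kappa> a then f b else undefined"
    have "?g \<in> Func (underS \<kappa> a) T" "?g ` underS \<kappa> a = V" using f V by (auto simp: Func_def)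
    then show "V \<in> (\<Union>a\<in>Field \<kappa>. (\<lambda>f. f ` underS \<kappa> a) ` Func (underS \<kappa> a) T)" using a by blast
  qed
  have "|(\<Union>a\<in>Field \<kappa>. (\<lambda>f. f ` underS \<kappa> a) ` Func (underS \<kappa> a) T)| <o \<nu>"
  proof (rule regularCard_UNION_bound)
    show "Cinfinite \<nu>" "regularCard \<nu>" using \<nu> by (auto simp: universe_def)
    show "|Field \<kappa>| <o \<nu>" using card_of_Field_ordIso[OF \<kappa>] \<kappa>\<nu> ordIso_ordLess_trans by blast
    fix a assume a: "a \<in> Field \<kappa>"
    have "|underS \<kappa> a| <o \<kappa>" using \<kappa> a by (rule card_of_underS)
    then have "|T| ^c |underS \<kappa> a| <o \<nu>" using \<nu> T by (simp add: universe_def)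
    then have "|Func (underS \<kappa> a) T| <o \<nu>"
      by (simp add: BNF_Cardinal_Arithmetic.cexp_def Field_card_of)
    then show "|(\<lambda>f. f ` underS \<kappa> a) ` Func (underS \<kappa> a) T| <o \<nu>"
      by (rule card_of_image_ordLess)
  qed
  then show ?thesis using cov card_of_subset_ordLess by blast
qed

lemma MonoI: "f \<in> V \<rightarrow>\<^sub>E S \<Longrightarrow> inj_on f V \<Longrightarrow> f \<in> Mono V S"
  by (simp add: Mono_def)

lemma Mono_restrictI: "(\<And>v. v \<in> V \<Longrightarrow> f v \<in> S) \<Longrightarrow> inj_on f V \<Longrightarrow> restrict f V \<in> Mono V S"
  by (auto simp: Mono_def inj_on_def)

lemma MonoD: "f \<in> Mono V S \<Longrightarrow> v \<in> V \<Longrightarrow> f v \<in> S"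
  and Mono_inj: "f \<in> Mono V S \<Longrightarrow> inj_on f V"
  and Mono_ext: "f \<in> Mono V S \<Longrightarrow> f \<in> extensional V"
  and Mono_image: "f \<in> Mono V S \<Longrightarrow> f ` V \<subseteq> S"
  by (auto simp: Mono_def PiE_def)

lemma Mono_eqI: "f \<in> Mono V S \<Longrightarrow> g \<in> Mono V T \<Longrightarrow> (\<And>v. v \<in> V \<Longrightarrow> f v = g v) \<Longrightarrow> f = g"
  using Mono_ext extensionalityI by metis

lemma Mono_incl: "V \<subseteq> S \<Longrightarrow> restrict (\<lambda>x. x) V \<in> Mono V S"
  by (rule Mono_restrictI) auto

lemma Mono_compose: "f \<in> Mono V S \<Longrightarrow> g \<in> Mono S T \<Longrightarrow> compose V g f \<in> Mono V T"
  by (auto simp: Mono_def compose_def inj_on_def PiE_def Pi_def)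

lemma Mono_mono: "f \<in> Mono V S \<Longrightarrow> S \<subseteq> T \<Longrightarrow> f \<in> Mono V T"
  by (auto simp: Mono_def)

lemma Mono_corestrict: "f \<in> Mono V S \<Longrightarrow> f ` V \<subseteq> T \<Longrightarrow> f \<in> Mono V T"
  by (auto simp: Mono_def PiE_def)

lemma Mono_card: "f \<in> Mono V S \<Longrightarrow> |V| \<le>o |S|"
  by (rule card_of_ordLeqI[of f]) (auto simp: Mono_def)

lemma Mono_restrict: "f \<in> Mono S T \<Longrightarrow> V \<subseteq> S \<Longrightarrow> restrict f V \<in> Mono V T"
  by (rule Mono_restrictI) (auto simp: Mono_def inj_on_def)

lemma compose_incl_right: "V \<subseteq> S \<Longrightarrow> compose V g (restrict (\<lambda>x. x) V) = restrict g V"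
  by (auto simp: compose_def fun_eq_iff)

lemma compose_incl_left: "f \<in> Mono V S \<Longrightarrow> compose V (restrict (\<lambda>x. x) S) f = f"
  by (auto simp: compose_def fun_eq_iff Mono_def PiE_def extensional_def)

lemma compose_assoc_Mono: "f \<in> Mono V S \<Longrightarrow> compose V h (compose V g f) = compose V (compose S h g) f"
  by (auto simp: compose_def fun_eq_iff Mono_def)

section \<open>Small and large sets, and the room that a small set leaves in a large one\<close>

locale scott_cards =
  fixes \<kappa> lam \<nu> :: "'u rel"
  assumes Cinfinite_\<kappa>: "Cinfinite \<kappa>" and regular_\<kappa>: "regularCard \<kappa>"
    and Card_order_lam: "Card_order lam" and \<kappa>_lam: "\<kappa> \<le>o lam"
    and universe: "universe \<kappa> \<nu>" and lam_\<nu>: "lam <o \<nu>"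
begin

abbreviation small :: "'a set \<Rightarrow> bool" where "small V \<equiv> |V| <o \<kappa>"

definition large :: "'u set \<Rightarrow> bool" where "large S \<longleftrightarrow> lam \<le>o |S| \<and> |S| <o \<nu>"

definition smallsub :: "'u set \<Rightarrow> 'u set set" where "smallsub T = {V. V \<subseteq> T \<and> small V}"

lemma Cinfinite_\<nu>: "Cinfinite \<nu>" and regular_\<nu>: "regularCard \<nu>"
  using universe by (auto simp: universe_def)

lemma inf_Field: "\<not> finite (Field \<kappa>)" "\<not> finite (Field \<nu>)"
  using Cinfinite_\<kappa> Cinfinite_\<nu> by (simp_all add: BNF_Cardinal_Arithmetic.cinfinite_def)

lemma \<kappa>_\<nu>: "\<kappa> <o \<nu>" using \<kappa>_lam lam_\<nu> by (rule ordLeq_ordLess_trans)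

lemma small_\<nu>: "small A \<Longrightarrow> |A| <o \<nu>" using \<kappa>_\<nu> ordLess_transitive by blast

lemma small_Un: "small A \<Longrightarrow> small B \<Longrightarrow> small (A \<union> B)"
  and \<nu>_Un: "|A| <o \<nu> \<Longrightarrow> |B| <o \<nu> \<Longrightarrow> |A \<union> B| <o \<nu>"
  using card_of_Un_ordLess_infinite_Field inf_Field Cinfinite_\<kappa> Cinfinite_\<nu> by blast+

lemma small_UN: "small I \<Longrightarrow> (\<And>i. i \<in> I \<Longrightarrow> small (A i)) \<Longrightarrow> small (\<Union>i\<in>I. A i)"
  using regularCard_UNION_bound Cinfinite_\<kappa> regular_\<kappa> by blast

lemma \<nu>_UN: "|I| <o \<nu> \<Longrightarrow> (\<And>i. i \<in> I \<Longrightarrow> |A i| <o \<nu>) \<Longrightarrow> |\<Union>i\<in>I. A i| <o \<nu>"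
  using regularCard_UNION_bound Cinfinite_\<nu> regular_\<nu> by blast

lemma small_finite: "finite A \<Longrightarrow> small A"
  using inf_Field Cinfinite_\<kappa> by (intro finite_ordLess_infinite)
    (auto simp: Field_card_of card_of_well_order_on card_order_on_well_order_on)

lemma small_large: "small V \<Longrightarrow> lam \<le>o |S| \<Longrightarrow> |V| <o |S|"
  using \<kappa>_lam ordLeq_transitive ordLess_ordLeq_trans by blast

lemma large_infinite: "lam \<le>o |S| \<Longrightarrow> infinite S"
proof
  assume "lam \<le>o |S|" and "finite S"
  then have "|S| <o |S|" by (intro small_large small_finite)
  then show False by (rule ordLess_irreflexive[THEN notE])
qed

lemma smallsub_\<nu>: "|T| <o \<nu> \<Longrightarrow> |smallsub T| <o \<nu>"
  unfolding smallsub_def using small_subsets_ordLess[OF _ universe \<kappa>_\<nu>] Cinfinite_\<kappa> by blast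

text \<open>The type \<open>'u\<close> has at least \<nu> elements, so removing \<open>T\<close>
  leaves a complement of full size. This supplies the fresh copies used for amalgams, for enlarging
  targets and for coding.\<close>

lemma room:
  fixes X :: "'a set" and T :: "'u set"
  assumes "|T| <o \<nu>" and "|X| <o \<nu>"
  obtains \<iota> where "inj_on \<iota> X" and "\<iota> ` X \<inter> T = {}"
proof -
  have \<nu>: "\<nu> \<le>o |UNIV :: 'u set|"
    using card_of_Field_ordIso[of \<nu>] Cinfinite_\<nu> card_of_mono1[of "Field \<nu>" UNIV]
      ordIso_symmetric ordIso_ordLeq_trans by blast
  have "infinite (UNIV :: 'u set)" using inf_Field(2) rev_finite_subset[OF _ subset_UNIV] by blast
  then have "|UNIV - T| =o |UNIV :: 'u set|"
    using infinite_card_of_Diff[OF _ ordLess_ordLeq_trans[OF assms(1) \<nu>]] by blast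
  then have "|X| \<le>o |UNIV - T|"
    using ordLess_imp_ordLeq[OF ordLess_ordLeq_trans[OF assms(2) \<nu>]]
      ordIso_symmetric ordLeq_ordIso_trans by blast
  then obtain \<iota> where "inj_on \<iota> X" "\<iota> ` X \<subseteq> UNIV - T" by (metis card_of_ordLeq)
  then show thesis using that by blast
qed

text \<open>The image of the small \<open>V\<close> takes away fewer than \<open>|T|\<close> points,
  so the rest of \<open>T\<close> has room for \<open>S - V\<close>. This is what lets a value over
  a set of size \<open>lam\<close> determine the values over every large set.\<close>

lemma Mono_extend:
  assumes f: "f \<in> Mono V T" and V: "small V" "V \<subseteq> S" and T: "lam \<le>o |T|" and ST: "|S| \<le>o |T|"
  obtains g where "g \<in> Mono S T" and "\<And>v. v \<in> V \<Longrightarrow> g v = f v"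
proof -
  have "|f ` V| <o |T|" using small_large[OF _ T] V(1) card_of_image_ordLess by blast
  then have "|T - f ` V| =o |T|" using large_infinite[OF T] by (intro infinite_card_of_Diff)
  moreover have "|S - V| \<le>o |T|" using ST card_of_mono1[of "S - V" S] ordLeq_transitive by blast
  ultimately have "|S - V| \<le>o |T - f ` V|" using ordIso_symmetric ordLeq_ordIso_trans by blast
  then obtain h where h: "inj_on h (S - V)" "h ` (S - V) \<subseteq> T - f ` V" by (metis card_of_ordLeq)
  let ?g = "\<lambda>s\<in>S. if s \<in> V then f s else h s"
  have "?g \<in> Mono S T"
  proof (rule Mono_restrictI)
    show "(if s \<in> V then f s else h s) \<in> T" if "s \<in> S" for s
      using that h f by (auto simp: Mono_def)
    show "inj_on (\<lambda>s. if s \<in> V then f s else h s) S"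
    proof (rule inj_onI)
      fix s t assume st: "s \<in> S" "t \<in> S" and eq: "(if s \<in> V then f s else h s) = (if t \<in> V then f t else h t)"
      have hV: "h u \<notin> f ` V" if "u \<in> S" "u \<notin> V" for u using h(2) that by blast
      consider "s \<in> V" "t \<in> V" | "s \<notin> V" "t \<notin> V" using eq hV st by (metis imageI)
      then show "s = t"
      proof cases
        case 1 then show ?thesis using eq inj_onD[OF Mono_inj[OF f]] by simp
      next
        case 2 then show ?thesis using eq inj_onD[OF h(1)] st by simp
      qed
    qed
  qed
  then show thesis using that V(2) by (auto simp: subset_iff)
qed

lemma lam_subset:
  assumes "lam \<le>o |S|" obtains B where "B \<subseteq> S" and "|B| =o lam"
proof -
  have "|Field lam| \<le>o |S|"
    using assms card_of_Field_ordIso[OF Card_order_lam] ordIso_ordLeq_trans by blast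
  then obtain f where f: "inj_on f (Field lam)" "f ` Field lam \<subseteq> S" by (metis card_of_ordLeq)
  have "|f ` Field lam| =o |Field lam|"
    using f(1) card_of_ordIso inj_on_imp_bij_betw ordIso_symmetric by blast
  then have "|f ` Field lam| =o lam" using card_of_Field_ordIso[OF Card_order_lam] ordIso_transitive by blast
  then show thesis using f(2) that by blast
qed

lemma lam_Un_small: assumes "|B| =o lam" and "small V" shows "|B \<union> V| =o lam"
proof -
  have l: "lam \<le>o |B|" using assms(1) ordIso_symmetric ordIso_imp_ordLeq by blast
  then have "|B \<union> V| =o |B|"
    using small_large[OF assms(2) l] large_infinite ordLess_imp_ordLeq by (intro infinite_card_of_Un) auto
  then show ?thesis using assms(1) ordIso_transitive by blast
qed

lemma lam_large: "|S| =o lam \<Longrightarrow> large S"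
  unfolding large_def using lam_\<nu> ordIso_symmetric ordIso_imp_ordLeq ordIso_ordLess_trans by blast

lemma lam_le_large: "|S| =o lam \<Longrightarrow> large T \<Longrightarrow> |S| \<le>o |T|"
  unfolding large_def using ordIso_ordLeq_trans by blast

lemma large_Un: "large S \<Longrightarrow> |V| <o \<nu> \<Longrightarrow> large (S \<union> V)"
  unfolding large_def using \<nu>_Un card_of_subset_ordLeq[of S "S \<union> V"] by blast

lemma small_in_lam:
  assumes V: "small V" "V \<subseteq> T" and T: "lam \<le>o |T|"
  obtains S where "V \<subseteq> S" "S \<subseteq> T" "|S| =o lam"
proof -
  obtain B where B: "B \<subseteq> T" "|B| =o lam" using lam_subset[OF T] by blast
  show thesis using that[of "B \<union> V"] lam_Un_small[OF B(2) V(1)] B(1) V(2) by blast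
qed

lemma small_in_lam':
  fixes V :: "'u set" assumes V: "small V"
  obtains S where "V \<subseteq> S" "|S| =o lam"
proof -
  \<comment> \<open>\<open>Field lam\<close> is a set of size \<open>lam\<close> in
    \<open>'u\<close>; adjoining \<open>V\<close> gives an ambient set for
    \<open>small_in_lam\<close>.\<close>
  obtain S where "V \<subseteq> S" "S \<subseteq> Field lam \<union> V" "|S| =o lam"
    using small_in_lam[OF V, of "Field lam \<union> V"] card_of_subset_ordLeq[of "Field lam" "Field lam \<union> V" lam]
      card_of_Field_ordIso[OF Card_order_lam] ordIso_symmetric ordIso_imp_ordLeq by (metis Un_upper1 Un_upper2)
  then show thesis using that by blast
qed

text \<open>The Ore condition for the category of small sets and injections.\<close>
lemma small_amalgam:
  fixes V W U :: "'u set"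
  assumes f: "f \<in> Mono V W" and h: "h \<in> Mono V U" and "small W" and "small U"
  obtains X p q where "small X" "p \<in> Mono W X" "q \<in> Mono U X" "compose V p f = compose V q h"
proof -
  obtain \<iota> where \<iota>: "inj_on \<iota> U" "\<iota> ` U \<inter> W = {}"
    using room[OF small_\<nu>[OF assms(3)] small_\<nu>[OF assms(4)]] by blast
  \<comment> \<open>\<open>W\<close> stays in place. A point of \<open>U\<close> coming from
    \<open>V\<close> is glued to its image under \<open>f\<close>, and every other point of
    \<open>U\<close> goes to a fresh copy off \<open>W\<close>, which keeps the map
    injective.\<close>
  let ?q = "\<lambda>u\<in>U. if u \<in> h ` V then f (inv_into V h u) else \<iota> u"
  have fh: "?q u = f v" if "v \<in> V" "u = h v" for u v
    using that MonoD[OF h] inv_into_f_f[OF Mono_inj[OF h]] by simp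
  show thesis
  proof
    show "small (W \<union> \<iota> ` U)" using assms(3,4) small_Un card_of_image_ordLess by blast
    show "restrict (\<lambda>x. x) W \<in> Mono W (W \<union> \<iota> ` U)" by (rule Mono_incl) simp
    show "?q \<in> Mono U (W \<union> \<iota> ` U)"
    proof (rule MonoI)
      show "?q \<in> U \<rightarrow>\<^sub>E W \<union> \<iota> ` U" using MonoD[OF f] by (auto simp: inv_into_f_f[OF Mono_inj[OF h]])
      show "inj_on ?q U"
      proof (rule inj_onI)
        fix s t assume st: "s \<in> U" "t \<in> U" "?q s = ?q t"
        have W: "?q u \<in> W" if "u \<in> h ` V" for u using that fh MonoD[OF f] by force
        have nW: "?q u = \<iota> u" "?q u \<notin> W" if "u \<in> U" "u \<notin> h ` V" for u using that \<iota>(2) by auto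
        consider "s \<in> h ` V" "t \<in> h ` V" | "s \<notin> h ` V" "t \<notin> h ` V"
          using W nW st by metis
        then show "s = t"
        proof cases
          case 1
          then obtain v w where vw: "v \<in> V" "s = h v" "w \<in> V" "t = h w" by blast
          then have "f v = f w" using fh[of v s] fh[of w t] st(3) by simp
          then show ?thesis using vw Mono_inj[OF f] by (auto simp: inj_on_def)
        next
          case 2
          then have "\<iota> s = \<iota> t" using st nW(1)[OF st(1)] nW(1)[OF st(2)] by simp
          then show ?thesis using inj_onD[OF \<iota>(1)] st(1,2) by blast
        qed
      qed
    qed
    show "compose V (restrict (\<lambda>x. x) W) f = compose V ?q h"
      unfolding compose_def
    proof (rule restrict_ext)
      fix v assume "v \<in> V"
      then show "restrict (\<lambda>x. x) W (f v) = ?q (h v)" using fh[OF _ refl] MonoD[OF f] by simp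
    qed
  qed
qed

end

section \<open>Categories and equivalences\<close>

lemma cat_ident: "is_category C \<Longrightarrow> a \<in> Ob C \<Longrightarrow> ident C a \<in> Hom C a a"
  and cat_cmp: "is_category C \<Longrightarrow> a \<in> Ob C \<Longrightarrow> b \<in> Ob C \<Longrightarrow> c \<in> Ob C \<Longrightarrow> f \<in> Hom C a b \<Longrightarrow>
    g \<in> Hom C b c \<Longrightarrow> cmp C a b c g f \<in> Hom C a c"
  and cat_idr: "is_category C \<Longrightarrow> a \<in> Ob C \<Longrightarrow> b \<in> Ob C \<Longrightarrow> f \<in> Hom C a b \<Longrightarrow>
    cmp C a a b f (ident C a) = f"
  and cat_idl: "is_category C \<Longrightarrow> a \<in> Ob C \<Longrightarrow> b \<in> Ob C \<Longrightarrow> f \<in> Hom C a b \<Longrightarrow>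
    cmp C a b b (ident C b) f = f"
  and cat_assoc: "is_category C \<Longrightarrow> a \<in> Ob C \<Longrightarrow> b \<in> Ob C \<Longrightarrow> c \<in> Ob C \<Longrightarrow> d \<in> Ob C \<Longrightarrow>
    f \<in> Hom C a b \<Longrightarrow> g \<in> Hom C b c \<Longrightarrow> h \<in> Hom C c d \<Longrightarrow>
    cmp C a b d (cmp C b c d h g) f = cmp C a c d h (cmp C a b c g f)"
  by (auto simp: is_category_def)

lemma func_dom: "is_functor C D F \<Longrightarrow> is_category C"
  and func_cod: "is_functor C D F \<Longrightarrow> is_category D"
  and func_ob: "is_functor C D F \<Longrightarrow> a \<in> Ob C \<Longrightarrow> fob F a \<in> Ob D"
  and func_arr: "is_functor C D F \<Longrightarrow> a \<in> Ob C \<Longrightarrow> b \<in> Ob C \<Longrightarrow> f \<in> Hom C a b \<Longrightarrow>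
    farr F a b f \<in> Hom D (fob F a) (fob F b)"
  and func_ident: "is_functor C D F \<Longrightarrow> a \<in> Ob C \<Longrightarrow> farr F a a (ident C a) = ident D (fob F a)"
  and func_cmp: "is_functor C D F \<Longrightarrow> a \<in> Ob C \<Longrightarrow> b \<in> Ob C \<Longrightarrow> c \<in> Ob C \<Longrightarrow>
    f \<in> Hom C a b \<Longrightarrow> g \<in> Hom C b c \<Longrightarrow>
    farr F a c (cmp C a b c g f) = cmp D (fob F a) (fob F b) (fob F c) (farr F b c g) (farr F a b f)"
  by (auto simp: is_functor_def)

lemma comp_func_simps [simp]:
  "fob (comp_func G F) a = fob G (fob F a)"
  "farr (comp_func G F) a b f = farr G (fob F a) (fob F b) (farr F a b f)"
  by (simp_all add: comp_func_def)

lemma id_func_simps [simp]: "fob id_func a = a" "farr id_func a b f = f"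
  by (simp_all add: id_func_def)

lemma comp_func_id [simp]: "comp_func F id_func = F"
  by (simp add: comp_func_def)

lemma comp_func_assoc: "comp_func (comp_func H G) F = comp_func H (comp_func G F)"
  by (simp add: comp_func_def)

lemma comp_func_functor: "is_functor C D F \<Longrightarrow> is_functor D E G \<Longrightarrow> is_functor C E (comp_func G F)"
  unfolding is_functor_def[of C E]
  by (intro conjI ballI)
     (simp_all add: func_dom func_cod func_ob func_arr func_ident func_cmp)

lemma fully_faithful_functor: "fully_faithful C D F \<Longrightarrow> is_functor C D F"
  by (simp add: fully_faithful_def)

lemma fully_faithful_inj:
  "fully_faithful C D F \<Longrightarrow> a \<in> Ob C \<Longrightarrow> b \<in> Ob C \<Longrightarrow> f \<in> Hom C a b \<Longrightarrow> g \<in> Hom C a b \<Longrightarrow>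
    farr F a b f = farr F a b g \<Longrightarrow> f = g"
  unfolding fully_faithful_def bij_betw_def inj_on_def by blast

lemma fully_faithful_full:
  assumes "fully_faithful C D F" "a \<in> Ob C" "b \<in> Ob C" "g \<in> Hom D (fob F a) (fob F b)"
  obtains f where "f \<in> Hom C a b" "farr F a b f = g"
proof -
  have "g \<in> farr F a b ` Hom C a b" using assms by (simp add: fully_faithful_def bij_betw_def)
  then show thesis using that by blast
qed

subsection \<open>Isomorphisms\<close>

lemma iso_hom: "is_iso C a b f \<Longrightarrow> f \<in> Hom C a b"
  by (simp add: is_iso_def)

lemma iso_inverse:
  assumes "is_iso C a b f"
  obtains g where "is_iso C b a g" "g \<in> Hom C b a" "cmp C a b a g f = ident C a"
    "cmp C b a b f g = ident C b"
  using assms unfolding is_iso_def by blast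

lemma iso_cmp:
  assumes C: "is_category C" and ob: "a \<in> Ob C" "b \<in> Ob C" "c \<in> Ob C"
    and f: "is_iso C a b f" and g: "is_iso C b c g"
  shows "is_iso C a c (cmp C a b c g f)"
proof -
  obtain f' where f': "f' \<in> Hom C b a" "cmp C a b a f' f = ident C a" "cmp C b a b f f' = ident C b"
    using f by (rule iso_inverse)
  obtain g' where g': "g' \<in> Hom C c b" "cmp C b c b g' g = ident C b" "cmp C c b c g g' = ident C c"
    using g by (rule iso_inverse)
  note h = iso_hom[OF f] iso_hom[OF g]
  note cc = C ob cat_cmp cat_ident
  show ?thesis unfolding is_iso_def
  proof (intro conjI bexI[of _ "cmp C c b a f' g'"])
    show "cmp C a b c g f \<in> Hom C a c" "cmp C c b a f' g' \<in> Hom C c a"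
      by (intro cat_cmp C ob h f' g')+
    have "cmp C a c a (cmp C c b a f' g') (cmp C a b c g f) =
        cmp C a b a f' (cmp C a c b g' (cmp C a b c g f))"
      by (intro cat_assoc cat_cmp C ob h f' g')
    also have "cmp C a c b g' (cmp C a b c g f) = cmp C a b b (cmp C b c b g' g) f"
      by (intro cat_assoc[symmetric] C ob h g')
    also have "\<dots> = f" using g' cat_idl[OF C _ _ h(1)] ob by simp
    finally show "cmp C a c a (cmp C c b a f' g') (cmp C a b c g f) = ident C a" using f' by simp
    have "cmp C c a c (cmp C a b c g f) (cmp C c b a f' g') =
        cmp C c b c g (cmp C c a b f (cmp C c b a f' g'))"
      by (intro cat_assoc cat_cmp C ob h f' g')
    also have "cmp C c a b f (cmp C c b a f' g') = cmp C c b b (cmp C b a b f f') g'"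
      by (intro cat_assoc[symmetric] C ob h f' g')
    also have "\<dots> = g'" using f' cat_idl[OF C _ _ g'(1)] ob by simp
    finally show "cmp C c a c (cmp C a b c g f) (cmp C c b a f' g') = ident C c" using g' by simp
  qed
qed

lemma iso_func:
  assumes F: "is_functor C D F" and ob: "a \<in> Ob C" "b \<in> Ob C" and f: "is_iso C a b f"
  shows "is_iso D (fob F a) (fob F b) (farr F a b f)"
proof -
  obtain g where g: "g \<in> Hom C b a" "cmp C a b a g f = ident C a" "cmp C b a b f g = ident C b"
    using f by (rule iso_inverse)
  show ?thesis unfolding is_iso_def
    using func_arr[OF F ob iso_hom[OF f]] func_arr[OF F ob(2,1) g(1)]
      func_cmp[OF F ob(1,2,1) iso_hom[OF f] g(1)] func_cmp[OF F ob(2,1,2) g(1) iso_hom[OF f]]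
      func_ident[OF F] ob g by metis
qed

lemma cat_cancel:
  assumes "is_category C" "a \<in> Ob C" "b \<in> Ob C" "c \<in> Ob C" "f \<in> Hom C a b" "g \<in> Hom C b c"
    "g' \<in> Hom C c b" "cmp C b c b g' g = ident C b"
  shows "cmp C a c b g' (cmp C a b c g f) = f"
  using cat_assoc[of C a b c b f g g'] cat_idl[of C a b f] assms by simp

lemma cat_cancel_right:
  assumes "is_category C" "a \<in> Ob C" "b \<in> Ob C" "c \<in> Ob C" "f \<in> Hom C a b" "g \<in> Hom C c a"
    "g' \<in> Hom C a c" "cmp C a c a g g' = ident C a"
  shows "cmp C a c b (cmp C c a b f g) g' = f"
  using cat_assoc[of C a c a b g' g f] cat_idr[of C a b f] assms by simp

lemma iso_reflect:
  assumes F: "fully_faithful C D F" and ob: "a \<in> Ob C" "b \<in> Ob C" and f: "f \<in> Hom C a b"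
    and i: "is_iso D (fob F a) (fob F b) (farr F a b f)"
  shows "is_iso C a b f"
proof -
  note F' = fully_faithful_functor[OF F]
  note C = func_dom[OF F']
  obtain h where h: "h \<in> Hom D (fob F b) (fob F a)"
    "cmp D (fob F a) (fob F b) (fob F a) h (farr F a b f) = ident D (fob F a)"
    "cmp D (fob F b) (fob F a) (fob F b) (farr F a b f) h = ident D (fob F b)"
    using i by (rule iso_inverse)
  obtain g where g: "g \<in> Hom C b a" "farr F b a g = h" using fully_faithful_full[OF F ob(2,1) h(1)] .
  show ?thesis unfolding is_iso_def
  proof (intro conjI bexI)
    show "cmp C a b a g f = ident C a"
      by (rule fully_faithful_inj[OF F ob(1,1)])
        (simp_all add: cat_cmp[OF C ob(1,2,1) f g(1)] cat_ident[OF C] ob func_cmp[OF F' ob(1,2,1) f g(1)] g h func_ident[OF F'])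
    show "cmp C b a b f g = ident C b"
      by (rule fully_faithful_inj[OF F ob(2,2)])
        (simp_all add: cat_cmp[OF C ob(2,1,2) g(1) f] cat_ident[OF C] ob func_cmp[OF F' ob(2,1,2) g(1) f] g h func_ident[OF F'])
  qed (use f g in auto)
qed

subsection \<open>Natural isomorphisms\<close>

lemma nat_isomorphicE:
  assumes "nat_isomorphic C D F G"
  obtains t where "\<And>a. a \<in> Ob C \<Longrightarrow> is_iso D (fob F a) (fob G a) (t a)"
    "\<And>a. a \<in> Ob C \<Longrightarrow> t a \<in> Hom D (fob F a) (fob G a)"
    "\<And>a b f. a \<in> Ob C \<Longrightarrow> b \<in> Ob C \<Longrightarrow> f \<in> Hom C a b \<Longrightarrow>
        cmp D (fob F a) (fob F b) (fob G b) (t b) (farr F a b f) =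
        cmp D (fob F a) (fob G a) (fob G b) (farr G a b f) (t a)"
  using assms unfolding nat_isomorphic_def nat_trans_def by blast

lemma nat_isomorphicI:
  assumes "\<And>a. a \<in> Ob C \<Longrightarrow> is_iso D (fob F a) (fob G a) (t a)"
    "\<And>a b f. a \<in> Ob C \<Longrightarrow> b \<in> Ob C \<Longrightarrow> f \<in> Hom C a b \<Longrightarrow>
        cmp D (fob F a) (fob F b) (fob G b) (t b) (farr F a b f) =
        cmp D (fob F a) (fob G a) (fob G b) (farr G a b f) (t a)"
  shows "nat_isomorphic C D F G"
  unfolding nat_isomorphic_def nat_trans_def
  by (intro exI[of _ t] conjI ballI) (simp_all add: assms iso_hom[OF assms(1)])

lemma nat_isomorphic_sym:
  assumes F: "is_functor C D F" and G: "is_functor C D G" and "nat_isomorphic C D F G"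
  shows "nat_isomorphic C D G F"
proof -
  obtain t where ti: "\<And>a. a \<in> Ob C \<Longrightarrow> is_iso D (fob F a) (fob G a) (t a)"
    and t: "\<And>a. a \<in> Ob C \<Longrightarrow> t a \<in> Hom D (fob F a) (fob G a)"
    and nat: "\<And>a b f. a \<in> Ob C \<Longrightarrow> b \<in> Ob C \<Longrightarrow> f \<in> Hom C a b \<Longrightarrow>
        cmp D (fob F a) (fob F b) (fob G b) (t b) (farr F a b f) =
        cmp D (fob F a) (fob G a) (fob G b) (farr G a b f) (t a)"
    using nat_isomorphicE[OF assms(3)] by metis
  have "\<exists>s. is_iso D (fob G a) (fob F a) s \<and>
      cmp D (fob F a) (fob G a) (fob F a) s (t a) = ident D (fob F a) \<and>
      cmp D (fob G a) (fob F a) (fob G a) (t a) s = ident D (fob G a)" if "a \<in> Ob C" for a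
    using iso_inverse[OF ti[OF that]] by metis
  then obtain s where si: "\<And>a. a \<in> Ob C \<Longrightarrow> is_iso D (fob G a) (fob F a) (s a)"
    and s1: "\<And>a. a \<in> Ob C \<Longrightarrow> cmp D (fob F a) (fob G a) (fob F a) (s a) (t a) = ident D (fob F a)"
    and s2: "\<And>a. a \<in> Ob C \<Longrightarrow> cmp D (fob G a) (fob F a) (fob G a) (t a) (s a) = ident D (fob G a)"
    by metis
  note D = func_cod[OF F]
  show ?thesis
  proof (rule nat_isomorphicI[of C D G F s])
    show "is_iso D (fob G a) (fob F a) (s a)" if "a \<in> Ob C" for a using si that .
    fix a b f assume ob: "a \<in> Ob C" "b \<in> Ob C" and f: "f \<in> Hom C a b"
    note o = func_ob[OF F ob(1)] func_ob[OF F ob(2)] func_ob[OF G ob(1)] func_ob[OF G ob(2)]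
    note h = t[OF ob(1)] t[OF ob(2)] iso_hom[OF si[OF ob(1)]] iso_hom[OF si[OF ob(2)]]
      func_arr[OF F ob f] func_arr[OF G ob f]
    have "cmp D (fob G a) (fob G b) (fob F b) (s b) (farr G a b f) =
       cmp D (fob G a) (fob F a) (fob F b) (cmp D (fob F a) (fob G a) (fob F b)
         (cmp D (fob G a) (fob G b) (fob F b) (s b) (farr G a b f)) (t a)) (s a)"
      by (intro cat_cancel_right[symmetric] D o h s2 ob cat_cmp)
    also have "cmp D (fob F a) (fob G a) (fob F b)
         (cmp D (fob G a) (fob G b) (fob F b) (s b) (farr G a b f)) (t a) =
       cmp D (fob F a) (fob G b) (fob F b) (s b) (cmp D (fob F a) (fob G a) (fob G b) (farr G a b f) (t a))"
      by (intro cat_assoc D o h)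
    also have "\<dots> = cmp D (fob F a) (fob G b) (fob F b) (s b) (cmp D (fob F a) (fob F b) (fob G b) (t b) (farr F a b f))"
      using nat[OF ob f] by simp
    also have "\<dots> = farr F a b f" by (intro cat_cancel D o h s1 ob)
    finally show "cmp D (fob G a) (fob G b) (fob F b) (s b) (farr G a b f) =
      cmp D (fob G a) (fob F a) (fob F b) (farr F a b f) (s a)" .
  qed
qed

lemma nat_isomorphic_trans:
  assumes F: "is_functor C D F" and G: "is_functor C D G" and H: "is_functor C D H"
    and FG: "nat_isomorphic C D F G" and GH: "nat_isomorphic C D G H"
  shows "nat_isomorphic C D F H"
proof -
  obtain s where si: "\<And>a. a \<in> Ob C \<Longrightarrow> is_iso D (fob F a) (fob G a) (s a)"
    and s: "\<And>a. a \<in> Ob C \<Longrightarrow> s a \<in> Hom D (fob F a) (fob G a)"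
    and snat: "\<And>a b f. a \<in> Ob C \<Longrightarrow> b \<in> Ob C \<Longrightarrow> f \<in> Hom C a b \<Longrightarrow>
        cmp D (fob F a) (fob F b) (fob G b) (s b) (farr F a b f) =
        cmp D (fob F a) (fob G a) (fob G b) (farr G a b f) (s a)"
    using nat_isomorphicE[OF FG] by metis
  obtain t where ti: "\<And>a. a \<in> Ob C \<Longrightarrow> is_iso D (fob G a) (fob H a) (t a)"
    and t: "\<And>a. a \<in> Ob C \<Longrightarrow> t a \<in> Hom D (fob G a) (fob H a)"
    and tnat: "\<And>a b f. a \<in> Ob C \<Longrightarrow> b \<in> Ob C \<Longrightarrow> f \<in> Hom C a b \<Longrightarrow>
        cmp D (fob G a) (fob G b) (fob H b) (t b) (farr G a b f) =
        cmp D (fob G a) (fob H a) (fob H b) (farr H a b f) (t a)"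
    using nat_isomorphicE[OF GH] by metis
  note D = func_cod[OF F]
  show ?thesis
  proof (rule nat_isomorphicI[of C D F H "\<lambda>a. cmp D (fob F a) (fob G a) (fob H a) (t a) (s a)"])
    show "is_iso D (fob F a) (fob H a) (cmp D (fob F a) (fob G a) (fob H a) (t a) (s a))" if "a \<in> Ob C" for a
      using that by (intro iso_cmp D si ti func_ob[OF F] func_ob[OF G] func_ob[OF H])
    fix a b f assume ob: "a \<in> Ob C" "b \<in> Ob C" and f: "f \<in> Hom C a b"
    note o = func_ob[OF F ob(1)] func_ob[OF F ob(2)] func_ob[OF G ob(1)] func_ob[OF G ob(2)]
      func_ob[OF H ob(1)] func_ob[OF H ob(2)]
    note h = t[OF ob(1)] t[OF ob(2)] s[OF ob(1)] s[OF ob(2)]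
      func_arr[OF F ob f] func_arr[OF G ob f] func_arr[OF H ob f]
    have "cmp D (fob F a) (fob F b) (fob H b) (cmp D (fob F b) (fob G b) (fob H b) (t b) (s b)) (farr F a b f)
      = cmp D (fob F a) (fob G b) (fob H b) (t b) (cmp D (fob F a) (fob F b) (fob G b) (s b) (farr F a b f))"
      by (intro cat_assoc D o h)
    also have "\<dots> = cmp D (fob F a) (fob G b) (fob H b) (t b) (cmp D (fob F a) (fob G a) (fob G b) (farr G a b f) (s a))"
      using snat[OF ob f] by simp
    also have "\<dots> = cmp D (fob F a) (fob G a) (fob H b) (cmp D (fob G a) (fob G b) (fob H b) (t b) (farr G a b f)) (s a)"
      by (intro cat_assoc[symmetric] D o h)
    also have "\<dots> = cmp D (fob F a) (fob G a) (fob H b) (cmp D (fob G a) (fob H a) (fob H b) (farr H a b f) (t a)) (s a)"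
      using tnat[OF ob f] by simp
    also have "\<dots> = cmp D (fob F a) (fob H a) (fob H b) (farr H a b f) (cmp D (fob F a) (fob G a) (fob H a) (t a) (s a))"
      by (intro cat_assoc D o h)
    finally show "cmp D (fob F a) (fob F b) (fob H b) (cmp D (fob F b) (fob G b) (fob H b) (t b) (s b)) (farr F a b f) =
      cmp D (fob F a) (fob H a) (fob H b) (farr H a b f) (cmp D (fob F a) (fob G a) (fob H a) (t a) (s a))" .
  qed
qed

lemma nat_isomorphic_whisker_right:
  assumes "nat_isomorphic C D F G" and K: "is_functor B C K"
  shows "nat_isomorphic B D (comp_func F K) (comp_func G K)"
proof -
  obtain t where ti: "\<And>a. a \<in> Ob C \<Longrightarrow> is_iso D (fob F a) (fob G a) (t a)"
    and nat: "\<And>a b f. a \<in> Ob C \<Longrightarrow> b \<in> Ob C \<Longrightarrow> f \<in> Hom C a b \<Longrightarrow>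
        cmp D (fob F a) (fob F b) (fob G b) (t b) (farr F a b f) =
        cmp D (fob F a) (fob G a) (fob G b) (farr G a b f) (t a)"
    using nat_isomorphicE[OF assms(1)] by metis
  show ?thesis
    by (rule nat_isomorphicI[of B D _ _ "\<lambda>a. t (fob K a)"])
      (simp_all add: ti nat func_ob[OF K] func_arr[OF K])
qed

lemma nat_isomorphic_whisker_left:
  assumes "nat_isomorphic B C F G" and F: "is_functor B C F" and G: "is_functor B C G"
    and K: "is_functor C D K"
  shows "nat_isomorphic B D (comp_func K F) (comp_func K G)"
proof -
  obtain t where ti: "\<And>a. a \<in> Ob B \<Longrightarrow> is_iso C (fob F a) (fob G a) (t a)"
    and t: "\<And>a. a \<in> Ob B \<Longrightarrow> t a \<in> Hom C (fob F a) (fob G a)"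
    and nat: "\<And>a b f. a \<in> Ob B \<Longrightarrow> b \<in> Ob B \<Longrightarrow> f \<in> Hom B a b \<Longrightarrow>
        cmp C (fob F a) (fob F b) (fob G b) (t b) (farr F a b f) =
        cmp C (fob F a) (fob G a) (fob G b) (farr G a b f) (t a)"
    using nat_isomorphicE[OF assms(1)] by metis
  show ?thesis
  proof (rule nat_isomorphicI[of B D _ _ "\<lambda>a. farr K (fob F a) (fob G a) (t a)"])
    show "is_iso D (fob (comp_func K F) a) (fob (comp_func K G) a) (farr K (fob F a) (fob G a) (t a))"
      if "a \<in> Ob B" for a
      using iso_func[OF K func_ob[OF F that] func_ob[OF G that] ti[OF that]] by simp
    fix a b f assume ob: "a \<in> Ob B" "b \<in> Ob B" and f: "f \<in> Hom B a b"
    note o = func_ob[OF F ob(1)] func_ob[OF F ob(2)] func_ob[OF G ob(1)] func_ob[OF G ob(2)]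
    show "cmp D (fob (comp_func K F) a) (fob (comp_func K F) b) (fob (comp_func K G) b)
        (farr K (fob F b) (fob G b) (t b)) (farr (comp_func K F) a b f) =
      cmp D (fob (comp_func K F) a) (fob (comp_func K G) a) (fob (comp_func K G) b)
        (farr (comp_func K G) a b f) (farr K (fob F a) (fob G a) (t a))"
      using nat[OF ob f] func_cmp[OF K o(1,2,4) func_arr[OF F ob f] t[OF ob(2)]]
        func_cmp[OF K o(1,3,4) t[OF ob(1)] func_arr[OF G ob f]] by simp
  qed
qed

subsection \<open>Equivalences\<close>

definition ess_surj :: "('o, 'm) category \<Rightarrow> ('p, 'n) category \<Rightarrow> ('o, 'm, 'p, 'n) func \<Rightarrow> bool" where
  "ess_surj C D F \<longleftrightarrow> (\<forall>d\<in>Ob D. \<exists>c\<in>Ob C. \<exists>u. is_iso D (fob F c) d u)"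

text \<open>For each \<open>d\<close> an isomorphism \<open>u d\<close> from some
  \<open>fob F (c d)\<close> is chosen. Arrows are then forced: the lift of the conjugate of
  \<open>f\<close> by these isomorphisms is the one that makes \<open>u\<close> natural, and
  functoriality holds because \<open>F\<close> is faithful.\<close>

lemma ess_surj_inverse:
  assumes F: "fully_faithful C D F" and "ess_surj C D F"
  obtains G where "is_functor D C G" "nat_isomorphic C C (comp_func G F) id_func"
    "nat_isomorphic D D (comp_func F G) id_func"
proof -
  note F' = fully_faithful_functor[OF F]
  note C = func_dom[OF F'] and D = func_cod[OF F']
  have "\<exists>c u v. c \<in> Ob C \<and> is_iso D (fob F c) d u \<and> v \<in> Hom D d (fob F c) \<and>
      cmp D (fob F c) d (fob F c) v u = ident D (fob F c) \<and> cmp D d (fob F c) d u v = ident D d"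
    if "d \<in> Ob D" for d
    using assms(2) that unfolding ess_surj_def is_iso_def by blast
  then obtain c u v where c: "\<And>d. d \<in> Ob D \<Longrightarrow> c d \<in> Ob C"
    and ui: "\<And>d. d \<in> Ob D \<Longrightarrow> is_iso D (fob F (c d)) d (u d)"
    and v: "\<And>d. d \<in> Ob D \<Longrightarrow> v d \<in> Hom D d (fob F (c d))"
    and vu: "\<And>d. d \<in> Ob D \<Longrightarrow> cmp D (fob F (c d)) d (fob F (c d)) (v d) (u d) = ident D (fob F (c d))"
    and uv: "\<And>d. d \<in> Ob D \<Longrightarrow> cmp D d (fob F (c d)) d (u d) (v d) = ident D d"
    by metis
  note u = iso_hom[OF ui]
  \<comment> \<open>The conjugate \<open>v d' \<circ> f \<circ> u d\<close>, an arrow between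
    objects in the image of \<open>F\<close>.\<close>
  define m where "m d d' f = cmp D (fob F (c d)) d' (fob F (c d')) (v d') (cmp D (fob F (c d)) d d' f (u d))"
    for d d' f
  have m: "m d d' f \<in> Hom D (fob F (c d)) (fob F (c d'))"
    if "d \<in> Ob D" "d' \<in> Ob D" "f \<in> Hom D d d'" for d d' f
    unfolding m_def using that by (intro cat_cmp D u v func_ob[OF F'] c)
  define g where "g d d' f = inv_into (Hom C (c d) (c d')) (farr F (c d) (c d')) (m d d' f)" for d d' f
  have g: "g d d' f \<in> Hom C (c d) (c d') \<and> farr F (c d) (c d') (g d d' f) = m d d' f"
    if "d \<in> Ob D" "d' \<in> Ob D" "f \<in> Hom D d d'" for d d' f
  proof -
    have "bij_betw (farr F (c d) (c d')) (Hom C (c d) (c d')) (Hom D (fob F (c d)) (fob F (c d')))"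
      using F c that by (simp add: fully_faithful_def)
    then show ?thesis unfolding g_def using m[OF that]
      by (metis bij_betw_imp_surj_on inv_into_into f_inv_into_f)
  qed
  note g1 = g[THEN conjunct1] and g2 = g[THEN conjunct2]
  note fc = func_ob[OF F' c]
  have um: "cmp D (fob F (c d)) (fob F (c d')) d' (u d') (m d d' f) = cmp D (fob F (c d)) d d' f (u d)"
    if "d \<in> Ob D" "d' \<in> Ob D" "f \<in> Hom D d d'" for d d' f
    unfolding m_def using that by (intro cat_cancel D fc cat_cmp u v uv)
  define G where "G = \<lparr>fob = c, farr = g\<rparr>"
  have Gs [simp]: "fob G = c" "farr G = g" by (simp_all add: G_def)
  have G: "is_functor D C G"
    unfolding is_functor_def[of D C]
  proof (intro conjI ballI)
    show "is_category D" "is_category C" by (rule D C)+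
    fix a assume a: "a \<in> Ob D"
    show "fob G a \<in> Ob C" using c a by simp
    have "farr F (c a) (c a) (g a a (ident D a)) = farr F (c a) (c a) (ident C (c a))"
      using g2[OF a a cat_ident[OF D a]] func_ident[OF F' c[OF a]] cat_idl[OF D fc[OF a] a u[OF a]] vu[OF a]
      by (simp add: m_def)
    then show "farr G a a (ident D a) = ident C (fob G a)"
      using fully_faithful_inj[OF F c[OF a] c[OF a]] g1[OF a a cat_ident[OF D a]] cat_ident[OF C c[OF a]]
      by simp
    fix b assume b: "b \<in> Ob D"
    show "farr G a b f \<in> Hom C (fob G a) (fob G b)" if "f \<in> Hom D a b" for f
      using g1 a b that by simp
    fix e f h assume e: "e \<in> Ob D" and f: "f \<in> Hom D a b" and h: "h \<in> Hom D b e"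
    note hf = cat_cmp[OF D a b e f h]
    have "m a e (cmp D a b e h f) = cmp D (fob F (c a)) (fob F (c b)) (fob F (c e)) (m b e h) (m a b f)"
    proof -
      let ?A = "fob F (c a)" and ?B = "fob F (c b)" and ?E = "fob F (c e)"
      note o = a b e fc[OF a] fc[OF b] fc[OF e]
      have "cmp D ?A ?B ?E (m b e h) (m a b f) = cmp D ?A e ?E (v e) (cmp D ?A ?B e (cmp D ?B b e h (u b)) (m a b f))"
        unfolding m_def[of b e] by (intro cat_assoc D o cat_cmp u v h m f)
      also have "cmp D ?A ?B e (cmp D ?B b e h (u b)) (m a b f) = cmp D ?A b e h (cmp D ?A ?B b (u b) (m a b f))"
        by (intro cat_assoc D o cat_cmp u v h m f)
      also have "cmp D ?A ?B b (u b) (m a b f) = cmp D ?A a b f (u a)" by (rule um[OF a b f])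
      also have "cmp D ?A b e h (cmp D ?A a b f (u a)) = cmp D ?A a e (cmp D a b e h f) (u a)"
        by (intro cat_assoc[symmetric] D o u f h)
      finally show ?thesis by (simp add: m_def[of a e])
    qed
    then have "farr F (c a) (c e) (g a e (cmp D a b e h f)) =
        farr F (c a) (c e) (cmp C (c a) (c b) (c e) (g b e h) (g a b f))"
      using g2[OF a e hf] g2[OF a b f] g2[OF b e h]
        func_cmp[OF F' c[OF a] c[OF b] c[OF e] g1[OF a b f] g1[OF b e h]] by simp
    then show "farr G a e (cmp D a b e h f) =
        cmp C (fob G a) (fob G b) (fob G e) (farr G b e h) (farr G a b f)"
      using fully_faithful_inj[OF F c[OF a] c[OF e] g1[OF a e hf]
          cat_cmp[OF C c[OF a] c[OF b] c[OF e] g1[OF a b f] g1[OF b e h]]] by simp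
  qed
  have FG: "nat_isomorphic D D (comp_func F G) id_func"
    by (rule nat_isomorphicI[of _ _ _ _ u]) (simp_all add: ui g2 um)
  \<comment> \<open>The other comparison arrow is the lift of \<open>u (fob F a)\<close>. A fully
    faithful functor sends it to an isomorphism, so it is invertible, and its naturality is checked
    after applying \<open>F\<close>.\<close>
  have "\<exists>e. e \<in> Hom C (c (fob F a)) a \<and> farr F (c (fob F a)) a e = u (fob F a)" if a: "a \<in> Ob C" for a
    using fully_faithful_full[OF F c[OF func_ob[OF F' a]] a u[OF func_ob[OF F' a]]] by metis
  then obtain e where e: "\<And>a. a \<in> Ob C \<Longrightarrow> e a \<in> Hom C (c (fob F a)) a"
    and Fe: "\<And>a. a \<in> Ob C \<Longrightarrow> farr F (c (fob F a)) a (e a) = u (fob F a)" by metis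
  have GF: "nat_isomorphic C C (comp_func G F) id_func"
  proof (rule nat_isomorphicI[of _ _ _ _ e])
    fix a assume a: "a \<in> Ob C"
    note ca = c[OF func_ob[OF F' a]]
    show "is_iso C (fob (comp_func G F) a) (fob id_func a) (e a)"
      using iso_reflect[OF F ca a e[OF a]] Fe[OF a] ui[OF func_ob[OF F' a]] by simp
    fix b f assume b: "b \<in> Ob C" and f: "f \<in> Hom C a b"
    note cb = c[OF func_ob[OF F' b]]
    note Fo = func_ob[OF F' a] func_ob[OF F' b] and Ff = func_arr[OF F' a b f]
    have "farr F (c (fob F a)) b (cmp C (c (fob F a)) (c (fob F b)) b (e b) (g (fob F a) (fob F b) (farr F a b f)))
       = farr F (c (fob F a)) b (cmp C (c (fob F a)) a b f (e a))"
      using func_cmp[OF F' ca cb b g1[OF Fo Ff] e[OF b]] func_cmp[OF F' ca a b e[OF a] f]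
        Fe[OF a] Fe[OF b] g2[OF Fo Ff] um[OF Fo Ff] by simp
    then show "cmp C (fob (comp_func G F) a) (fob (comp_func G F) b) (fob id_func b) (e b) (farr (comp_func G F) a b f) =
      cmp C (fob (comp_func G F) a) (fob id_func a) (fob id_func b) (farr id_func a b f) (e a)"
      using fully_faithful_inj[OF F ca b cat_cmp[OF C ca cb b g1[OF Fo Ff] e[OF b]] cat_cmp[OF C ca a b e[OF a] f]]
      by simp
  qed
  show thesis using that[OF G GF FG] .
qed

lemma is_equivalenceI: "fully_faithful C D F \<Longrightarrow> ess_surj C D F \<Longrightarrow> is_equivalence C D F"
  unfolding is_equivalence_def using ess_surj_inverse fully_faithful_functor by metis

text \<open>The bijection is the composite Hom(Lc, d) = Hom(Lc, LRd) = Hom(c, Rd): first composition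
  with an isomorphism \<open>v d\<close> from \<open>d\<close> to \<open>L R d\<close>, then full
  faithfulness of \<open>L\<close>. It turns a quasi-inverse of the inverse image functor into a
  direct image.\<close>

lemma fully_faithful_adjunction:
  assumes L: "fully_faithful C D L" and R: "is_functor D C R" and LR: "nat_isomorphic D D (comp_func L R) id_func"
  shows "is_adjunction C D L R"
proof -
  note L' = fully_faithful_functor[OF L]
  note C = func_dom[OF L'] and D = func_cod[OF L']
  have "is_functor D D (comp_func L R)" using R L' by (rule comp_func_functor)
  moreover have I: "is_functor D D id_func"
    using D cat_ident[OF D] cat_cmp[OF D] by (simp add: is_functor_def)
  ultimately have "nat_isomorphic D D id_func (comp_func L R)" using LR by (rule nat_isomorphic_sym)
  then have idLR: "nat_isomorphic D D id_func (comp_func L R)" .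
  obtain v where vi: "\<And>d. d \<in> Ob D \<Longrightarrow> is_iso D d (fob L (fob R d)) (v d)"
    and v: "\<And>d. d \<in> Ob D \<Longrightarrow> v d \<in> Hom D d (fob L (fob R d))"
    and nat: "\<And>a b f. a \<in> Ob D \<Longrightarrow> b \<in> Ob D \<Longrightarrow> f \<in> Hom D a b \<Longrightarrow>
      cmp D a b (fob L (fob R b)) (v b) f =
      cmp D a (fob L (fob R a)) (fob L (fob R b)) (farr L (fob R a) (fob R b) (farr R a b f)) (v a)"
    using nat_isomorphicE[OF idLR, unfolded comp_func_simps id_func_simps] by metis
  define \<phi> where "\<phi> c d g = inv_into (Hom C c (fob R d)) (farr L c (fob R d))
    (cmp D (fob L c) d (fob L (fob R d)) (v d) g)" for c d g
  have bij: "bij_betw (farr L c (fob R d)) (Hom C c (fob R d)) (Hom D (fob L c) (fob L (fob R d)))"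
    if "c \<in> Ob C" "d \<in> Ob D" for c d using L that func_ob[OF R] by (simp add: fully_faithful_def)
  have vg: "cmp D (fob L c) d (fob L (fob R d)) (v d) g \<in> Hom D (fob L c) (fob L (fob R d))"
    if "c \<in> Ob C" "d \<in> Ob D" "g \<in> Hom D (fob L c) d" for c d g
    using that by (intro cat_cmp D func_ob[OF L'] func_ob[OF R] v)
  have \<phi>: "\<phi> c d g \<in> Hom C c (fob R d)" and L\<phi>: "farr L c (fob R d) (\<phi> c d g) = cmp D (fob L c) d (fob L (fob R d)) (v d) g"
    if "c \<in> Ob C" "d \<in> Ob D" "g \<in> Hom D (fob L c) d" for c d g
    unfolding \<phi>_def using bij[OF that(1,2)] vg[OF that]
    by (metis bij_betw_imp_surj_on inv_into_into) (metis bij[OF that(1,2)] vg[OF that] bij_betw_imp_surj_on f_inv_into_f)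
  have "bij_betw (\<phi> c d) (Hom D (fob L c) d) (Hom C c (fob R d))" if c: "c \<in> Ob C" and d: "d \<in> Ob D" for c d
  proof -
    obtain w where w: "w \<in> Hom D (fob L (fob R d)) d"
      "cmp D d (fob L (fob R d)) d w (v d) = ident D d"
      "cmp D (fob L (fob R d)) d (fob L (fob R d)) (v d) w = ident D (fob L (fob R d))"
      using iso_inverse[OF vi[OF d]] by metis
    note o = func_ob[OF L' c] d func_ob[OF R d] func_ob[OF L' func_ob[OF R d]]
    have "inj_on (\<phi> c d) (Hom D (fob L c) d)"
    proof (rule inj_onI)
      fix g h assume gh: "g \<in> Hom D (fob L c) d" "h \<in> Hom D (fob L c) d" "\<phi> c d g = \<phi> c d h"
      then have "cmp D (fob L c) d (fob L (fob R d)) (v d) g = cmp D (fob L c) d (fob L (fob R d)) (v d) h"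
        using L\<phi>[OF c d] by metis
      then show "g = h"
        using cat_cancel[OF D o(1,2,4) gh(1) v[OF d] w(1,2)] cat_cancel[OF D o(1,2,4) gh(2) v[OF d] w(1,2)] by metis
    qed
    moreover have "k \<in> \<phi> c d ` Hom D (fob L c) d" if k: "k \<in> Hom C c (fob R d)" for k
    proof -
      let ?g = "cmp D (fob L c) (fob L (fob R d)) d w (farr L c (fob R d) k)"
      have g: "?g \<in> Hom D (fob L c) d" by (intro cat_cmp D o w func_arr[OF L'] c k)
      have "farr L c (fob R d) (\<phi> c d ?g) = farr L c (fob R d) k"
        using L\<phi>[OF c d g] cat_cancel[OF D o(1,4,2) func_arr[OF L' c o(3) k] w(1) v[OF d] w(3)] by simp
      then have e: "\<phi> c d ?g = k" using fully_faithful_inj[OF L c o(3) \<phi>[OF c d g] k] by simp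
      show ?thesis using imageI[OF g, of "\<phi> c d"] e by simp
    qed
    ultimately show ?thesis using \<phi>[OF c d] by (auto simp: bij_betw_def)
  qed
  moreover have "\<phi> c' d' (cmp D (fob L c') d d' h (cmp D (fob L c') (fob L c) d g (farr L c' c f))) =
             cmp C c' (fob R d) (fob R d') (farr R d d' h) (cmp C c' c (fob R d) (\<phi> c d g) f)"
    if c: "c \<in> Ob C" "c' \<in> Ob C" and d: "d \<in> Ob D" "d' \<in> Ob D" and f: "f \<in> Hom C c' c"
      and h: "h \<in> Hom D d d'" and g: "g \<in> Hom D (fob L c) d" for c c' d d' f h g
  proof -
    note Lo = func_ob[OF L'] and Ro = func_ob[OF R]
    note arr = v func_arr[OF L'] func_arr[OF R] f h g \<phi>
    let ?G = "cmp D (fob L c') (fob L c) d g (farr L c' c f)"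
    have G: "?G \<in> Hom D (fob L c') d" by (intro cat_cmp D Lo c d arr)
    have hG: "cmp D (fob L c') d d' h ?G \<in> Hom D (fob L c') d'" by (intro cat_cmp D Lo c d h G)
    let ?r = "cmp C c' c (fob R d) (\<phi> c d g) f"
    have r: "?r \<in> Hom C c' (fob R d)" by (intro cat_cmp C Ro c d arr)
    have Rh: "farr R d d' h \<in> Hom C (fob R d) (fob R d')" by (intro arr d)
    have "farr L c' (fob R d) ?r = cmp D (fob L c') (fob L c) (fob L (fob R d)) (farr L c (fob R d) (\<phi> c d g)) (farr L c' c f)"
      by (intro func_cmp[OF L'] c d arr Ro)
    also have "\<dots> = cmp D (fob L c') (fob L c) (fob L (fob R d)) (cmp D (fob L c) d (fob L (fob R d)) (v d) g) (farr L c' c f)"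
      using L\<phi>[OF c(1) d(1) g] by simp
    also have "\<dots> = cmp D (fob L c') d (fob L (fob R d)) (v d) ?G"
      by (intro cat_assoc D Lo Ro c d arr)
    finally have Lr: "farr L c' (fob R d) ?r = cmp D (fob L c') d (fob L (fob R d)) (v d) ?G" .
    have "farr L c' (fob R d') (\<phi> c' d' (cmp D (fob L c') d d' h ?G)) =
        cmp D (fob L c') d' (fob L (fob R d')) (v d') (cmp D (fob L c') d d' h ?G)"
      using L\<phi>[OF c(2) d(2) hG] .
    also have "\<dots> = cmp D (fob L c') d (fob L (fob R d')) (cmp D d d' (fob L (fob R d')) (v d') h) ?G"
      by (intro cat_assoc[symmetric] D Lo Ro c d v h G)
    also have "\<dots> = cmp D (fob L c') d (fob L (fob R d'))
        (cmp D d (fob L (fob R d)) (fob L (fob R d')) (farr L (fob R d) (fob R d') (farr R d d' h)) (v d)) ?G"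
      using nat[OF d h] by simp
    also have "\<dots> = cmp D (fob L c') (fob L (fob R d)) (fob L (fob R d'))
        (farr L (fob R d) (fob R d') (farr R d d' h)) (cmp D (fob L c') d (fob L (fob R d)) (v d) ?G)"
      by (intro cat_assoc D Lo Ro c d v G func_arr[OF L'] Rh)
    also have "\<dots> = farr L c' (fob R d') (cmp C c' (fob R d) (fob R d') (farr R d d' h) ?r)"
      unfolding Lr[symmetric] by (intro func_cmp[OF L', symmetric] c Ro d r Rh)
    finally have eq: "farr L c' (fob R d') (\<phi> c' d' (cmp D (fob L c') d d' h ?G)) =
      farr L c' (fob R d') (cmp C c' (fob R d) (fob R d') (farr R d d' h) ?r)" .
    show ?thesis
      by (rule fully_faithful_inj[OF L c(2) Ro[OF d(2)] \<phi>[OF c(2) d(2) hG] _ eq])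
        (intro cat_cmp C c Ro d r Rh)
  qed
  ultimately show ?thesis unfolding is_adjunction_def using L' R by blast
qed

text \<open>The apex of a cone over the image diagram is isomorphic to some \<open>fob F b\<close>.
  Moved there, its legs lift to a cone over \<open>G\<close>, and the factorization through the
  limit is carried back along the isomorphism.\<close>

lemma fully_faithful_ess_surj_preserves_finite_limits:
  assumes F: "fully_faithful C D F" and es: "ess_surj C D F"
  shows "preserves_finite_limits C D F"
  unfolding preserves_finite_limits_def
proof (intro allI impI, elim conjE)
  note F' = fully_faithful_functor[OF F]
  note C = func_dom[OF F'] and D = func_cod[OF F']
  fix J :: "(nat, nat) category" and G c p
  assume G: "is_functor J C G" and lim: "is_limit J C G c p"
  have c: "c \<in> Ob C" and p: "\<And>i. i \<in> Ob J \<Longrightarrow> p i \<in> Hom C c (fob G i)"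
    and cone: "\<And>i j u. i \<in> Ob J \<Longrightarrow> j \<in> Ob J \<Longrightarrow> u \<in> Hom J i j \<Longrightarrow>
      cmp C c (fob G i) (fob G j) (farr G i j u) (p i) = p j"
    using lim[unfolded is_limit_def, THEN conjunct1] by (simp_all add: is_cone_def)
  have univ: "\<exists>!h. h \<in> Hom C c' c \<and> (\<forall>i\<in>Ob J. cmp C c' c (fob G i) (p i) h = p' i)"
    if "is_cone J C G c' p'" for c' p'
    using lim that unfolding is_limit_def by blast
  note Go = func_ob[OF G] and Fo = func_ob[OF F']
  show "is_limit J D (comp_func F G) (fob F c) (\<lambda>i. farr F c (fob G i) (p i))"
    unfolding is_limit_def
  proof (intro conjI allI impI)
    show "is_cone J D (comp_func F G) (fob F c) (\<lambda>i. farr F c (fob G i) (p i))"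
      unfolding is_cone_def
      using Fo[OF c] func_arr[OF F' c Go p]
        func_cmp[OF F' c Go Go p func_arr[OF G], symmetric] cone by simp
    fix d q assume dq: "is_cone J D (comp_func F G) d q"
    then have d: "d \<in> Ob D" and q: "\<And>i. i \<in> Ob J \<Longrightarrow> q i \<in> Hom D d (fob F (fob G i))"
      and qc: "\<And>i j u. i \<in> Ob J \<Longrightarrow> j \<in> Ob J \<Longrightarrow> u \<in> Hom J i j \<Longrightarrow>
        cmp D d (fob F (fob G i)) (fob F (fob G j)) (farr F (fob G i) (fob G j) (farr G i j u)) (q i) = q j"
      by (auto simp: is_cone_def)
    obtain b u where b: "b \<in> Ob C" and ui: "is_iso D (fob F b) d u" using es d unfolding ess_surj_def by blast
    obtain w where w: "w \<in> Hom D d (fob F b)" "cmp D (fob F b) d (fob F b) w u = ident D (fob F b)"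
      "cmp D d (fob F b) d u w = ident D d" using iso_inverse[OF ui] by metis
    note u = iso_hom[OF ui]
    have "\<exists>r. r \<in> Hom C b (fob G i) \<and> farr F b (fob G i) r = cmp D (fob F b) d (fob F (fob G i)) (q i) u"
      if i: "i \<in> Ob J" for i
      using fully_faithful_full[OF F b Go[OF i] cat_cmp[OF D Fo[OF b] d Fo[OF Go[OF i]] u q[OF i]]] by metis
    then obtain r where r: "\<And>i. i \<in> Ob J \<Longrightarrow> r i \<in> Hom C b (fob G i)"
      and Fr: "\<And>i. i \<in> Ob J \<Longrightarrow> farr F b (fob G i) (r i) = cmp D (fob F b) d (fob F (fob G i)) (q i) u"
      by metis
    have "is_cone J C G b r" unfolding is_cone_def
    proof (intro conjI ballI)
      fix i j v assume i: "i \<in> Ob J" and j: "j \<in> Ob J" and v: "v \<in> Hom J i j"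
      note Gv = func_arr[OF G i j v]
      have "farr F b (fob G j) (cmp C b (fob G i) (fob G j) (farr G i j v) (r i)) =
        cmp D (fob F b) (fob F (fob G i)) (fob F (fob G j)) (farr F (fob G i) (fob G j) (farr G i j v))
          (cmp D (fob F b) d (fob F (fob G i)) (q i) u)"
        using func_cmp[OF F' b Go[OF i] Go[OF j] r[OF i] Gv] Fr[OF i] by simp
      also have "\<dots> = cmp D (fob F b) d (fob F (fob G j))
         (cmp D d (fob F (fob G i)) (fob F (fob G j)) (farr F (fob G i) (fob G j) (farr G i j v)) (q i)) u"
        by (intro cat_assoc[symmetric] D Fo b d Go i j u q func_arr[OF F'] Gv)
      also have "\<dots> = farr F b (fob G j) (r j)" using qc[OF i j v] Fr[OF j] by simp
      finally have "farr F b (fob G j) (cmp C b (fob G i) (fob G j) (farr G i j v) (r i)) = farr F b (fob G j) (r j)" .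
      then show "cmp C b (fob G i) (fob G j) (farr G i j v) (r i) = r j"
        using fully_faithful_inj[OF F b Go[OF j] cat_cmp[OF C b Go[OF i] Go[OF j] r[OF i] Gv] r[OF j]] by simp
    qed (use b r in auto)
    then obtain h where h: "h \<in> Hom C b c" "\<And>i. i \<in> Ob J \<Longrightarrow> cmp C b c (fob G i) (p i) h = r i"
      and huniq: "\<And>h'. h' \<in> Hom C b c \<Longrightarrow> (\<forall>i\<in>Ob J. cmp C b c (fob G i) (p i) h' = r i) \<Longrightarrow> h' = h"
      using univ[of b r] by (metis (no_types, lifting))
    note Fh = func_arr[OF F' b c h(1)]
    show "\<exists>!h. h \<in> Hom D d (fob F c) \<and> (\<forall>i\<in>Ob J. cmp D d (fob F c) (fob (comp_func F G) i) (farr F c (fob G i) (p i)) h = q i)"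
    proof (rule ex1I[of _ "cmp D d (fob F b) (fob F c) (farr F b c h) w"], intro conjI ballI)
      show "cmp D d (fob F b) (fob F c) (farr F b c h) w \<in> Hom D d (fob F c)"
        by (intro cat_cmp D d Fo b c w Fh)
      fix i assume i: "i \<in> Ob J"
      note Fp = func_arr[OF F' c Go[OF i] p[OF i]]
      have "cmp D d (fob F c) (fob F (fob G i)) (farr F c (fob G i) (p i)) (cmp D d (fob F b) (fob F c) (farr F b c h) w)
        = cmp D d (fob F b) (fob F (fob G i)) (cmp D (fob F b) (fob F c) (fob F (fob G i)) (farr F c (fob G i) (p i)) (farr F b c h)) w"
        by (intro cat_assoc[symmetric] D d Fo b c Go i w Fh Fp)
      also have "cmp D (fob F b) (fob F c) (fob F (fob G i)) (farr F c (fob G i) (p i)) (farr F b c h) =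
          cmp D (fob F b) d (fob F (fob G i)) (q i) u"
        using func_cmp[OF F' b c Go[OF i] h(1) p[OF i]] h(2)[OF i] Fr[OF i] by simp
      also have "cmp D d (fob F b) (fob F (fob G i)) \<dots> w = q i"
        by (intro cat_cancel_right D d Fo b Go i q u w)
      finally show "cmp D d (fob F c) (fob (comp_func F G) i) (farr F c (fob G i) (p i)) (cmp D d (fob F b) (fob F c) (farr F b c h) w) = q i"
        by simp
    next
      fix k assume "k \<in> Hom D d (fob F c) \<and> (\<forall>i\<in>Ob J. cmp D d (fob F c) (fob (comp_func F G) i) (farr F c (fob G i) (p i)) k = q i)"
      then have k: "k \<in> Hom D d (fob F c)"
        and kq: "\<And>i. i \<in> Ob J \<Longrightarrow> cmp D d (fob F c) (fob F (fob G i)) (farr F c (fob G i) (p i)) k = q i" by auto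
      \<comment> \<open>Uniqueness: \<open>k\<close> precomposed with \<open>u\<close> is an arrow
        between objects in the image of \<open>F\<close>, and its lift factors the lifted
        cone.\<close>
      have ku: "cmp D (fob F b) d (fob F c) k u \<in> Hom D (fob F b) (fob F c)" by (intro cat_cmp D Fo b d c u k)
      obtain h' where h': "h' \<in> Hom C b c" "farr F b c h' = cmp D (fob F b) d (fob F c) k u"
        using fully_faithful_full[OF F b c ku] .
      have "cmp C b c (fob G i) (p i) h' = r i" if i: "i \<in> Ob J" for i
      proof -
        have "farr F b (fob G i) (cmp C b c (fob G i) (p i) h') =
          cmp D (fob F b) (fob F c) (fob F (fob G i)) (farr F c (fob G i) (p i)) (cmp D (fob F b) d (fob F c) k u)"
          using func_cmp[OF F' b c Go[OF i] h'(1) p[OF i]] h'(2) by simp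
        also have "\<dots> = cmp D (fob F b) d (fob F (fob G i)) (cmp D d (fob F c) (fob F (fob G i)) (farr F c (fob G i) (p i)) k) u"
          by (intro cat_assoc[symmetric] D Fo b d c Go i u k func_arr[OF F'] p)
        also have "\<dots> = farr F b (fob G i) (r i)" using kq[OF i] Fr[OF i] by simp
        finally have "farr F b (fob G i) (cmp C b c (fob G i) (p i) h') = farr F b (fob G i) (r i)" .
        then show ?thesis
          using fully_faithful_inj[OF F b Go[OF i] cat_cmp[OF C b c Go[OF i] h'(1) p[OF i]] r[OF i]] by simp
      qed
      then have "h' = h" using huniq h'(1) by blast
      then have "farr F b c h = cmp D (fob F b) d (fob F c) k u" using h'(2) by simp
      moreover have "cmp D d (fob F b) (fob F c) (cmp D (fob F b) d (fob F c) k u) w = k"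
        by (intro cat_cancel_right D d Fo b c k u w)
      ultimately show "k = cmp D d (fob F b) (fob F c) (farr F b c h) w" by simp
    qed
  qed
qed

text \<open>Conjugation by \<open>t\<close> turns arrows in the image of \<open>P' K\<close> into
  arrows in the image of \<open>P\<close>, so the hom bijections of \<open>P\<close> and
  \<open>P'\<close> yield one for \<open>K\<close>. For objects, \<open>P\<close> reaches
  \<open>fob P' b\<close> up to isomorphism, and \<open>P'\<close> reflects that isomorphism back to
  \<open>B\<close>.\<close>

lemma equivalence_two_of_three:
  assumes P: "fully_faithful A D P" "ess_surj A D P" and P': "fully_faithful B D P'"
    and K: "is_functor A B K" and iso: "nat_isomorphic A D (comp_func P' K) P"
  shows "fully_faithful A B K" and "ess_surj A B K"
proof -
  note Pf = fully_faithful_functor[OF P(1)] and Pf' = fully_faithful_functor[OF P']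
  note A = func_dom[OF Pf] and D = func_cod[OF Pf] and B = func_dom[OF Pf']
  obtain t where ti: "\<And>a. a \<in> Ob A \<Longrightarrow> is_iso D (fob P' (fob K a)) (fob P a) (t a)"
    and t: "\<And>a. a \<in> Ob A \<Longrightarrow> t a \<in> Hom D (fob P' (fob K a)) (fob P a)"
    and nat: "\<And>a b f. a \<in> Ob A \<Longrightarrow> b \<in> Ob A \<Longrightarrow> f \<in> Hom A a b \<Longrightarrow>
        cmp D (fob P' (fob K a)) (fob P' (fob K b)) (fob P b) (t b) (farr P' (fob K a) (fob K b) (farr K a b f)) =
        cmp D (fob P' (fob K a)) (fob P a) (fob P b) (farr P a b f) (t a)"
    by (rule nat_isomorphicE[OF iso, unfolded comp_func_simps]) (rule that; assumption)
  note o = func_ob[OF K] func_ob[OF Pf] func_ob[OF Pf']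
  show "fully_faithful A B K" unfolding fully_faithful_def
  proof (intro conjI K ballI)
    fix a b assume a: "a \<in> Ob A" and b: "b \<in> Ob A"
    obtain s where s: "s \<in> Hom D (fob P a) (fob P' (fob K a))"
      "cmp D (fob P' (fob K a)) (fob P a) (fob P' (fob K a)) s (t a) = ident D (fob P' (fob K a))"
      "cmp D (fob P a) (fob P' (fob K a)) (fob P a) (t a) s = ident D (fob P a)" using iso_inverse[OF ti[OF a]] by metis
    obtain s' where s': "s' \<in> Hom D (fob P b) (fob P' (fob K b))"
      "cmp D (fob P' (fob K b)) (fob P b) (fob P' (fob K b)) s' (t b) = ident D (fob P' (fob K b))"
      "cmp D (fob P b) (fob P' (fob K b)) (fob P b) (t b) s' = ident D (fob P b)" using iso_inverse[OF ti[OF b]] by metis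
    have "inj_on (farr K a b) (Hom A a b)"
    proof (rule inj_onI)
      fix f g assume f: "f \<in> Hom A a b" and g: "g \<in> Hom A a b" and "farr K a b f = farr K a b g"
      then have "cmp D (fob P' (fob K a)) (fob P a) (fob P b) (farr P a b f) (t a) =
          cmp D (fob P' (fob K a)) (fob P a) (fob P b) (farr P a b g) (t a)"
        using nat[OF a b f] nat[OF a b g] by simp
      then have "farr P a b f = farr P a b g"
        using cat_cancel_right[OF D o(2)[OF a] o(2)[OF b] o(3)[OF o(1)[OF a]] func_arr[OF Pf a b f] t[OF a] s(1,3)]
          cat_cancel_right[OF D o(2)[OF a] o(2)[OF b] o(3)[OF o(1)[OF a]] func_arr[OF Pf a b g] t[OF a] s(1,3)] by metis
      then show "f = g" using fully_faithful_inj[OF P(1) a b f g] by simp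
    qed
    moreover have "k \<in> farr K a b ` Hom A a b" if k: "k \<in> Hom B (fob K a) (fob K b)" for k
    proof -
      let ?k = "farr P' (fob K a) (fob K b) k"
      have k': "?k \<in> Hom D (fob P' (fob K a)) (fob P' (fob K b))" by (intro func_arr[OF Pf'] o a b k)
      let ?m = "cmp D (fob P' (fob K a)) (fob P' (fob K b)) (fob P b) (t b) ?k"
      have m: "?m \<in> Hom D (fob P' (fob K a)) (fob P b)" by (intro cat_cmp D o a b t k')
      have ms: "cmp D (fob P a) (fob P' (fob K a)) (fob P b) ?m s \<in> Hom D (fob P a) (fob P b)"
        by (intro cat_cmp D o a b m s)
      obtain f where f: "f \<in> Hom A a b" "farr P a b f = cmp D (fob P a) (fob P' (fob K a)) (fob P b) ?m s"
        using fully_faithful_full[OF P(1) a b ms] .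
      let ?l = "farr P' (fob K a) (fob K b) (farr K a b f)"
      have l: "?l \<in> Hom D (fob P' (fob K a)) (fob P' (fob K b))" by (intro func_arr[OF Pf'] func_arr[OF K] o a b f)
      have "cmp D (fob P' (fob K a)) (fob P' (fob K b)) (fob P b) (t b) ?l = ?m"
        using nat[OF a b f(1)] f(2) cat_cancel_right[OF D o(3)[OF o(1)[OF a]] o(2)[OF b] o(2)[OF a] m s(1) t[OF a] s(2)] by simp
      then have "?l = ?k"
        using cat_cancel[OF D o(3)[OF o(1)[OF a]] o(3)[OF o(1)[OF b]] o(2)[OF b] l t[OF b] s'(1,2)]
          cat_cancel[OF D o(3)[OF o(1)[OF a]] o(3)[OF o(1)[OF b]] o(2)[OF b] k' t[OF b] s'(1,2)] by metis
      then have "farr K a b f = k"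
        using fully_faithful_inj[OF P' o(1)[OF a] o(1)[OF b] func_arr[OF K a b f(1)] k] by simp
      then show ?thesis using f(1) by blast
    qed
    ultimately show "bij_betw (farr K a b) (Hom A a b) (Hom B (fob K a) (fob K b))"
      using func_arr[OF K a b] by (auto simp: bij_betw_def)
  qed
  show "ess_surj A B K" unfolding ess_surj_def
  proof
    fix b assume b: "b \<in> Ob B"
    obtain a u where a: "a \<in> Ob A" and u: "is_iso D (fob P a) (fob P' b) u"
      using P(2) o(3)[OF b] unfolding ess_surj_def by blast
    note i = iso_cmp[OF D o(3)[OF o(1)[OF a]] o(2)[OF a] o(3)[OF b] ti[OF a] u]
    obtain f where "f \<in> Hom B (fob K a) b" "farr P' (fob K a) b f = cmp D (fob P' (fob K a)) (fob P a) (fob P' b) u (t a)"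
      using fully_faithful_full[OF P' o(1)[OF a] b iso_hom[OF i]] .
    then have "is_iso B (fob K a) b f" using iso_reflect[OF P' o(1)[OF a] b] i by simp
    then show "\<exists>c\<in>Ob A. \<exists>u. is_iso B (fob K c) b u" using a by blast
  qed
qed

subsection \<open>Functor categories\<close>

lemma is_category_op: "is_category C \<Longrightarrow> is_category (op_cat C)"
  unfolding is_category_def op_cat_def by simp

lemma op_cat_op [simp]: "op_cat (op_cat C) = C"
  by (simp add: op_cat_def)

lemma is_category_full_subcat: "is_category C \<Longrightarrow> is_category (full_subcat C P)"
  unfolding is_category_def full_subcat_def by simp

lemma is_category_functor_cat:
  assumes C: "is_category C" and D: "is_category D"
  shows "is_category (functor_cat C D)"
  unfolding is_category_def[of "functor_cat C D"]
proof (intro conjI ballI)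
  fix F assume "F \<in> Ob (functor_cat C D)"
  then have F: "is_functor C D F" by (simp add: functor_cat_def)
  note fo = func_ob[OF F] and fa = func_arr[OF F]
  show "ident (functor_cat C D) F \<in> Hom (functor_cat C D) F F"
    by (simp add: functor_cat_def nat_trans_def fo fa cat_ident[OF D] cat_idl[OF D] cat_idr[OF D])
  fix G assume "G \<in> Ob (functor_cat C D)"
  then have G: "is_functor C D G" by (simp add: functor_cat_def)
  note go = func_ob[OF G] and ga = func_arr[OF G]
  { fix t assume t: "t \<in> Hom (functor_cat C D) F G"
    then have th: "\<And>a. a \<in> Ob C \<Longrightarrow> t a \<in> Hom D (fob F a) (fob G a)" and te: "t \<in> extensional (Ob C)"
      by (auto simp: functor_cat_def nat_trans_def)
    show "cmp (functor_cat C D) F F G t (ident (functor_cat C D) F) = t"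
      "cmp (functor_cat C D) F G G (ident (functor_cat C D) G) t = t"
      by (rule extensionalityI[of _ "Ob C"]; simp add: functor_cat_def th te fo go cat_idl[OF D] cat_idr[OF D])+
    fix H assume "H \<in> Ob (functor_cat C D)"
    then have H: "is_functor C D H" by (simp add: functor_cat_def)
    note ho = func_ob[OF H] and ha = func_arr[OF H]
    { fix s assume s: "s \<in> Hom (functor_cat C D) G H"
      then have sh: "\<And>a. a \<in> Ob C \<Longrightarrow> s a \<in> Hom D (fob G a) (fob H a)"
        by (auto simp: functor_cat_def nat_trans_def)
      have "cmp D (fob F a) (fob F b) (fob H b) (cmp D (fob F b) (fob G b) (fob H b) (s b) (t b)) (farr F a b f) =
         cmp D (fob F a) (fob H a) (fob H b) (farr H a b f) (cmp D (fob F a) (fob G a) (fob H a) (s a) (t a))"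
        if a: "a \<in> Ob C" and b: "b \<in> Ob C" and f: "f \<in> Hom C a b" for a b f
      proof -
        have nt: "cmp D (fob F a) (fob F b) (fob G b) (t b) (farr F a b f) = cmp D (fob F a) (fob G a) (fob G b) (farr G a b f) (t a)"
          and ns: "cmp D (fob G a) (fob G b) (fob H b) (s b) (farr G a b f) = cmp D (fob G a) (fob H a) (fob H b) (farr H a b f) (s a)"
          using t s a b f by (auto simp: functor_cat_def nat_trans_def)
        have "cmp D (fob F a) (fob F b) (fob H b) (cmp D (fob F b) (fob G b) (fob H b) (s b) (t b)) (farr F a b f) =
          cmp D (fob F a) (fob G b) (fob H b) (s b) (cmp D (fob F a) (fob F b) (fob G b) (t b) (farr F a b f))"
          by (intro cat_assoc D fo go ho a b fa f th sh)
        also have "\<dots> = cmp D (fob F a) (fob G a) (fob H b) (cmp D (fob G a) (fob G b) (fob H b) (s b) (farr G a b f)) (t a)"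
          unfolding nt by (intro cat_assoc[symmetric] D fo go ho a b ga f th sh)
        also have "\<dots> = cmp D (fob F a) (fob H a) (fob H b) (farr H a b f) (cmp D (fob F a) (fob G a) (fob H a) (s a) (t a))"
          unfolding ns by (intro cat_assoc D fo go ho a b ha f th sh)
        finally show ?thesis .
      qed
      then show "cmp (functor_cat C D) F G H s t \<in> Hom (functor_cat C D) F H"
        by (simp add: functor_cat_def nat_trans_def cat_cmp[OF D] fo go ho th sh)
      fix K r assume "K \<in> Ob (functor_cat C D)" and "r \<in> Hom (functor_cat C D) H K"
      then have ko: "\<And>a. a \<in> Ob C \<Longrightarrow> fob K a \<in> Ob D" and rh: "\<And>a. a \<in> Ob C \<Longrightarrow> r a \<in> Hom D (fob H a) (fob K a)"
        by (auto simp: functor_cat_def nat_trans_def func_ob)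
      show "cmp (functor_cat C D) F G K (cmp (functor_cat C D) G H K r s) t =
          cmp (functor_cat C D) F H K r (cmp (functor_cat C D) F G H s t)"
      proof (rule extensionalityI[of _ "Ob C"])
        fix a assume a: "a \<in> Ob C"
        show "cmp (functor_cat C D) F G K (cmp (functor_cat C D) G H K r s) t a =
          cmp (functor_cat C D) F H K r (cmp (functor_cat C D) F G H s t) a"
          using cat_assoc[OF D fo[OF a] go[OF a] ho[OF a] ko[OF a] th[OF a] sh[OF a] rh[OF a]] a
          by (simp add: functor_cat_def)
      qed (simp_all add: functor_cat_def)
    }
  }
qed

section \<open>Functors on large sets\<close>

abbreviation incl :: "'a set \<Rightarrow> 'a \<Rightarrow> 'a" where "incl V \<equiv> \<lambda>x\<in>V. x"

lemma Set_cat_simps [simp]: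
  "Ob (Set_cat \<nu>) = {X. |X| <o \<nu>}" "Hom (Set_cat \<nu>) X Y = X \<rightarrow>\<^sub>E Y" "ident (Set_cat \<nu>) X = incl X"
  "cmp (Set_cat \<nu>) X Y Z g f = compose X g f"
  by (simp_all add: Set_cat_def)

lemma Setm_simps [simp]:
  "Ob (Setm P) = P" "Hom (Setm P) = Mono" "ident (Setm P) S = incl S"
  "cmp (Setm P) S T U g f = compose S g f"
  by (simp_all add: Setm_def)

lemma compose_funcset: "f \<in> A \<rightarrow>\<^sub>E B \<Longrightarrow> g \<in> B \<rightarrow>\<^sub>E C \<Longrightarrow> compose A g f \<in> A \<rightarrow>\<^sub>E C"
  by (auto simp: compose_def)

lemma compose_incl_l: "f \<in> A \<rightarrow>\<^sub>E B \<Longrightarrow> compose A (incl B) f = f"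
  by (auto simp: compose_def fun_eq_iff PiE_def extensional_def)

lemma compose_incl_r: "f \<in> extensional A \<Longrightarrow> compose A f (incl A) = f"
  by (auto simp: compose_def fun_eq_iff extensional_def)

lemma compose_incl_fun: "f \<in> A \<rightarrow>\<^sub>E B \<Longrightarrow> compose A f (incl A) = f"
  by (rule compose_incl_r) (simp add: PiE_def)

lemma compose_assoc_fun: "f \<in> A \<rightarrow>\<^sub>E B \<Longrightarrow> compose A (compose B h g) f = compose A h (compose A g f)"
  by (auto simp: compose_def fun_eq_iff)

lemma is_category_Set_cat: "is_category (Set_cat \<nu>)"
  unfolding is_category_def
  by (simp add: compose_funcset compose_incl_l compose_incl_fun compose_assoc_fun)

lemma is_category_Setm: "is_category (Setm P)"
  unfolding is_category_def
  by (simp add: Mono_incl Mono_compose compose_incl_r compose_incl_left Mono_ext compose_assoc_Mono)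

text \<open>Arrows of \<open>Set_cat\<close> are extensional functions, so equations between them
  reduce to their values on elements and functors can be handled by pointwise laws.\<close>

lemma set_functor_iff:
  "is_functor (Setm P) (Set_cat \<nu>) F \<longleftrightarrow>
    (\<forall>S\<in>P. |fob F S| <o \<nu>) \<and>
    (\<forall>S\<in>P. \<forall>T\<in>P. \<forall>f\<in>Mono S T. farr F S T f \<in> fob F S \<rightarrow>\<^sub>E fob F T) \<and>
    (\<forall>S\<in>P. \<forall>x\<in>fob F S. farr F S S (incl S) x = x) \<and>
    (\<forall>S\<in>P. \<forall>T\<in>P. \<forall>U\<in>P. \<forall>f\<in>Mono S T. \<forall>g\<in>Mono T U. \<forall>x\<in>fob F S.
      farr F S U (compose S g f) x = farr F T U g (farr F S T f x))"
  (is "?L \<longleftrightarrow> ?R")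
proof
  assume L: ?L
  note id = func_ident[OF L] and cm = func_cmp[OF L]
  show ?R
  proof (intro conjI ballI)
    fix S assume S: "S \<in> P"
    then show "|fob F S| <o \<nu>" using func_ob[OF L] by simp
    show "farr F S S (incl S) x = x" if "x \<in> fob F S" for x using id[of S] S that by simp
    fix T assume T: "T \<in> P"
    show "farr F S T f \<in> fob F S \<rightarrow>\<^sub>E fob F T" if "f \<in> Mono S T" for f using func_arr[OF L, of S T f] S T that by simp
    fix U f g x assume "U \<in> P" "f \<in> Mono S T" "g \<in> Mono T U" "x \<in> fob F S"
    then show "farr F S U (compose S g f) x = farr F T U g (farr F S T f x)"
      using cm[of S T U f g] S T by (simp add: compose_def)
  qed
next
  assume R: ?R
  have ex: "farr F S T f \<in> fob F S \<rightarrow>\<^sub>E fob F T" if "S \<in> P" "T \<in> P" "f \<in> Mono S T" for S T f using R that by blast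
  show ?L unfolding is_functor_def
  proof (intro conjI ballI)
    show "is_category (Setm P)" "is_category (Set_cat \<nu>)" by (rule is_category_Setm is_category_Set_cat)+
    fix S assume S: "S \<in> Ob (Setm P)"
    show "fob F S \<in> Ob (Set_cat \<nu>)" using R S by simp
    show "farr F S S (ident (Setm P) S) = ident (Set_cat \<nu>) (fob F S)"
    proof (rule extensionalityI[of _ "fob F S"])
      show "farr F S S (ident (Setm P) S) \<in> extensional (fob F S)"
        using ex[of S S "incl S"] S by (simp add: Mono_incl PiE_def)
    qed (use R S in auto)
    fix T assume T: "T \<in> Ob (Setm P)"
    show "farr F S T f \<in> Hom (Set_cat \<nu>) (fob F S) (fob F T)" if "f \<in> Hom (Setm P) S T" for f
      using ex S T that by simp
    fix U f g assume U: "U \<in> Ob (Setm P)" and f: "f \<in> Hom (Setm P) S T" and g: "g \<in> Hom (Setm P) T U"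
    show "farr F S U (cmp (Setm P) S T U g f) = cmp (Set_cat \<nu>) (fob F S) (fob F T) (fob F U) (farr F T U g) (farr F S T f)"
    proof (rule extensionalityI[of _ "fob F S"])
      show "farr F S U (cmp (Setm P) S T U g f) \<in> extensional (fob F S)"
        using ex[of S U "compose S g f"] S T U f g Mono_compose[of f S T g U] by (simp add: PiE_def)
      fix x assume "x \<in> fob F S"
      then show "farr F S U (cmp (Setm P) S T U g f) x = cmp (Set_cat \<nu>) (fob F S) (fob F T) (fob F U) (farr F T U g) (farr F S T f) x"
        using R S T U f g by (simp add: compose_eq)
    qed simp
  qed
qed

context
  fixes P and \<nu> :: "'u rel" and F
  assumes F: "is_functor (Setm P) (Set_cat \<nu>) F"
begin

lemma setf_card: "S \<in> P \<Longrightarrow> |fob F S| <o \<nu>"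
  and setf_hom: "S \<in> P \<Longrightarrow> T \<in> P \<Longrightarrow> f \<in> Mono S T \<Longrightarrow> farr F S T f \<in> fob F S \<rightarrow>\<^sub>E fob F T"
  and setf_ident: "S \<in> P \<Longrightarrow> x \<in> fob F S \<Longrightarrow> farr F S S (incl S) x = x"
  and setf_cmp: "S \<in> P \<Longrightarrow> T \<in> P \<Longrightarrow> U \<in> P \<Longrightarrow> f \<in> Mono S T \<Longrightarrow> g \<in> Mono T U \<Longrightarrow> x \<in> fob F S \<Longrightarrow>
    farr F T U g (farr F S T f x) = farr F S U (compose S g f) x"
  using F[unfolded set_functor_iff] by simp_all

lemma setf_map: "S \<in> P \<Longrightarrow> T \<in> P \<Longrightarrow> f \<in> Mono S T \<Longrightarrow> x \<in> fob F S \<Longrightarrow> farr F S T f x \<in> fob F T"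
  using setf_hom by (meson PiE_mem)

lemma setf_incl: "S \<in> P \<Longrightarrow> T \<in> P \<Longrightarrow> S \<subseteq> T \<Longrightarrow> x \<in> fob F S \<Longrightarrow> farr F S T (incl S) x \<in> fob F T"
  by (rule setf_map) (simp_all add: Mono_incl)

lemma setf_incl_incl:
  assumes "S \<in> P" "T \<in> P" "U \<in> P" "S \<subseteq> T" "T \<subseteq> U" "x \<in> fob F S"
  shows "farr F T U (incl T) (farr F S T (incl S) x) = farr F S U (incl S) x"
proof -
  have "compose S (incl T) (incl S) = incl S" using assms by (auto simp: compose_def fun_eq_iff)
  then show ?thesis using setf_cmp[of S T U "incl S" "incl T" x] assms by (simp add: Mono_incl)
qed

lemma setf_restrict:
  assumes "S \<in> P" "T \<in> P" "U \<in> P" "S \<subseteq> T" "g \<in> Mono T U" "x \<in> fob F S"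
  shows "farr F T U g (farr F S T (incl S) x) = farr F S U (restrict g S) x"
  using setf_cmp[of S T U "incl S" g x] assms compose_incl_right[of S T g] by (simp add: Mono_incl)

end

subsection \<open>Posets as categories\<close>

text \<open>The arrow from \<open>i\<close> to \<open>j\<close>, if there is one, is named \<open>i\<close>.\<close>
definition poset_cat :: "'i set \<Rightarrow> ('i \<Rightarrow> 'i \<Rightarrow> bool) \<Rightarrow> ('i, 'i) category" where
  "poset_cat I le = \<lparr>Ob = I, Hom = (\<lambda>i j. if le i j then {i} else {}), ident = (\<lambda>i. i),
    cmp = (\<lambda>i j k g f. i)\<rparr>"

lemma poset_cat_simps [simp]:
  "Ob (poset_cat I le) = I" "u \<in> Hom (poset_cat I le) i j \<longleftrightarrow> le i j \<and> u = i"
  "ident (poset_cat I le) i = i" "cmp (poset_cat I le) i j k g f = i"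
  by (simp_all add: poset_cat_def)

lemma is_category_poset_cat:
  assumes "\<And>i. i \<in> I \<Longrightarrow> le i i"
    and "\<And>i j k. i \<in> I \<Longrightarrow> j \<in> I \<Longrightarrow> k \<in> I \<Longrightarrow> le i j \<Longrightarrow> le j k \<Longrightarrow> le i k"
  shows "is_category (poset_cat I le)"
  unfolding is_category_def Ball_def poset_cat_simps using assms(1)
  by simp (blast intro: assms(2))

lemma arrows_poset_cat: "arrows (poset_cat I le) \<subseteq> (\<lambda>(i, j). (i, j, i)) ` (I \<times> I)"
  by (auto simp: arrows_def)

lemma ex1_unique: "\<exists>!x. Q x \<Longrightarrow> Q a \<Longrightarrow> Q b \<Longrightarrow> a = b"
  by blast

lemma colimit_cocone: "is_colimit J C D c k \<Longrightarrow> is_cocone J C D c k"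
  by (simp add: is_colimit_def)

lemma colimit_universal: "is_colimit J C D c k \<Longrightarrow> is_cocone J C D c' k' \<Longrightarrow>
    \<exists>!h. h \<in> Hom C c c' \<and> (\<forall>i\<in>Ob J. cmp C (fob D i) c c' h (k i) = k' i)"
  by (simp add: is_colimit_def)

lemma Ob_le_arrows: "is_category C \<Longrightarrow> |Ob C| \<le>o |arrows C|"
  by (rule card_of_ordLeqI[where f = "\<lambda>a. (a, a, ident C a)"]) (auto simp: inj_on_def arrows_def cat_ident)

section \<open>Filtered colimits of large sets and the functors preserving them\<close>

context scott_cards
begin

abbreviation A :: "('u set, 'u \<Rightarrow> 'u) category" where "A \<equiv> Setm_ge lam \<nu>"
abbreviation Cop :: "('u set, 'u \<Rightarrow> 'u) category" where "Cop \<equiv> Setm_less_op \<kappa>"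
abbreviation E :: "('u scott_ob, 'u scott_arr) category" where "E \<equiv> S_Setm_ge \<kappa> lam \<nu>"

lemma A_eq: "A = Setm (Collect large)"
  by (simp add: Setm_ge_def large_def [abs_def])

lemma small_Times: "small I \<Longrightarrow> small J \<Longrightarrow> small (I \<times> J)"
proof -
  assume "small I" "small J"
  then have "small (\<Union>i\<in>I. Pair i ` J)" by (intro small_UN card_of_image_ordLess)
  moreover have "(\<Union>i\<in>I. Pair i ` J) = I \<times> J" by auto
  ultimately show ?thesis by simp
qed

lemma \<nu>_Times: "|I| <o \<nu> \<Longrightarrow> |J| <o \<nu> \<Longrightarrow> |I \<times> J| <o \<nu>"
proof -
  assume "|I| <o \<nu>" "|J| <o \<nu>"
  then have "|\<Union>i\<in>I. Pair i ` J| <o \<nu>" by (intro \<nu>_UN card_of_image_ordLess)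
  moreover have "(\<Union>i\<in>I. Pair i ` J) = I \<times> J" by auto
  ultimately show ?thesis by simp
qed

text \<open>A cocone on the discrete diagram with index set \<open>V\<close> is an upper bound. The
  indices are elements of \<open>'u\<close> because \<open>filtered\<close> tests diagrams over the
  same types as \<open>J\<close>.\<close>

lemma filtered_upper_bound:
  fixes J :: "('u, 'u) category" and V :: "'u set"
  assumes J: "filtered \<kappa> J" and V: "small V" and d: "\<And>v. v \<in> V \<Longrightarrow> d v \<in> Ob J"
  shows "\<exists>l\<in>Ob J. \<forall>v\<in>V. \<exists>u. u \<in> Hom J (d v) l"
proof -
  have Jc: "is_category J" using J by (simp add: filtered_def)
  let ?I = "poset_cat V (=)"
  let ?D = "\<lparr>fob = d, farr = (\<lambda>v w f. ident J (d v))\<rparr>"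
  have "small (arrows ?I)"
    using card_of_subset_ordLess[OF arrows_poset_cat] card_of_image_ordLess small_Times[OF V V] by blast
  moreover have "is_functor ?I J ?D"
    unfolding is_functor_def
    using is_category_poset_cat[of V "(=)"] Jc cat_ident[OF Jc] cat_idl[OF Jc] d by simp
  ultimately obtain c k where ck: "is_cocone ?I J ?D c k" using J unfolding filtered_def by blast
  show ?thesis
  proof (intro bexI ballI)
    show "c \<in> Ob J" using ck by (simp add: is_cocone_def)
    show "\<exists>u. u \<in> Hom J (d v) c" if "v \<in> V" for v
      using ck that unfolding is_cocone_def by (intro exI[of _ "k v"]) simp
  qed
qed

lemma filtered_nonempty:
  fixes J :: "('u, 'u) category"
  assumes "filtered \<kappa> J" shows "Ob J \<noteq> {}"
  using filtered_upper_bound[OF assms, of "{}"] small_finite[of "{}"] by auto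

lemma filtered_upper_bound2:
  fixes J :: "('u, 'u) category"
  assumes J: "filtered \<kappa> J" and ij: "i \<in> Ob J" "j \<in> Ob J"
  obtains l u v where "l \<in> Ob J" "u \<in> Hom J i l" "v \<in> Hom J j l"
proof -
  have "infinite (UNIV :: 'u set)" using inf_Field(2) rev_finite_subset[OF _ subset_UNIV] by blast
  then obtain b :: 'u where ab: "b \<noteq> undefined" using ex_new_if_finite[of "{undefined}"] by auto
  define d where "d v = (if v = b then i else j)" for v :: 'u
  have d: "d v \<in> Ob J" for v using ij by (simp add: d_def)
  obtain l where l: "l \<in> Ob J" "\<forall>v\<in>{b, undefined}. \<exists>u. u \<in> Hom J (d v) l"
    using filtered_upper_bound[OF J small_finite[of "{b, undefined}"], of d] d by blast
  obtain u v where "u \<in> Hom J (d b) l" "v \<in> Hom J (d undefined) l" using l(2) by blast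
  then show thesis using that[OF l(1), of u v] ab by (simp add: d_def)
qed

text \<open>The inclusion of the union of the images of the colimit injections admits a section, hence is
  onto.\<close>
lemma filtered_colimit_surj:
  fixes J :: "('u, 'u) category"
  assumes J: "filtered \<kappa> J" and G: "is_functor J A G" and col: "is_colimit J A G c k"
  shows "c = (\<Union>i\<in>Ob J. k i ` fob G i)"
proof -
  let ?U = "\<Union>i\<in>Ob J. k i ` fob G i"
  have c: "large c" and k: "\<And>i. i \<in> Ob J \<Longrightarrow> k i \<in> Mono (fob G i) c"
    and kc: "\<And>i j u. i \<in> Ob J \<Longrightarrow> j \<in> Ob J \<Longrightarrow> u \<in> Hom J i j \<Longrightarrow> compose (fob G i) (k j) (farr G i j u) = k i"
    using colimit_cocone[OF col] unfolding is_cocone_def A_eq by simp_all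
  have U: "?U \<subseteq> c" using Mono_image[OF k] by blast
  have g: "large (fob G i)" if "i \<in> Ob J" for i using func_ob[OF G that] by (simp add: A_eq)
  obtain i where i: "i \<in> Ob J" using filtered_nonempty[OF J] by blast
  \<comment> \<open>\<open>J\<close> is non-empty, so the union of the images contains a copy of
    some \<open>fob G i\<close> and is itself large: a legitimate target of a cocone.\<close>
  have "|fob G i| \<le>o |?U|"
    using i by (intro card_of_ordLeqI[OF Mono_inj[OF k[OF i]]]) auto
  then have lU: "large ?U"
    using g[OF i] c card_of_subset_ordLess[OF U, of \<nu>] ordLeq_transitive[of lam "|fob G i|" "|?U|"]
    by (simp add: large_def)
  have kU: "k i \<in> Mono (fob G i) ?U" if "i \<in> Ob J" for i by (rule Mono_corestrict[OF k[OF that]]) (use that in auto)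
  have "is_cocone J A G ?U k" unfolding is_cocone_def A_eq using lU kU kc by simp
  from colimit_universal[OF col this, unfolded A_eq Setm_simps]
  obtain h where h: "h \<in> Mono c ?U" "\<forall>i\<in>Ob J. compose (fob G i) h (k i) = k i" by (elim ex1E conjE)
  \<comment> \<open>The identity and \<open>h\<close> are both endomorphisms of \<open>c\<close>
    compatible with the colimit injections, hence equal; but \<open>h\<close> lands in the union of
    the images.\<close>
  have ex1: "\<exists>!h. h \<in> Mono c c \<and> (\<forall>i\<in>Ob J. compose (fob G i) h (k i) = k i)"
    using colimit_universal[OF col colimit_cocone[OF col], unfolded A_eq Setm_simps] .
  have "incl c \<in> Mono c c \<and> (\<forall>i\<in>Ob J. compose (fob G i) (incl c) (k i) = k i)"
    using compose_incl_left[OF k] by (simp add: Mono_incl)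
  moreover have "h \<in> Mono c c \<and> (\<forall>i\<in>Ob J. compose (fob G i) h (k i) = k i)"
    using Mono_mono[OF h(1) U] h(2) by simp
  ultimately have eq: "incl c = h" by (rule ex1_unique[OF ex1])
  have "x \<in> ?U" if "x \<in> c" for x using MonoD[OF h(1) that] that unfolding eq[symmetric] by simp
  then show ?thesis using U by blast
qed

lemma obtain_distinct: obtains a b :: "'u \<Rightarrow> 'u" where "a \<noteq> b"
proof -
  have "infinite (UNIV :: 'u set)" using inf_Field(2) rev_finite_subset[OF _ subset_UNIV] by blast
  then obtain b :: 'u where "b \<noteq> undefined" using ex_new_if_finite[of "{undefined}"] by auto
  then have "(\<lambda>_. b) \<noteq> (\<lambda>_. undefined :: 'u)" by (simp add: fun_eq_iff)
  then show thesis by (rule that)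
qed

lemma E_Ob: "F \<in> Ob E \<longleftrightarrow> is_functor A (Set_cat \<nu>) F \<and> preserves_filtered_colimits \<kappa> \<nu> A (Set_cat \<nu>) F"
  by (simp add: S_Setm_ge_def Scott_def full_subcat_def functor_cat_def)

lemma E_functor: "F \<in> Ob E \<Longrightarrow> is_functor (Setm (Collect large)) (Set_cat \<nu>) F"
  unfolding E_Ob A_eq by blast

lemma E_Hom: "t \<in> Hom E F G \<longleftrightarrow> t \<in> extensional (Collect large) \<and>
    (\<forall>S. large S \<longrightarrow> t S \<in> fob F S \<rightarrow>\<^sub>E fob G S) \<and>
    (\<forall>S T f. large S \<longrightarrow> large T \<longrightarrow> f \<in> Mono S T \<longrightarrow>
       compose (fob F S) (t T) (farr F S T f) = compose (fob F S) (farr G S T f) (t S))"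
  by (auto simp: S_Setm_ge_def Scott_def full_subcat_def functor_cat_def nat_trans_def A_eq)

lemma E_ident: "ident E F = (\<lambda>S\<in>Collect large. incl (fob F S))"
  and E_cmp: "cmp E F G H s t = (\<lambda>S\<in>Collect large. compose (fob F S) (s S) (t S))"
  by (simp_all add: S_Setm_ge_def Scott_def full_subcat_def functor_cat_def A_eq)

lemma is_category_E: "is_category E"
  unfolding S_Setm_ge_def Scott_def A_eq
  by (intro is_category_full_subcat is_category_functor_cat is_category_Setm is_category_Set_cat)

text \<open>Two-element test objects detect both joint surjectivity and the identifications made in a
  directed colimit of sets.\<close>
lemma directed_union:
  fixes P :: "'u set set"
  assumes F: "F \<in> Ob E" and P: "|P| <o \<nu>" and lgP: "\<And>U. U \<in> P \<Longrightarrow> large U"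
    and dir: "\<And>Q. Q \<subseteq> P \<Longrightarrow> small Q \<Longrightarrow> \<exists>U\<in>P. \<forall>V\<in>Q. V \<subseteq> U"
    and S: "S = \<Union>P" and lgS: "large S"
  shows "x \<in> fob F S \<Longrightarrow> \<exists>U\<in>P. \<exists>y\<in>fob F U. x = farr F U S (incl U) y"
    and "U \<in> P \<Longrightarrow> y \<in> fob F U \<Longrightarrow> z \<in> fob F U \<Longrightarrow> farr F U S (incl U) y = farr F U S (incl U) z \<Longrightarrow>
      \<exists>W\<in>P. U \<subseteq> W \<and> farr F U W (incl U) y = farr F U W (incl U) z"
proof -
  note Ff = E_functor[OF F]
  \<comment> \<open>\<open>preserves_filtered_colimits\<close> speaks of index categories with
    objects in \<open>'u\<close>, while \<open>P\<close> is a family of subsets of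
    \<open>'u\<close>. Having fewer than \<nu> members, it can be named by elements of
    \<open>'u\<close>, with \<open>d\<close> returning the set behind a name.\<close>
  obtain \<iota> :: "'u set \<Rightarrow> 'u" where \<iota>: "inj_on \<iota> P" using room[of "{}" P] P
    by (metis small_\<nu> small_finite finite.emptyI)
  define d where "d = inv_into P \<iota>"
  have d\<iota>: "d (\<iota> U) = U" if "U \<in> P" for U using \<iota> that by (simp add: d_def)
  define I where "I = \<iota> ` P"
  have \<iota>I [simp]: "\<iota> U \<in> I" if "U \<in> P" for U using that by (simp add: I_def)
  have dP: "d i \<in> P" if "i \<in> I" for i using that d\<iota> by (auto simp: I_def)
  let ?J = "poset_cat I (\<lambda>i j. d i \<subseteq> d j)"
  let ?G = "\<lparr>fob = d, farr = (\<lambda>i j u. incl (d i))\<rparr> :: ('u, 'u, 'u set, 'u \<Rightarrow> 'u) func"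
  have Jc: "is_category ?J" by (rule is_category_poset_cat) auto
  have dir2: "\<exists>W\<in>P. U \<subseteq> W \<and> V \<subseteq> W" if "U \<in> P" "V \<in> P" for U V
    using dir[of "{U, V}"] that small_finite[of "{U, V}"] by auto
  have dir0: "\<exists>U. U \<in> P" using dir[of "{}"] small_finite[of "{}"] by auto
  have "filtered \<kappa> ?J" unfolding filtered_def
  proof (intro conjI Jc allI impI, elim conjE)
    fix I0 :: "('u, 'u) category" and D
    assume ar: "small (arrows I0)" and D: "is_functor I0 ?J D"
    have DI: "fob D i \<in> I" if "i \<in> Ob I0" for i using func_ob[OF D that] by simp
    have "small (Ob I0)" using Ob_le_arrows[OF func_dom[OF D]] ar by (rule ordLeq_ordLess_trans)
    then have "small ((\<lambda>i. d (fob D i)) ` Ob I0)" by (rule card_of_image_ordLess)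
    moreover have "(\<lambda>i. d (fob D i)) ` Ob I0 \<subseteq> P" using dP DI by blast
    ultimately obtain U where U: "U \<in> P" "\<forall>V\<in>(\<lambda>i. d (fob D i)) ` Ob I0. V \<subseteq> U" using dir by meson
    have "is_cocone I0 ?J D (\<iota> U) (fob D)" unfolding is_cocone_def using U d\<iota> by simp
    then show "\<exists>c k. is_cocone I0 ?J D c k" by blast
  qed
  moreover have "|arrows ?J| <o \<nu>"
  proof (rule card_of_subset_ordLess[OF arrows_poset_cat])
    show "|(\<lambda>(i, j). (i, j, i)) ` (I \<times> I)| <o \<nu>"
      unfolding I_def by (intro card_of_image_ordLess \<nu>_Times P)
  qed
  moreover have "is_functor ?J A ?G"
    unfolding is_functor_def A_eq using Jc is_category_Setm lgP dP
    by (simp add: Mono_incl) (auto simp: compose_def fun_eq_iff)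
  moreover have "is_colimit ?J A ?G S (\<lambda>i. incl (d i))"
    unfolding is_colimit_def
  proof (intro conjI allI impI)
    have dS: "d i \<subseteq> S" if "i \<in> I" for i using S dP[OF that] by blast
    show "is_cocone ?J A ?G S (\<lambda>i. incl (d i))"
      unfolding is_cocone_def A_eq using lgS dS
      by (simp add: Mono_incl) (auto simp: compose_def fun_eq_iff)
    fix c k assume "is_cocone ?J A ?G c k"
    then have k: "\<And>i. i \<in> I \<Longrightarrow> k i \<in> Mono (d i) c"
      and kc: "\<And>i j. i \<in> I \<Longrightarrow> j \<in> I \<Longrightarrow> d i \<subseteq> d j \<Longrightarrow> compose (d i) (k j) (incl (d i)) = k i"
      unfolding is_cocone_def A_eq Ball_def by simp_all
    have kc': "k i s = k j s" if "i \<in> I" "j \<in> I" "d i \<subseteq> d j" "s \<in> d i" for i j s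
      using fun_cong[OF kc[OF that(1-3)], of s] that(4) by (simp add: compose_eq)
    have kk: "k i s = k j s" if ij: "i \<in> I" "j \<in> I" "s \<in> d i" "s \<in> d j" for i j s
    proof -
      obtain W where W: "W \<in> P" "d i \<subseteq> W" "d j \<subseteq> W" using dir2[OF dP[OF ij(1)] dP[OF ij(2)]] by blast
      then show ?thesis using kc'[of i "\<iota> W" s] kc'[of j "\<iota> W" s] ij d\<iota>[of W] by simp
    qed
    \<comment> \<open>Gluing: \<open>e s\<close> names some stage containing \<open>s\<close>, and
      by \<open>kk\<close> the cocone has the same value at \<open>s\<close> in any other such
      stage.\<close>
    define e where "e s = (SOME i. i \<in> I \<and> s \<in> d i)" for s
    have ex: "\<exists>i. i \<in> I \<and> s \<in> d i" if s: "s \<in> S" for s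
    proof -
      obtain U where "U \<in> P" "s \<in> U" using s S by blast
      then show ?thesis using d\<iota>[of U] by (intro exI[of _ "\<iota> U"]) simp
    qed
    have e: "e s \<in> I \<and> s \<in> d (e s)" if "s \<in> S" for s
      unfolding e_def using ex[OF that] by (rule someI_ex)
    let ?h = "\<lambda>s\<in>S. k (e s) s"
    have h: "?h \<in> Mono S c"
    proof (rule Mono_restrictI)
      show "k (e s) s \<in> c" if "s \<in> S" for s using MonoD[OF k] e[OF that] by blast
      show "inj_on (\<lambda>s. k (e s) s) S"
      proof (rule inj_onI)
        fix s t assume s: "s \<in> S" and t: "t \<in> S" and eq: "k (e s) s = k (e t) t"
        obtain W where W: "W \<in> P" "d (e s) \<subseteq> W" "d (e t) \<subseteq> W" using dir2 dP e[OF s] e[OF t] by blast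
        then have i: "\<iota> W \<in> I" "s \<in> d (\<iota> W)" "t \<in> d (\<iota> W)" using e[OF s] e[OF t] d\<iota> by auto
        then have "k (\<iota> W) s = k (\<iota> W) t" using eq kk e[OF s] e[OF t] by metis
        then show "s = t" using inj_onD[OF Mono_inj[OF k[OF i(1)]]] i by blast
      qed
    qed
    have hk: "compose (d i) ?h (incl (d i)) = k i" if i: "i \<in> I" for i
    proof (rule extensionalityI[of _ "d i"])
      show "k i \<in> extensional (d i)" using Mono_ext[OF k[OF i]] .
      fix s assume s: "s \<in> d i"
      then have sS: "s \<in> S" using dS[OF i] by blast
      show "compose (d i) ?h (incl (d i)) s = k i s"
        using kk[of "e s" i s] e[OF sS] i s sS by (simp add: compose_eq)
    qed simp
    show "\<exists>!h. h \<in> Hom A S c \<and> (\<forall>i\<in>Ob ?J. cmp A (fob ?G i) S c h (incl (d i)) = k i)"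
      unfolding A_eq
    proof (rule ex1I[of _ ?h])
      fix h' assume h': "h' \<in> Hom (Setm (Collect large)) S c \<and>
        (\<forall>i\<in>Ob ?J. cmp (Setm (Collect large)) (fob ?G i) S c h' (incl (d i)) = k i)"
      show "h' = ?h"
      proof (rule Mono_eqI[OF _ h])
        show "h' \<in> Mono S c" using h' by simp
        fix s assume s: "s \<in> S"
        then have "compose (d (e s)) h' (incl (d (e s))) = k (e s)" using h' e[OF s] by simp
        from fun_cong[OF this, of s] show "h' s = ?h s" using e[OF s] s by (simp add: compose_eq)
      qed
    qed (use h hk in simp)
  qed
  ultimately have "is_colimit ?J (Set_cat \<nu>) (comp_func F ?G) (fob F S) (\<lambda>i. farr F (d i) S (incl (d i)))"
    using F unfolding E_Ob preserves_filtered_colimits_def by fastforce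
  note univ = colimit_universal[OF this]
  obtain a b :: "'u \<Rightarrow> 'u" where ab: "a \<noteq> b" by (rule obtain_distinct)
  have ob2: "|{a, b}| <o \<nu>" by (intro small_\<nu> small_finite) simp
  have Fd: "farr F (d i) S (incl (d i)) y \<in> fob F S" if "i \<in> I" "y \<in> fob F (d i)" for i y
    using setf_incl[OF Ff, of "d i" S y] that lgP[OF dP[OF that(1)]] lgS S dP[OF that(1)] by auto
  have Fdd: "farr F (d i) (d j) (incl (d i)) y \<in> fob F (d j)"
    if "i \<in> I" "j \<in> I" "d i \<subseteq> d j" "y \<in> fob F (d i)" for i j y
    using setf_incl[OF Ff, of "d i" "d j" y] that lgP[OF dP[OF that(1)]] lgP[OF dP[OF that(2)]] by auto
  have cocone: "is_cocone ?J (Set_cat \<nu>) (comp_func F ?G) {a, b} (\<lambda>i. \<lambda>y\<in>fob F (d i). if Q i y then a else b)"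
    if Q: "\<And>i j y. i \<in> I \<Longrightarrow> j \<in> I \<Longrightarrow> d i \<subseteq> d j \<Longrightarrow> y \<in> fob F (d i) \<Longrightarrow>
       Q j (farr F (d i) (d j) (incl (d i)) y) = Q i y" for Q
    unfolding is_cocone_def using ob2 Q Fdd by (auto simp: compose_def fun_eq_iff)
  show "\<exists>U\<in>P. \<exists>y\<in>fob F U. x = farr F U S (incl U) y" if x: "x \<in> fob F S"
  proof (rule ccontr)
    assume no: "\<not> ?thesis"
    \<comment> \<open>The constant map and the map singling out \<open>x\<close> agree on everything
      coming from a stage, so uniqueness in the universal property excludes an \<open>x\<close> that
      comes from none.\<close>
    let ?h = "\<lambda>w\<in>fob F S. a" and ?h' = "\<lambda>w\<in>fob F S. if w = x then b else a"
    have ex1: "\<exists>!h. h \<in> fob F S \<rightarrow>\<^sub>E {a, b} \<and> (\<forall>i\<in>I. compose (fob F (d i)) h (farr F (d i) S (incl (d i))) =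
        (\<lambda>y\<in>fob F (d i). if True then a else b))"
      using univ[OF cocone[of "\<lambda>i y. True"]] by simp
    have "?h = ?h'"
    proof (rule ex1_unique[OF ex1])
      show "?h \<in> fob F S \<rightarrow>\<^sub>E {a, b} \<and> (\<forall>i\<in>I. compose (fob F (d i)) ?h (farr F (d i) S (incl (d i))) =
        (\<lambda>y\<in>fob F (d i). if True then a else b))"
        using Fd by (auto simp: compose_def fun_eq_iff)
      show "?h' \<in> fob F S \<rightarrow>\<^sub>E {a, b} \<and> (\<forall>i\<in>I. compose (fob F (d i)) ?h' (farr F (d i) S (incl (d i))) =
        (\<lambda>y\<in>fob F (d i). if True then a else b))"
      proof (intro conjI ballI)
        show "?h' \<in> fob F S \<rightarrow>\<^sub>E {a, b}" by auto
        fix i assume i: "i \<in> I"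
        have "farr F (d i) S (incl (d i)) y \<noteq> x" if "y \<in> fob F (d i)" for y
          using no dP[OF i] that by blast
        then show "compose (fob F (d i)) ?h' (farr F (d i) S (incl (d i))) = (\<lambda>y\<in>fob F (d i). if True then a else b)"
          unfolding compose_def by (intro restrict_ext) (simp add: Fd[OF i])
      qed
    qed
    from fun_cong[OF this, of x] show False using x ab by simp
  qed
  show "\<exists>W\<in>P. U \<subseteq> W \<and> farr F U W (incl U) y = farr F U W (incl U) z"
    if U: "U \<in> P" and y: "y \<in> fob F U" and z: "z \<in> fob F U"
      and eq: "farr F U S (incl U) y = farr F U S (incl U) z"
  proof -
    \<comment> \<open>\<open>Q i w\<close> says that \<open>w\<close> and \<open>y\<close> become
      equal at some stage. It is invariant under the transition maps, so it induces a map from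
      \<open>fob F S\<close> to the two-element object; as \<open>y\<close> and \<open>z\<close>
      have the same image in \<open>fob F S\<close>, \<open>Q\<close> holds of \<open>z\<close> as
      well.\<close>
    define Q where "Q i w \<longleftrightarrow> (\<exists>W\<in>P. U \<subseteq> W \<and> d i \<subseteq> W \<and> farr F U W (incl U) y = farr F (d i) W (incl (d i)) w)" for i w
    have Q: "Q j (farr F (d i) (d j) (incl (d i)) w) = Q i w"
      if i: "i \<in> I" and j: "j \<in> I" and ij: "d i \<subseteq> d j" and w: "w \<in> fob F (d i)" for i j w
    proof
      assume "Q j (farr F (d i) (d j) (incl (d i)) w)"
      then obtain W where W: "W \<in> P" "U \<subseteq> W" "d j \<subseteq> W"
        "farr F U W (incl U) y = farr F (d j) W (incl (d j)) (farr F (d i) (d j) (incl (d i)) w)"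
        unfolding Q_def by blast
      then have "farr F U W (incl U) y = farr F (d i) W (incl (d i)) w"
        using setf_incl_incl[OF Ff, of "d i" "d j" W w] lgP dP i j ij w by simp
      then show "Q i w" unfolding Q_def using W ij by blast
    next
      assume "Q i w"
      then obtain W where W: "W \<in> P" "U \<subseteq> W" "d i \<subseteq> W"
        "farr F U W (incl U) y = farr F (d i) W (incl (d i)) w"
        unfolding Q_def by blast
      obtain W' where W': "W' \<in> P" "W \<subseteq> W'" "d j \<subseteq> W'" using dir2[OF W(1) dP[OF j]] by blast
      have "farr F U W' (incl U) y = farr F W W' (incl W) (farr F U W (incl U) y)"
        using setf_incl_incl[OF Ff, of U W W' y] lgP U W W' y by simp
      also have "\<dots> = farr F (d i) W' (incl (d i)) w"
        unfolding W(4) using setf_incl_incl[OF Ff, of "d i" W W' w] lgP dP i W W' w by simp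
      also have "\<dots> = farr F (d j) W' (incl (d j)) (farr F (d i) (d j) (incl (d i)) w)"
        using setf_incl_incl[OF Ff, of "d i" "d j" W' w] lgP dP i j ij W' w by simp
      finally show "Q j (farr F (d i) (d j) (incl (d i)) w)" unfolding Q_def using W W' by blast
    qed
    have ex1: "\<exists>!h. h \<in> fob F S \<rightarrow>\<^sub>E {a, b} \<and> (\<forall>i\<in>I. compose (fob F (d i)) h (farr F (d i) S (incl (d i))) =
        (\<lambda>y\<in>fob F (d i). if Q i y then a else b))"
      using univ[OF cocone[of Q, OF Q]] by simp
    then obtain h where "\<forall>i\<in>I. compose (fob F (d i)) h (farr F (d i) S (incl (d i))) =
        (\<lambda>y\<in>fob F (d i). if Q i y then a else b)" by (elim ex1E conjE)
    from bspec[OF this \<iota>I[OF U], unfolded d\<iota>[OF U]]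
    have comp: "compose (fob F U) h (farr F U S (incl U)) = (\<lambda>y\<in>fob F U. if Q (\<iota> U) y then a else b)" .
    have hw: "h (farr F U S (incl U) w) = (if Q (\<iota> U) w then a else b)" if "w \<in> fob F U" for w
      using fun_cong[OF comp, of w] unfolding compose_eq[OF that] restrict_apply'[OF that] .
    have Qy: "Q (\<iota> U) y" unfolding Q_def d\<iota>[OF U] by (intro bexI[OF _ U]) simp
    have "(if Q (\<iota> U) z then a else b) = a" using hw[OF y] hw[OF z] eq Qy by simp
    then have "Q (\<iota> U) z" using ab by (cases "Q (\<iota> U) z") simp_all
    then show ?thesis unfolding Q_def d\<iota>[OF U] by blast
  qed
qed

text \<open>Injectivity on arrows identifies elements of the colimit as soon as their images agree, and small
  supports lie in a single stage.\<close>
lemma small_supports_preserve: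
  fixes F :: "'u scott_ob"
  assumes F: "is_functor (Setm (Collect large)) (Set_cat \<nu>) F"
    and inj: "\<And>S T m. large S \<Longrightarrow> large T \<Longrightarrow> m \<in> Mono S T \<Longrightarrow> inj_on (farr F S T m) (fob F S)"
    and supp: "\<And>S x. large S \<Longrightarrow> x \<in> fob F S \<Longrightarrow> \<exists>V. V \<subseteq> S \<and> small V \<and>
      (\<forall>T m. large T \<and> m \<in> Mono T S \<and> V \<subseteq> m ` T \<longrightarrow> x \<in> farr F T S m ` fob F T)"
  shows "preserves_filtered_colimits \<kappa> \<nu> A (Set_cat \<nu>) F"
  unfolding preserves_filtered_colimits_def
proof (intro allI impI, elim conjE)
  fix J :: "('u, 'u) category" and G c k
  assume J: "filtered \<kappa> J" and G: "is_functor J A G" and col: "is_colimit J A G c k"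
  have c: "large c" and k: "\<And>i. i \<in> Ob J \<Longrightarrow> k i \<in> Mono (fob G i) c"
    and kc: "\<And>i j u. i \<in> Ob J \<Longrightarrow> j \<in> Ob J \<Longrightarrow> u \<in> Hom J i j \<Longrightarrow> compose (fob G i) (k j) (farr G i j u) = k i"
    using colimit_cocone[OF col] unfolding is_cocone_def A_eq by simp_all
  have g: "large (fob G i)" if "i \<in> Ob J" for i using func_ob[OF G that] by (simp add: A_eq)
  have Gu: "farr G i j u \<in> Mono (fob G i) (fob G j)" if "i \<in> Ob J" "j \<in> Ob J" "u \<in> Hom J i j" for i j u
    using func_arr[OF G that] by (simp add: A_eq)
  have Fk: "farr F (fob G i) c (k i) \<in> fob F (fob G i) \<rightarrow>\<^sub>E fob F c" if "i \<in> Ob J" for i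
    using setf_hom[OF F _ _ k[OF that]] g[OF that] c by simp
  have FG: "farr F (fob G i) (fob G j) (farr G i j u) y \<in> fob F (fob G j)"
    if "i \<in> Ob J" "j \<in> Ob J" "u \<in> Hom J i j" "y \<in> fob F (fob G i)" for i j u y
    using setf_map[OF F _ _ Gu[OF that(1-3)] that(4)] g that by simp
  have Fkc: "farr F (fob G j) c (k j) (farr F (fob G i) (fob G j) (farr G i j u) y) = farr F (fob G i) c (k i) y"
    if "i \<in> Ob J" "j \<in> Ob J" "u \<in> Hom J i j" "y \<in> fob F (fob G i)" for i j u y
    using setf_cmp[OF F _ _ _ Gu[OF that(1-3)] k[OF that(2)] that(4)] g that c kc[OF that(1-3)] by simp
  have surj: "\<exists>i\<in>Ob J. \<exists>y\<in>fob F (fob G i). x = farr F (fob G i) c (k i) y" if x: "x \<in> fob F c" for x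
  proof -
    obtain V where V: "V \<subseteq> c" "small V"
      "\<forall>T m. large T \<and> m \<in> Mono T c \<and> V \<subseteq> m ` T \<longrightarrow> x \<in> farr F T c m ` fob F T" using supp[OF c x] by blast
    \<comment> \<open>Each point of the support comes from some stage. There are fewer than \<kappa>
      such points, so a single stage \<open>l\<close> dominates all these stages and its image
      contains the whole support.\<close>
    have "\<forall>v\<in>V. \<exists>i. i \<in> Ob J \<and> v \<in> k i ` fob G i" using V(1) filtered_colimit_surj[OF J G col] by blast
    then obtain e where e: "\<forall>v\<in>V. e v \<in> Ob J \<and> v \<in> k (e v) ` fob G (e v)" by metis
    obtain l where l: "l \<in> Ob J" "\<forall>v\<in>V. \<exists>u. u \<in> Hom J (e v) l"
      using filtered_upper_bound[OF J V(2), of e] e by blast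
    have "v \<in> k l ` fob G l" if v: "v \<in> V" for v
    proof -
      obtain u where u: "u \<in> Hom J (e v) l" using l v by blast
      obtain s where s: "s \<in> fob G (e v)" "v = k (e v) s" using e v by blast
      have ev: "e v \<in> Ob J" using e v by blast
      have "v = k l (farr G (e v) l u s)"
        using fun_cong[OF kc[OF ev l(1) u], of s] s by (simp add: compose_eq)
      then show ?thesis using MonoD[OF Gu[OF ev l(1) u] s(1)] by blast
    qed
    then have "x \<in> farr F (fob G l) c (k l) ` fob F (fob G l)" using V(3) g[OF l(1)] k[OF l(1)] by blast
    then show ?thesis using l(1) by blast
  qed
  show "is_colimit J (Set_cat \<nu>) (comp_func F G) (fob F c) (\<lambda>i. farr F (fob G i) c (k i))"
    unfolding is_colimit_def
  proof (intro conjI allI impI)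
    have "compose (fob F (fob G i)) (farr F (fob G j) c (k j)) (farr F (fob G i) (fob G j) (farr G i j u)) =
        farr F (fob G i) c (k i)" if "i \<in> Ob J" "j \<in> Ob J" "u \<in> Hom J i j" for i j u
      by (rule extensionalityI[of _ "fob F (fob G i)"])
        (use Fk[OF that(1)] Fkc[OF that] in \<open>simp_all add: compose_eq PiE_def\<close>)
    then show "is_cocone J (Set_cat \<nu>) (comp_func F G) (fob F c) (\<lambda>i. farr F (fob G i) c (k i))"
      unfolding is_cocone_def using Fk setf_card[OF F] c by simp
    fix Z q assume "is_cocone J (Set_cat \<nu>) (comp_func F G) Z q"
    then have q: "\<And>i. i \<in> Ob J \<Longrightarrow> q i \<in> fob F (fob G i) \<rightarrow>\<^sub>E Z"
      and qc: "\<And>i j u. i \<in> Ob J \<Longrightarrow> j \<in> Ob J \<Longrightarrow> u \<in> Hom J i j \<Longrightarrow>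
        compose (fob F (fob G i)) (q j) (farr F (fob G i) (fob G j) (farr G i j u)) = q i"
      unfolding is_cocone_def by simp_all
    have qc': "q j (farr F (fob G i) (fob G j) (farr G i j u) y) = q i y"
      if "i \<in> Ob J" "j \<in> Ob J" "u \<in> Hom J i j" "y \<in> fob F (fob G i)" for i j u y
      using fun_cong[OF qc[OF that(1-3)], of y] that(4) by (simp add: compose_eq)
    have wd: "q i y = q j z" if i: "i \<in> Ob J" and j: "j \<in> Ob J" and y: "y \<in> fob F (fob G i)"
      and z: "z \<in> fob F (fob G j)" and eq: "farr F (fob G i) c (k i) y = farr F (fob G j) c (k j) z" for i j y z
    proof -
      obtain l u v where l: "l \<in> Ob J" and u: "u \<in> Hom J i l" and v: "v \<in> Hom J j l"
        using filtered_upper_bound2[OF J i j] .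
      have "farr F (fob G i) (fob G l) (farr G i l u) y = farr F (fob G j) (fob G l) (farr G j l v) z"
        using inj_onD[OF inj[OF g[OF l] c k[OF l]]] Fkc[OF i l u y] Fkc[OF j l v z] eq FG[OF i l u y] FG[OF j l v z] by simp
      then show ?thesis using qc'[OF i l u y] qc'[OF j l v z] by simp
    qed
    have "\<forall>x\<in>fob F c. \<exists>p. fst p \<in> Ob J \<and> snd p \<in> fob F (fob G (fst p)) \<and> x = farr F (fob G (fst p)) c (k (fst p)) (snd p)"
      using surj by fastforce
    then obtain p where p: "\<forall>x\<in>fob F c. fst (p x) \<in> Ob J \<and> snd (p x) \<in> fob F (fob G (fst (p x))) \<and>
      x = farr F (fob G (fst (p x))) c (k (fst (p x))) (snd (p x))" by metis
    let ?h = "\<lambda>x\<in>fob F c. q (fst (p x)) (snd (p x))"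
    have h: "?h \<in> fob F c \<rightarrow>\<^sub>E Z" using p q by (auto intro!: PiE_mem[OF q])
    have hk: "compose (fob F (fob G i)) ?h (farr F (fob G i) c (k i)) = q i" if i: "i \<in> Ob J" for i
    proof (rule extensionalityI[of _ "fob F (fob G i)"])
      show "q i \<in> extensional (fob F (fob G i))" using q[OF i] by (simp add: PiE_def)
      fix y assume y: "y \<in> fob F (fob G i)"
      let ?x = "farr F (fob G i) c (k i) y"
      have x: "?x \<in> fob F c" using Fk[OF i] y by (rule PiE_mem)
      then have "q (fst (p ?x)) (snd (p ?x)) = q i y" using p wd[OF _ i _ y] by metis
      then show "compose (fob F (fob G i)) ?h (farr F (fob G i) c (k i)) y = q i y" using x y by (simp add: compose_eq)
    qed simp
    show "\<exists>!h. h \<in> Hom (Set_cat \<nu>) (fob F c) Z \<and> (\<forall>i\<in>Ob J. cmp (Set_cat \<nu>) (fob (comp_func F G) i) (fob F c) Z h (farr F (fob G i) c (k i)) = q i)"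
    proof (rule ex1I[of _ ?h])
      show "?h \<in> Hom (Set_cat \<nu>) (fob F c) Z \<and> (\<forall>i\<in>Ob J. cmp (Set_cat \<nu>) (fob (comp_func F G) i) (fob F c) Z ?h (farr F (fob G i) c (k i)) = q i)"
        using h hk by simp
      fix h' assume h': "h' \<in> Hom (Set_cat \<nu>) (fob F c) Z \<and> (\<forall>i\<in>Ob J. cmp (Set_cat \<nu>) (fob (comp_func F G) i) (fob F c) Z h' (farr F (fob G i) c (k i)) = q i)"
      show "h' = ?h"
      proof (rule extensionalityI[of _ "fob F c"])
        show "h' \<in> extensional (fob F c)" using h' by (simp add: PiE_def)
        fix x assume x: "x \<in> fob F c"
        have px: "fst (p x) \<in> Ob J" "snd (p x) \<in> fob F (fob G (fst (p x)))"
          "x = farr F (fob G (fst (p x))) c (k (fst (p x))) (snd (p x))" using p x by blast+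
        have "compose (fob F (fob G (fst (p x)))) h' (farr F (fob G (fst (p x))) c (k (fst (p x)))) = q (fst (p x))"
          using h' px(1) by simp
        from fun_cong[OF this, of "snd (p x)"] show "h' x = ?h x" using px x by (simp add: compose_eq)
      qed simp
    qed
  qed
qed

end

section \<open>Small supports\<close>

text \<open>Values of \<open>g\<close> stay in \<open>T\<close> and those of \<iota> stay off it, so
  the two pieces cannot collide. This changes an injection outside \<open>X\<close> while leaving it
  alone on \<open>X\<close>.\<close>

lemma Mono_mix:
  assumes g: "inj_on g (S \<inter> X)" "g ` (S \<inter> X) \<subseteq> T" and \<iota>: "inj_on \<iota> S" "\<iota> ` S \<inter> T = {}"
  shows "(\<lambda>s\<in>S. if s \<in> X then g s else \<iota> s) \<in> Mono S (T \<union> \<iota> ` S)"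
proof (rule Mono_restrictI)
  show "(if s \<in> X then g s else \<iota> s) \<in> T \<union> \<iota> ` S" if "s \<in> S" for s
    using g(2) that by auto
  show "inj_on (\<lambda>s. if s \<in> X then g s else \<iota> s) S"
  proof (rule inj_onI)
    fix s t assume st: "s \<in> S" "t \<in> S" and eq: "(if s \<in> X then g s else \<iota> s) = (if t \<in> X then g t else \<iota> t)"
    have gT: "g u \<in> T" if "u \<in> S" "u \<in> X" for u using g(2) that by blast
    have \<iota>T: "\<iota> u \<notin> T" if "u \<in> S" for u using \<iota>(2) that by blast
    consider "s \<in> X" "t \<in> X" | "s \<notin> X" "t \<notin> X" using eq gT \<iota>T st by metis
    then show "s = t"
    proof cases
      case 1 then show ?thesis using eq inj_onD[OF g(1)] st by simp
    next
      case 2 then show ?thesis using eq inj_onD[OF \<iota>(1)] st by simp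
    qed
  qed
qed

lemma Mono_inverse:
  assumes m: "m \<in> Mono S T"
  obtains n where "n \<in> Mono (m ` S) S" "compose S n m = incl S"
proof
  show "restrict (inv_into S m) (m ` S) \<in> Mono (m ` S) S"
    by (rule Mono_restrictI) (auto simp: inv_into_into inj_on_inv_into)
  show "compose S (restrict (inv_into S m) (m ` S)) m = incl S"
    unfolding compose_def using inv_into_f_f[OF Mono_inj[OF m]] by (intro restrict_ext) simp
qed

context scott_cards
begin

text \<open>\<open>S\<close> is the union of the sets \<open>B \<union> V\<close> with
  \<open>V\<close> a small subset of \<open>S\<close>. Regularity of \<kappa> makes this family
  \<kappa>-directed, and its members contain \<open>B\<close>, so they are large and
  \<open>F\<close> is defined on them. The two conclusions are the two halves of
  \<open>directed_union\<close>.\<close>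

lemma E_base:
  assumes F: "F \<in> Ob E" and S: "large S" and B: "B \<subseteq> S" "lam \<le>o |B|"
  shows "x \<in> fob F S \<Longrightarrow> \<exists>V y. V \<subseteq> S \<and> small V \<and> y \<in> fob F (B \<union> V) \<and> x = farr F (B \<union> V) S (incl (B \<union> V)) y"
    and "y \<in> fob F B \<Longrightarrow> z \<in> fob F B \<Longrightarrow> farr F B S (incl B) y = farr F B S (incl B) z \<Longrightarrow>
      \<exists>V. V \<subseteq> S \<and> small V \<and> farr F B (B \<union> V) (incl B) y = farr F B (B \<union> V) (incl B) z"
proof -
  let ?P = "(\<lambda>V. B \<union> V) ` smallsub S"
  have P: "|?P| <o \<nu>" using smallsub_\<nu> S by (intro card_of_image_ordLess) (simp add: large_def)
  have lgP: "large U" if "U \<in> ?P" for U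
  proof -
    have "B \<subseteq> U" "U \<subseteq> S" using that B by (auto simp: smallsub_def)
    then show ?thesis using S B(2) card_of_subset_ordLess card_of_subset_ordLeq unfolding large_def by blast
  qed
  have dir: "\<exists>U\<in>?P. \<forall>V\<in>Q. V \<subseteq> U" if Q: "Q \<subseteq> ?P" "small Q" for Q
  proof -
    have "\<forall>q\<in>Q. \<exists>V. V \<in> smallsub S \<and> q = B \<union> V" using Q(1) by blast
    then obtain f where f: "\<forall>q\<in>Q. f q \<in> smallsub S \<and> q = B \<union> f q" by metis
    have "small (\<Union>q\<in>Q. f q)" using f by (intro small_UN Q(2)) (auto simp: smallsub_def)
    then have "(\<Union>q\<in>Q. f q) \<in> smallsub S" using f by (auto simp: smallsub_def)
    moreover have "\<forall>q\<in>Q. q \<subseteq> B \<union> (\<Union>q\<in>Q. f q)" using f by blast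
    ultimately show ?thesis by blast
  qed
  have SP: "S = \<Union>?P"
  proof
    show "S \<subseteq> \<Union>?P"
    proof
      fix s assume "s \<in> S"
      then have "{s} \<in> smallsub S" using small_finite[of "{s}"] by (simp add: smallsub_def)
      then show "s \<in> \<Union>?P" by blast
    qed
    show "\<Union>?P \<subseteq> S" using B(1) by (auto simp: smallsub_def)
  qed
  have du1: "\<exists>U\<in>?P. \<exists>y\<in>fob F U. x = farr F U S (incl U) y" if "x \<in> fob F S"
    by (rule directed_union(1)[OF F P lgP dir SP S that])
  have du2: "\<exists>W\<in>?P. B \<subseteq> W \<and> farr F B W (incl B) y = farr F B W (incl B) z"
    if "B \<in> ?P" "y \<in> fob F B" "z \<in> fob F B" "farr F B S (incl B) y = farr F B S (incl B) z"
    by (rule directed_union(2)[OF F P lgP dir SP S that])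
  show "\<exists>V y. V \<subseteq> S \<and> small V \<and> y \<in> fob F (B \<union> V) \<and> x = farr F (B \<union> V) S (incl (B \<union> V)) y" if "x \<in> fob F S"
    using du1[OF that] by (auto simp: smallsub_def)
  \<comment> \<open>\<open>B\<close> itself is the stage given by the empty set, so an
    identification over \<open>S\<close> can start from it.\<close>
  have BP: "B \<in> ?P" using small_finite[of "{}"] by (intro image_eqI[of _ _ "{}"]) (simp_all add: smallsub_def)
  show "\<exists>V. V \<subseteq> S \<and> small V \<and> farr F B (B \<union> V) (incl B) y = farr F B (B \<union> V) (incl B) z"
    if "y \<in> fob F B" "z \<in> fob F B" "farr F B S (incl B) y = farr F B S (incl B) z"
    using du2[OF BP that] by (auto simp: smallsub_def)
qed

text \<open>Elements of \<open>F S\<close> already live over half of \<open>S\<close> and few further points, and the other half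
  leaves room to retract \<open>S \<union> V\<close> into \<open>S\<close>.\<close>
lemma E_inj_incl:
  assumes F: "F \<in> Ob E" and S: "large S" and T: "large T" and ST: "S \<subseteq> T"
  shows "inj_on (farr F S T (incl S)) (fob F S)"
proof (rule inj_onI)
  note Ff = E_functor[OF F]
  fix x y assume x: "x \<in> fob F S" and y: "y \<in> fob F S" and "farr F S T (incl S) x = farr F S T (incl S) y"
  \<comment> \<open>With \<open>B\<close> taken to be \<open>S\<close>, the identification over
    \<open>T\<close> already happens after adding a small \<open>V\<close> to
    \<open>S\<close>.\<close>
  then obtain V where V: "V \<subseteq> T" "small V" and eq: "farr F S (S \<union> V) (incl S) x = farr F S (S \<union> V) (incl S) y"
    using E_base(2)[OF F T ST _ x y] S unfolding large_def by blast
  have lS: "lam \<le>o |S|" using S by (simp add: large_def)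
  have lSV: "large (S \<union> V)" using large_Un[OF S small_\<nu>[OF V(2)]] .
  obtain S0 S1 where h: "S = S0 \<union> S1" "S0 \<inter> S1 = {}" "|S0| =o |S|" "|S1| =o |S|"
    by (rule infinite_halves[OF large_infinite[OF lS]])
  have l01: "lam \<le>o |S0|" "lam \<le>o |S1|"
    using ordLeq_ordIso_trans[OF lS ordIso_symmetric[OF h(3)]] ordLeq_ordIso_trans[OF lS ordIso_symmetric[OF h(4)]] by simp_all
  have S1S: "S1 \<subseteq> S" using h(1) by blast
  obtain Vx x0 where vx: "Vx \<subseteq> S" "small Vx" "x0 \<in> fob F (S1 \<union> Vx)" "x = farr F (S1 \<union> Vx) S (incl (S1 \<union> Vx)) x0"
    using E_base(1)[OF F S S1S l01(2) x] by blast
  obtain Vy y0 where vy: "Vy \<subseteq> S" "small Vy" "y0 \<in> fob F (S1 \<union> Vy)" "y = farr F (S1 \<union> Vy) S (incl (S1 \<union> Vy)) y0"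
    using E_base(1)[OF F S S1S l01(2) y] by blast
  define K where "K = Vx \<union> Vy"
  have K: "small K" "K \<subseteq> S" using vx vy by (auto simp: K_def small_Un)
  let ?D = "(S \<union> V) - (S1 \<union> K)"
  have "|?D| \<le>o |S \<union> V|" by (rule card_of_mono1) blast
  also have "|S \<union> V| =o |S|"
    using small_large[OF V(2) lS] by (intro infinite_card_of_Un large_infinite lS ordLess_imp_ordLeq)
  also have "|S| =o |S0|" using h(3) by (rule ordIso_symmetric)
  also have "|S0| =o |S0 - K|"
    by (rule ordIso_symmetric[OF infinite_card_of_Diff[OF large_infinite[OF l01(1)] small_large[OF K(1) l01(1)]]])
  finally have "|?D| \<le>o |S0 - K|" .
  then obtain \<iota> where \<iota>: "inj_on \<iota> ?D" "\<iota> ` ?D \<subseteq> S0 - K" using card_of_ordLeq[of ?D "S0 - K"] by blast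
  \<comment> \<open>\<rho> fixes \<open>S1 \<union> K\<close> and moves everything else in
    \<open>S \<union> V\<close>, including the rest of \<open>S0\<close>, into
    \<open>S0 - K\<close>. It does not have to fix \<open>S\<close> pointwise: \<open>x\<close> and
    \<open>y\<close> come from subsets of \<open>S1 \<union> K\<close>.\<close>
  define \<rho> where "\<rho> = (\<lambda>s\<in>S \<union> V. if s \<in> S1 \<union> K then s else \<iota> s)"
  have \<rho>: "\<rho> \<in> Mono (S \<union> V) S" unfolding \<rho>_def
  proof (rule Mono_restrictI)
    have i: "\<iota> s \<in> S0 - K" if "s \<in> S \<union> V" "s \<notin> S1 \<union> K" for s using \<iota>(2) that by blast
    show "(if s \<in> S1 \<union> K then s else \<iota> s) \<in> S" if "s \<in> S \<union> V" for s
      using i[OF that] h(1) K(2) by auto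
    show "inj_on (\<lambda>s. if s \<in> S1 \<union> K then s else \<iota> s) (S \<union> V)"
    proof (rule inj_onI)
      fix s t assume st: "s \<in> S \<union> V" "t \<in> S \<union> V" "(if s \<in> S1 \<union> K then s else \<iota> s) = (if t \<in> S1 \<union> K then t else \<iota> t)"
      have ni: "\<iota> u \<notin> S1 \<union> K" if "u \<in> S \<union> V" "u \<notin> S1 \<union> K" for u using i[OF that] h(2) by blast
      consider "s \<in> S1 \<union> K" "t \<in> S1 \<union> K" | "s \<notin> S1 \<union> K" "t \<notin> S1 \<union> K" using st ni by metis
      then show "s = t"
      proof cases
        case 1 then show ?thesis using st by simp
      next
        case 2 then show ?thesis using st inj_onD[OF \<iota>(1), of s t] by simp
      qed
    qed
  qed
  have retract: "farr F (S \<union> V) S \<rho> (farr F S (S \<union> V) (incl S) z) = z"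
    if W: "W \<subseteq> K" and w: "w \<in> fob F (S1 \<union> W)" and z: "z = farr F (S1 \<union> W) S (incl (S1 \<union> W)) w" for W w z
  proof -
    have WS: "S1 \<union> W \<subseteq> S" using S1S W K by blast
    have lW: "large (S1 \<union> W)"
      using card_of_subset_ordLeq[of S1 "S1 \<union> W", OF _ l01(2)] card_of_subset_ordLess[OF WS] S unfolding large_def by blast
    have zS: "z \<in> fob F S" using setf_incl[OF Ff, of "S1 \<union> W" S w] lW S WS w z by simp
    have \<rho>S: "restrict \<rho> S \<in> Mono S S" using Mono_restrict[OF \<rho>] by blast
    have "farr F (S \<union> V) S \<rho> (farr F S (S \<union> V) (incl S) z) = farr F S S (restrict \<rho> S) z"
      using setf_restrict[OF Ff, of S "S \<union> V" S \<rho> z] S lSV \<rho> zS by simp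
    also have "\<dots> = farr F (S1 \<union> W) S (restrict (restrict \<rho> S) (S1 \<union> W)) w"
      unfolding z using setf_restrict[OF Ff, of "S1 \<union> W" S S "restrict \<rho> S" w] S lW WS \<rho>S w by simp
    also have "restrict (restrict \<rho> S) (S1 \<union> W) = incl (S1 \<union> W)"
      using WS W by (intro restrict_ext) (auto simp: \<rho>_def)
    finally show ?thesis unfolding z[symmetric] .
  qed
  have "x = farr F (S \<union> V) S \<rho> (farr F S (S \<union> V) (incl S) x)" using retract[OF _ vx(3,4)] by (simp add: K_def)
  also have "\<dots> = y" unfolding eq using retract[OF _ vy(3,4)] by (simp add: K_def)
  finally show "x = y" .
qed

text \<open>Every injection is a bijection onto its image, which \<open>F\<close> sends to something
  invertible, followed by an inclusion.\<close>

lemma E_inj: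
  assumes F: "F \<in> Ob E" and S: "large S" and T: "large T" and m: "m \<in> Mono S T"
  shows "inj_on (farr F S T m) (fob F S)"
proof (rule inj_onI)
  note Ff = E_functor[OF F]
  fix x y assume x: "x \<in> fob F S" and y: "y \<in> fob F S" and eq: "farr F S T m x = farr F S T m y"
  have mS: "m ` S \<subseteq> T" using Mono_image[OF m] .
  have m': "m \<in> Mono S (m ` S)" using Mono_corestrict[OF m] by blast
  obtain n where n: "n \<in> Mono (m ` S) S" "compose S n m = incl S" using Mono_inverse[OF m] .
  have "lam \<le>o |m ` S|" using S Mono_card[OF m'] ordLeq_transitive unfolding large_def by blast
  then have lm: "large (m ` S)" using card_of_subset_ordLess[OF mS] T unfolding large_def by blast
  have split: "farr F (m ` S) T (incl (m ` S)) (farr F S (m ` S) m z) = farr F S T m z" if "z \<in> fob F S" for z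
    using setf_cmp[OF Ff, of S "m ` S" T m "incl (m ` S)" z] S T lm m' that mS
    by (simp add: Mono_incl compose_incl_left[OF m'])
  have mem: "farr F S (m ` S) m z \<in> fob F (m ` S)" if "z \<in> fob F S" for z
    using setf_map[OF Ff _ _ m' that] S lm by simp
  have "farr F S (m ` S) m x = farr F S (m ` S) m y"
    using inj_onD[OF E_inj_incl[OF F lm T mS]] split[OF x] split[OF y] eq mem[OF x] mem[OF y] by simp
  moreover have "farr F (m ` S) S n (farr F S (m ` S) m z) = z" if "z \<in> fob F S" for z
    using setf_cmp[OF Ff _ _ _ m' n(1) that] S lm n(2) setf_ident[OF Ff _ that] by simp
  ultimately show "x = y" using x y by metis
qed

lemma E_support_lam:
  assumes F: "F \<in> Ob E" and S: "|S| =o lam" and x: "x \<in> fob F S"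
  shows "\<exists>K. K \<subseteq> S \<and> small K \<and> (\<forall>T g h. large T \<longrightarrow> g \<in> Mono S T \<longrightarrow> h \<in> Mono S T \<longrightarrow>
    (\<forall>s\<in>K. g s = h s) \<longrightarrow> farr F S T g x = farr F S T h x)"
proof -
  note Ff = E_functor[OF F] and lS = lam_large[OF S]
  then have lS': "lam \<le>o |S|" by (simp add: large_def)
  obtain S0 S1 where h: "S = S0 \<union> S1" "S0 \<inter> S1 = {}" "|S0| =o |S|" "|S1| =o |S|"
    by (rule infinite_halves[OF large_infinite[OF lS']])
  have l01: "lam \<le>o |S0|" "lam \<le>o |S1|"
    using ordLeq_ordIso_trans[OF lS' ordIso_symmetric[OF h(3)]] ordLeq_ordIso_trans[OF lS' ordIso_symmetric[OF h(4)]] by simp_all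
  have S01: "S0 \<subseteq> S" "S1 \<subseteq> S" using h(1) by blast+
  obtain V y where V: "V \<subseteq> S" "small V" "y \<in> fob F (S1 \<union> V)" "x = farr F (S1 \<union> V) S (incl (S1 \<union> V)) y"
    using E_base(1)[OF F lS S01(2) l01(2) x] by blast
  obtain W z where W: "W \<subseteq> S" "small W" "z \<in> fob F (S0 \<union> W)" "x = farr F (S0 \<union> W) S (incl (S0 \<union> W)) z"
    using E_base(1)[OF F lS S01(1) l01(1) x] by blast
  have lg1: "large (S1 \<union> V)" "large (S0 \<union> W)"
    using card_of_subset_ordLeq[of S1 "S1 \<union> V", OF _ l01(2)] card_of_subset_ordLeq[of S0 "S0 \<union> W", OF _ l01(1)]
      card_of_subset_ordLess[of "S1 \<union> V" S] card_of_subset_ordLess[of "S0 \<union> W" S] lS S01 V(1) W(1)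
    unfolding large_def by blast+
  define K where "K = V \<union> W"
  have K: "K \<subseteq> S" "small K" using V W by (auto simp: K_def small_Un)
  show ?thesis
  proof (intro exI[of _ K] conjI K allI impI)
    fix T g h assume T: "large T" and g: "g \<in> Mono S T" and h': "h \<in> Mono S T" and gh: "\<forall>s\<in>K. g s = h s"
    have "|T| <o \<nu>" "|S| <o \<nu>" using T lS by (simp_all add: large_def)
    then obtain \<iota> where \<iota>: "inj_on \<iota> S" "\<iota> ` S \<inter> T = {}" by (rule room)
    \<comment> \<open>The larger target: \<open>T\<close> together with a fresh copy of
      \<open>S\<close>.\<close>
    let ?T = "T \<union> \<iota> ` S"
    have T': "large ?T" using lS by (intro large_Un[OF T] card_of_image_ordLess) (simp add: large_def)
    \<comment> \<open>\<open>k\<close> depends only on the common values of \<open>g\<close> and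
      \<open>h\<close> on \<open>K\<close>, so both can be joined to it.\<close>
    define k where "k = (\<lambda>s\<in>S. if s \<in> K then g s else \<iota> s)"
    have zigzag: "farr F T ?T (incl T) (farr F S T f x) = farr F S ?T k x"
      if f: "f \<in> Mono S T" and fk: "\<forall>s\<in>K. f s = g s" for f
    proof -
      have f': "f \<in> Mono S ?T" using Mono_mono[OF f] by blast
      have fin: "inj_on f (S \<inter> X)" "f ` (S \<inter> X) \<subseteq> T" for X
        using Mono_inj[OF f] Mono_image[OF f] by (auto simp: inj_on_def)
      \<comment> \<open>\<open>?f1\<close> agrees with \<open>f\<close> on
        \<open>S1 \<union> V\<close> and with \<open>k\<close> on \<open>S0 \<union> W\<close>.
        Since \<open>x\<close> comes from both of these sets, neither replacement changes its
        image.\<close>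
      let ?f1 = "\<lambda>s\<in>S. if s \<in> S1 \<union> K then f s else \<iota> s"
      have k: "k = (\<lambda>s\<in>S. if s \<in> K then f s else \<iota> s)" unfolding k_def using fk by (intro restrict_ext) simp
      have k': "k \<in> Mono S ?T" unfolding k by (rule Mono_mix[OF fin \<iota>])
      have f1: "?f1 \<in> Mono S ?T" by (rule Mono_mix[OF fin \<iota>])
      have "farr F T ?T (incl T) (farr F S T f x) = farr F S ?T f x"
        using setf_cmp[OF Ff, of S T ?T f "incl T" x] lS T T' f x by (simp add: Mono_incl compose_incl_left)
      also have "\<dots> = farr F (S1 \<union> V) ?T (restrict f (S1 \<union> V)) y"
        unfolding V(4) using setf_restrict[OF Ff, of "S1 \<union> V" S ?T f y] lS T' lg1 f' V S01 by simp
      also have "restrict f (S1 \<union> V) = restrict ?f1 (S1 \<union> V)"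
        using S01 V by (intro restrict_ext) (auto simp: K_def)
      also have "farr F (S1 \<union> V) ?T (restrict ?f1 (S1 \<union> V)) y = farr F S ?T ?f1 x"
        unfolding V(4) using setf_restrict[OF Ff, of "S1 \<union> V" S ?T ?f1 y] lS T' lg1 f1 V S01 by simp
      also have "\<dots> = farr F (S0 \<union> W) ?T (restrict ?f1 (S0 \<union> W)) z"
        unfolding W(4) using setf_restrict[OF Ff, of "S0 \<union> W" S ?T ?f1 z] lS T' lg1 f1 W S01 by simp
      also have "restrict ?f1 (S0 \<union> W) = restrict k (S0 \<union> W)"
        unfolding k using S01 W h(2) by (intro restrict_ext) (auto simp: K_def)
      also have "farr F (S0 \<union> W) ?T (restrict k (S0 \<union> W)) z = farr F S ?T k x"
        unfolding W(4) using setf_restrict[OF Ff, of "S0 \<union> W" S ?T k z] lS T' lg1 k' W S01 by simp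
      finally show ?thesis .
    qed
    \<comment> \<open>The images agree in the enlarged target; injectivity of \<open>F\<close> on
      the inclusion of \<open>T\<close> brings the equality back.\<close>
    have "farr F T ?T (incl T) (farr F S T g x) = farr F T ?T (incl T) (farr F S T h x)"
      using zigzag[OF g] zigzag[OF h'] gh by simp
    moreover have "farr F S T f x \<in> fob F T" if "f \<in> Mono S T" for f
      using setf_map[OF Ff _ _ that x] lS T by simp
    ultimately show "farr F S T g x = farr F S T h x"
      using inj_onD[OF E_inj_incl[OF F T T']] g h' by blast
  qed
qed

subsection \<open>The representable functors\<close>

lemma R_ob_simps [simp]: "fob (R_ob V) S = Mono V S" "farr (R_ob V) S T f = (\<lambda>h\<in>Mono V S. compose V f h)"
  by (simp_all add: R_ob_def)

text \<open>Closure of the universe under powers with small exponents is what keeps the values of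
  \<open>R_ob V\<close> inside it.\<close>

lemma Mono_card_\<nu>: "small V \<Longrightarrow> |S| <o \<nu> \<Longrightarrow> |Mono V S| <o \<nu>" for V S :: "'u set"
proof -
  assume V: "small V" and S: "|S| <o \<nu>"
  then have "|S| ^c |V| <o \<nu>" using universe by (simp add: universe_def)
  then have "|Func V S| <o \<nu>" by (simp add: BNF_Cardinal_Arithmetic.cexp_def Field_card_of)
  moreover have "Mono V S \<subseteq> Func V S"
    by (auto simp: Mono_def Func_def PiE_def extensional_def)
  ultimately show ?thesis using card_of_subset_ordLess by blast
qed

lemma R_ob_functor:
  assumes V: "small V" shows "is_functor (Setm (Collect large)) (Set_cat \<nu>) (R_ob V)"
  unfolding set_functor_iff using Mono_card_\<nu>[OF V]
  by (simp add: large_def Mono_compose compose_incl_left compose_assoc_Mono)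

text \<open>An injection out of \<open>V\<close> is supported on its image, which is small, and
  composing with an injection loses nothing; so \<open>small_supports_preserve\<close>
  applies.\<close>

lemma R_ob_E: assumes V: "small V" shows "R_ob V \<in> Ob E"
  unfolding E_Ob A_eq
proof (intro conjI R_ob_functor[OF V] small_supports_preserve[unfolded A_eq])
  fix S T :: "'u set" and m assume m: "m \<in> Mono S T"
  show "inj_on (farr (R_ob V) S T m) (fob (R_ob V) S)"
  proof (rule inj_onI)
    fix x y assume x: "x \<in> fob (R_ob V) S" and y: "y \<in> fob (R_ob V) S" and "farr (R_ob V) S T m x = farr (R_ob V) S T m y"
    then have eq: "compose V m x = compose V m y" and x': "x \<in> Mono V S" and y': "y \<in> Mono V S" by simp_all
    show "x = y"
    proof (rule Mono_eqI[OF x' y'])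
      fix v assume v: "v \<in> V"
      then have "m (x v) = m (y v)" using fun_cong[OF eq, of v] by (simp add: compose_eq)
      then show "x v = y v" using inj_onD[OF Mono_inj[OF m]] MonoD[OF x' v] MonoD[OF y' v] by blast
    qed
  qed
next
  fix S x assume "large S" and "x \<in> fob (R_ob V) S"
  then have x: "x \<in> Mono V S" by simp
  show "\<exists>W. W \<subseteq> S \<and> small W \<and> (\<forall>T m. large T \<and> m \<in> Mono T S \<and> W \<subseteq> m ` T \<longrightarrow> x \<in> farr (R_ob V) T S m ` fob (R_ob V) T)"
  proof (intro exI[of _ "x ` V"] conjI allI impI; (elim conjE)?)
    show "x ` V \<subseteq> S" using Mono_image[OF x] .
    show "small (x ` V)" using V by (rule card_of_image_ordLess)
    fix T m assume m: "m \<in> Mono T S" and sub: "x ` V \<subseteq> m ` T"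
    let ?y = "\<lambda>v\<in>V. inv_into T m (x v)"
    have xm: "x v \<in> m ` T" if "v \<in> V" for v using sub that by blast
    have y: "?y \<in> Mono V T"
    proof (rule Mono_restrictI)
      show "inv_into T m (x v) \<in> T" if "v \<in> V" for v using xm[OF that] by (rule inv_into_into)
      show "inj_on (\<lambda>v. inv_into T m (x v)) V"
      proof (rule inj_onI)
        fix v w assume v: "v \<in> V" and w: "w \<in> V" and "inv_into T m (x v) = inv_into T m (x w)"
        then have "x v = x w" using inv_into_injective[OF _ xm[OF v] xm[OF w]] by blast
        then show "v = w" using inj_onD[OF Mono_inj[OF x]] v w by blast
      qed
    qed
    have "compose V m ?y = x"
      by (rule Mono_eqI[OF Mono_compose[OF y m] x]) (simp add: compose_eq f_inv_into_f[OF xm])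
    then show "x \<in> farr (R_ob V) T S m ` fob (R_ob V) T" using y by (intro image_eqI[of _ _ ?y]) simp_all
  qed
qed

section \<open>Transformations out of \<open>R_ob V\<close> as elements supported in
  \<open>V\<close>\<close>

lemma R_Hom: "t \<in> Hom E (R_ob V) F \<longleftrightarrow> t \<in> extensional (Collect large) \<and>
    (\<forall>S. large S \<longrightarrow> t S \<in> Mono V S \<rightarrow>\<^sub>E fob F S) \<and>
    (\<forall>S T g k. large S \<longrightarrow> large T \<longrightarrow> g \<in> Mono S T \<longrightarrow> k \<in> Mono V S \<longrightarrow> t T (compose V g k) = farr F S T g (t S k))"
proof -
  have "compose (Mono V S) (t T) (\<lambda>h\<in>Mono V S. compose V f h) = compose (Mono V S) (farr F S T f) (t S) \<longleftrightarrow>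
    (\<forall>k\<in>Mono V S. t T (compose V f k) = farr F S T f (t S k))" for S T f
    by (auto simp: compose_def fun_eq_iff)
  then show ?thesis unfolding E_Hom by (simp add: Ball_def)
qed

lemma R_HomD:
  assumes "t \<in> Hom E (R_ob V) F"
  shows "t \<in> extensional (Collect large)" and "large S \<Longrightarrow> t S \<in> Mono V S \<rightarrow>\<^sub>E fob F S"
    and "large S \<Longrightarrow> k \<in> Mono V S \<Longrightarrow> t S k \<in> fob F S"
    and "large S \<Longrightarrow> large T \<Longrightarrow> g \<in> Mono S T \<Longrightarrow> k \<in> Mono V S \<Longrightarrow> farr F S T g (t S k) = t T (compose V g k)"
  using assms unfolding R_Hom by (blast dest: PiE_mem, blast dest: PiE_mem, blast dest: PiE_mem, metis)

lemma R_Hom_eqI: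
  assumes t: "t \<in> Hom E (R_ob V) F" and t': "t' \<in> Hom E (R_ob V) F"
    and eq: "\<And>T k. large T \<Longrightarrow> k \<in> Mono V T \<Longrightarrow> t T k = t' T k"
  shows "t = t'"
proof (rule extensionalityI[OF R_HomD(1)[OF t] R_HomD(1)[OF t']])
  fix T assume "T \<in> Collect large"
  then have T: "large T" by simp
  show "t T = t' T"
    by (rule extensionalityI[of _ "Mono V T"])
      (use R_HomD(2)[OF t T] R_HomD(2)[OF t' T] eq[OF T] in \<open>simp_all add: PiE_def\<close>)
qed

lemma R_Hom_restrictI:
  assumes "\<And>S k. large S \<Longrightarrow> k \<in> Mono V S \<Longrightarrow> t S k \<in> fob F S"
    and "\<And>S T g k. large S \<Longrightarrow> large T \<Longrightarrow> g \<in> Mono S T \<Longrightarrow> k \<in> Mono V S \<Longrightarrow> t T (compose V g k) = farr F S T g (t S k)"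
  shows "(\<lambda>S\<in>Collect large. \<lambda>k\<in>Mono V S. t S k) \<in> Hom E (R_ob V) F"
  unfolding R_Hom using assms by (simp add: Mono_compose)

text \<open>As \<open>S\<close> has size \<open>lam\<close>, any injection \<open>k\<close> from
  \<open>V\<close> into a large \<open>T\<close> extends to \<open>S\<close>. The transformation
  sends \<open>k\<close> to the image of \<open>x\<close> under such an extension, and the support
  condition makes it independent of the choice \<open>e\<close>.\<close>

lemma R_Hom_yoneda_lam:
  assumes F: "F \<in> Ob E" and S: "|S| =o lam" and V: "V \<subseteq> S" "small V" and x: "x \<in> fob F S"
    and supp: "\<And>T g h. large T \<Longrightarrow> g \<in> Mono S T \<Longrightarrow> h \<in> Mono S T \<Longrightarrow> (\<forall>v\<in>V. g v = h v) \<Longrightarrow> farr F S T g x = farr F S T h x"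
  shows "\<exists>t\<in>Hom E (R_ob V) F. t S (incl V) = x"
proof -
  note Ff = E_functor[OF F] and lS = lam_large[OF S]
  have "\<exists>g. g \<in> Mono S T \<and> (\<forall>v\<in>V. g v = k v)" if T: "large T" and k: "k \<in> Mono V T" for T k
    using Mono_extend[OF k V(2,1) _ lam_le_large[OF S T]] T unfolding large_def by metis
  then obtain e where e: "\<And>T k. large T \<Longrightarrow> k \<in> Mono V T \<Longrightarrow> e T k \<in> Mono S T \<and> (\<forall>v\<in>V. e T k v = k v)" by metis
  let ?t = "\<lambda>S'\<in>Collect large. \<lambda>k\<in>Mono V S'. farr F S S' (e S' k) x"
  have "?t \<in> Hom E (R_ob V) F"
  proof (rule R_Hom_restrictI)
    show "farr F S S' (e S' k) x \<in> fob F S'" if "large S'" "k \<in> Mono V S'" for S' k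
      using setf_map[OF Ff, of S S' "e S' k" x] e[OF that] that lS x by simp
    fix U T g k assume U: "large U" and T: "large T" and g: "g \<in> Mono U T" and k: "k \<in> Mono V U"
    have "farr F U T g (farr F S U (e U k) x) = farr F S T (compose S g (e U k)) x"
      using setf_cmp[OF Ff, of S U T "e U k" g x] e[OF U k] g lS U T x by simp
    also have "\<dots> = farr F S T (e T (compose V g k)) x"
    proof (rule supp[OF T])
      show "compose S g (e U k) \<in> Mono S T" using e[OF U k] g Mono_compose by blast
      show "e T (compose V g k) \<in> Mono S T" using e[OF T Mono_compose[OF k g]] by blast
      show "\<forall>v\<in>V. compose S g (e U k) v = e T (compose V g k) v"
        using e[OF U k] e[OF T Mono_compose[OF k g]] V(1) by (auto simp: compose_eq)
    qed
    finally show "farr F S T (e T (compose V g k)) x = farr F U T g (farr F S U (e U k) x)" by simp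
  qed
  moreover have "?t S (incl V) = x"
  proof -
    have i: "incl V \<in> Mono V S" using V(1) by (rule Mono_incl)
    have "farr F S S (e S (incl V)) x = farr F S S (incl S) x"
      by (rule supp[OF lS]) (use e[OF lS i] V(1) in \<open>auto simp: Mono_incl\<close>)
    then show ?thesis using setf_ident[OF Ff, of S x] lS x i by simp
  qed
  ultimately show ?thesis by blast
qed

text \<open>\<open>S\<close> may be too big to embed in a given \<open>T\<close>. So the equality is
  first brought down to a subset \<open>S0\<close> of size \<open>lam\<close>, by injectivity of
  \<open>F\<close> on inclusions, and then carried from \<open>S0\<close> to \<open>T\<close> along
  an extension of \<open>k\<close>.\<close>

lemma R_Hom_uniq:
  assumes F: "F \<in> Ob E" and V: "small V" "V \<subseteq> S" and S: "large S"
    and t: "t \<in> Hom E (R_ob V) F" and t': "t' \<in> Hom E (R_ob V) F" and eq: "t S (incl V) = t' S (incl V)"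
  shows "t = t'"
proof (rule R_Hom_eqI[OF t t'])
  obtain S0 where S0: "V \<subseteq> S0" "S0 \<subseteq> S" "|S0| =o lam" using small_in_lam[OF V] S unfolding large_def by blast
  note l0 = lam_large[OF S0(3)]
  have i: "incl V \<in> Mono V S0" using S0(1) by (rule Mono_incl)
  have ii: "compose V (incl S0) (incl V) = incl V" using compose_incl_left[OF i] .
  have "farr F S0 S (incl S0) (t S0 (incl V)) = farr F S0 S (incl S0) (t' S0 (incl V))"
    using R_HomD(4)[OF t l0 S Mono_incl[OF S0(2)] i] R_HomD(4)[OF t' l0 S Mono_incl[OF S0(2)] i] eq ii by simp
  then have eq0: "t S0 (incl V) = t' S0 (incl V)"
    using inj_onD[OF E_inj_incl[OF F l0 S S0(2)]] R_HomD(3)[OF t l0 i] R_HomD(3)[OF t' l0 i] by blast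
  fix T k assume T: "large T" and k: "k \<in> Mono V T"
  obtain g where g: "g \<in> Mono S0 T" "\<And>v. v \<in> V \<Longrightarrow> g v = k v"
    using Mono_extend[OF k V(1) S0(1) _ lam_le_large[OF S0(3) T]] T unfolding large_def by metis
  have "compose V g (incl V) = k"
    by (rule Mono_eqI[OF Mono_compose[OF i g(1)] k]) (simp add: compose_eq g(2))
  then show "t T k = t' T k"
    using R_HomD(4)[OF t l0 T g(1) i] R_HomD(4)[OF t' l0 T g(1) i] eq0 by simp
qed

text \<open>The element first descends to a set \<open>B \<union> V\<close> of size
  \<open>lam\<close>, and there it has a small support \<open>K\<close>. The set in the conclusion
  is this \<open>K\<close>.\<close>

lemma R_Hom_exists:
  assumes F: "F \<in> Ob E" and S: "large S" and x: "x \<in> fob F S"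
  shows "\<exists>V t. V \<subseteq> S \<and> small V \<and> t \<in> Hom E (R_ob V) F \<and> t S (incl V) = x"
proof -
  obtain B where B: "B \<subseteq> S" "|B| =o lam" using lam_subset S unfolding large_def by blast
  have lB: "lam \<le>o |B|" using lam_large[OF B(2)] by (simp add: large_def)
  obtain V y where V: "V \<subseteq> S" "small V" "y \<in> fob F (B \<union> V)" "x = farr F (B \<union> V) S (incl (B \<union> V)) y"
    using E_base(1)[OF F S B(1) lB x] by blast
  have BV: "|B \<union> V| =o lam" using lam_Un_small[OF B(2) V(2)] .
  obtain K where K: "K \<subseteq> B \<union> V" "small K" and supp: "\<forall>T g h. large T \<longrightarrow> g \<in> Mono (B \<union> V) T \<longrightarrow> h \<in> Mono (B \<union> V) T \<longrightarrow>
    (\<forall>s\<in>K. g s = h s) \<longrightarrow> farr F (B \<union> V) T g y = farr F (B \<union> V) T h y"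
    using E_support_lam[OF F BV V(3)] by blast
  obtain t where t: "t \<in> Hom E (R_ob K) F" "t (B \<union> V) (incl K) = y"
    using R_Hom_yoneda_lam[OF F BV K V(3)] supp by blast
  have BVS: "B \<union> V \<subseteq> S" using B(1) V(1) by blast
  have i: "incl K \<in> Mono K (B \<union> V)" using K(1) by (rule Mono_incl)
  have "t S (incl K) = x"
    using R_HomD(4)[OF t(1) lam_large[OF BV] S Mono_incl[OF BVS] i] t(2) V(4) compose_incl_left[OF i] by simp
  then show ?thesis using t(1) K BVS by blast
qed

subsection \<open>Precomposition with an injection\<close>

text \<open>Composition of \<open>t\<close> with the arrow from \<open>R_ob W\<close> to
  \<open>R_ob V\<close> induced by \<open>f\<close>, in explicit form; \<open>E_cmp_R\<close>
  identifies it with composition in the topos. It is the action of \<open>f\<close> on the presheaf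
  of transformations into a fixed \<open>F\<close>.\<close>

definition pull :: "'u set \<Rightarrow> 'u set \<Rightarrow> ('u \<Rightarrow> 'u) \<Rightarrow> 'u scott_arr \<Rightarrow> 'u scott_arr" where
  "pull V W f t = (\<lambda>S\<in>Collect large. \<lambda>h\<in>Mono W S. t S (compose V h f))"

lemma pull_apply [simp]: "large S \<Longrightarrow> h \<in> Mono W S \<Longrightarrow> pull V W f t S h = t S (compose V h f)"
  by (simp add: pull_def)

lemma pull_Hom:
  assumes f: "f \<in> Mono V W" and t: "t \<in> Hom E (R_ob V) F"
  shows "pull V W f t \<in> Hom E (R_ob W) F"
  unfolding pull_def
proof (rule R_Hom_restrictI)
  show "t S (compose V k f) \<in> fob F S" if "large S" "k \<in> Mono W S" for S k
    using R_HomD(3)[OF t that(1) Mono_compose[OF f that(2)]] .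
  show "t T (compose V (compose W g k) f) = farr F S T g (t S (compose V k f))"
    if "large S" "large T" "g \<in> Mono S T" "k \<in> Mono W S" for S T g k
    using R_HomD(4)[OF t that(1-3) Mono_compose[OF f that(4)]] compose_assoc_Mono[OF f, of g k] by simp
qed

text \<open>\<open>R_ob W\<close> maps onto \<open>R_ob V\<close>: carry \<open>h\<close> along the
  inverse of \<open>f\<close> to the image of \<open>V\<close> in \<open>W\<close>, then extend to
  all of \<open>W\<close>.\<close>

lemma R_Mono_extend:
  assumes f: "f \<in> Mono V W" and W: "small W" and T: "large T" and h: "h \<in> Mono V T"
  obtains k where "k \<in> Mono W T" "compose V k f = h"
proof -
  obtain n where n: "n \<in> Mono (f ` V) V" "compose V n f = incl V" using Mono_inverse[OF f] .
  have V: "small (f ` V)" using card_of_subset_ordLess[OF Mono_image[OF f] W] .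
  have WT: "|W| \<le>o |T|" using small_large[OF W] T ordLess_imp_ordLeq unfolding large_def by blast
  have hn: "compose (f ` V) h n \<in> Mono (f ` V) T" using Mono_compose[OF n(1) h] .
  obtain k where k: "k \<in> Mono W T" "\<And>v. v \<in> f ` V \<Longrightarrow> k v = compose (f ` V) h n v"
    using Mono_extend[OF hn V Mono_image[OF f] _ WT] T unfolding large_def by blast
  have "compose V k f = h"
  proof (rule Mono_eqI[OF Mono_compose[OF f k(1)] h])
    fix v assume v: "v \<in> V"
    then have "n (f v) = v" using fun_cong[OF n(2), of v] by (simp add: compose_eq)
    then show "compose V k f v = h v" using v k(2)[of "f v"] by (simp add: compose_eq)
  qed
  then show thesis using that k(1) by blast
qed

text \<open>\<open>R\<^sub>W \<rightarrow> R\<^sub>V\<close> is onto, hence epimorphic.\<close>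
lemma pull_inj:
  assumes f: "f \<in> Mono V W" and W: "small W" and t: "t \<in> Hom E (R_ob V) F" and t': "t' \<in> Hom E (R_ob V) F"
    and eq: "pull V W f t = pull V W f t'"
  shows "t = t'"
proof (rule R_Hom_eqI[OF t t'])
  fix T k assume T: "large T" and k: "k \<in> Mono V T"
  obtain h where h: "h \<in> Mono W T" "compose V h f = k" using R_Mono_extend[OF f W T k] .
  show "t T k = t' T k" using fun_cong[OF fun_cong[OF eq, of T], of h] T h by simp
qed

text \<open>Because \<open>R_ob W\<close> maps onto \<open>R_ob V\<close>, a transformation out of
  \<open>R_ob W\<close> that is constant on the fibres factors through it. Both the sheaf condition
  and the support lemma over arbitrary large sets rest on this.\<close>

lemma pull_descend:
  assumes f: "f \<in> Mono V W" and W: "small W" and t: "t \<in> Hom E (R_ob W) F"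
    and wd: "\<And>T k k'. large T \<Longrightarrow> k \<in> Mono W T \<Longrightarrow> k' \<in> Mono W T \<Longrightarrow> compose V k f = compose V k' f \<Longrightarrow> t T k = t T k'"
  shows "\<exists>s\<in>Hom E (R_ob V) F. pull V W f s = t"
proof -
  have "\<exists>k. k \<in> Mono W T \<and> compose V k f = h" if T: "large T" and h: "h \<in> Mono V T" for T h
    using R_Mono_extend[OF f W T h] by metis
  then obtain e where e: "\<And>T h. large T \<Longrightarrow> h \<in> Mono V T \<Longrightarrow> e T h \<in> Mono W T \<and> compose V (e T h) f = h" by metis
  let ?s = "\<lambda>T\<in>Collect large. \<lambda>h\<in>Mono V T. t T (e T h)"
  have s: "?s \<in> Hom E (R_ob V) F"
  proof (rule R_Hom_restrictI)
    show "t S (e S k) \<in> fob F S" if "large S" "k \<in> Mono V S" for S k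
      using R_HomD(3)[OF t that(1)] e[OF that] by blast
    fix S T g k assume S: "large S" and T: "large T" and g: "g \<in> Mono S T" and k: "k \<in> Mono V S"
    note ek = e[OF S k, THEN conjunct1] and egk = e[OF T Mono_compose[OF k g]]
    have "compose V (compose W g (e S k)) f = compose V (e T (compose V g k)) f"
      using egk e[OF S k] compose_assoc_Mono[OF f, of g "e S k"] by simp
    then have "t T (e T (compose V g k)) = t T (compose W g (e S k))"
      using wd[OF T Mono_compose[OF ek g] conjunct1[OF egk]] by simp
    then show "t T (e T (compose V g k)) = farr F S T g (t S (e S k))" using R_HomD(4)[OF t S T g ek] by simp
  qed
  have "pull V W f ?s = t"
  proof (rule R_Hom_eqI[OF pull_Hom[OF f s] t])
    fix T k assume T: "large T" and k: "k \<in> Mono W T"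
    note fk = Mono_compose[OF f k]
    have "t T (e T (compose V k f)) = t T k"
      using wd[OF T _ k] e[OF T fk] by blast
    then show "pull V W f ?s T k = t T k" using T k fk by simp
  qed
  then show ?thesis using s by blast
qed

text \<open>When \<open>S\<close> is bigger than \<open>lam\<close>, a large target may be too small
  to receive \<open>S\<close>, and extending injections to \<open>S\<close> is no longer possible.
  Instead one starts from a transformation out of \<open>R_ob K\<close> for some small
  \<open>K\<close> containing \<open>V\<close>; the invariance of \<open>x\<close> makes it constant
  on the fibres over \<open>R_ob V\<close>.\<close>

lemma R_Hom_yoneda:
  assumes F: "F \<in> Ob E" and S: "large S" and V: "V \<subseteq> S" "small V" and x: "x \<in> fob F S"
    and supp: "\<And>T g h. large T \<Longrightarrow> g \<in> Mono S T \<Longrightarrow> h \<in> Mono S T \<Longrightarrow> (\<forall>v\<in>V. g v = h v) \<Longrightarrow> farr F S T g x = farr F S T h x"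
  shows "\<exists>t\<in>Hom E (R_ob V) F. t S (incl V) = x"
proof -
  note Ff = E_functor[OF F]
  obtain K0 t0 where K0: "K0 \<subseteq> S" "small K0" and t0: "t0 \<in> Hom E (R_ob K0) F" "t0 S (incl K0) = x"
    using R_Hom_exists[OF F S x] by blast
  define K where "K = K0 \<union> V"
  have K: "K \<subseteq> S" "small K" using K0 V by (auto simp: K_def small_Un)
  have i0: "incl K0 \<in> Mono K0 K" and iV: "incl V \<in> Mono V K" by (auto simp: K_def intro: Mono_incl)
  have iK: "incl K \<in> Mono K S" using K(1) by (rule Mono_incl)
  define t where "t = pull K0 K (incl K0) t0"
  have t: "t \<in> Hom E (R_ob K) F" unfolding t_def by (rule pull_Hom[OF i0 t0(1)])
  have tx: "t S (incl K) = x" unfolding t_def using S iK t0(2) compose_incl_left[OF i0] by simp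
  have "\<exists>s\<in>Hom E (R_ob V) F. pull V K (incl V) s = t"
  proof (rule pull_descend[OF iV K(2) t])
    fix T k k' assume T: "large T" and k: "k \<in> Mono K T" and k': "k' \<in> Mono K T" and kk0: "compose V k (incl V) = compose V k' (incl V)"
    have kk: "k v = k' v" if "v \<in> V" for v using that fun_cong[OF kk0, of v] by (simp add: compose_eq)
    have "|T| <o \<nu>" "|S| <o \<nu>" using T S by (simp_all add: large_def)
    then obtain \<iota> where \<iota>: "inj_on \<iota> S" "\<iota> ` S \<inter> T = {}" by (rule room)
    \<comment> \<open>Adding a copy of \<open>S\<close> to \<open>T\<close> lets injections out of
      \<open>K\<close> be extended to \<open>S\<close> inside the larger target; injectivity of
      \<open>F\<close> brings the resulting equality back to \<open>T\<close>.\<close>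
    let ?T = "T \<union> \<iota> ` S"
    have T': "large ?T" using S by (intro large_Un[OF T] card_of_image_ordLess) (simp add: large_def)
    have TT: "T \<subseteq> ?T" by blast
    let ?e = "\<lambda>k. \<lambda>s\<in>S. if s \<in> K then k s else \<iota> s"
    have e: "?e h \<in> Mono S ?T" "farr F T ?T (incl T) (t T h) = farr F S ?T (?e h) x" if h: "h \<in> Mono K T" for h
    proof -
      show eh: "?e h \<in> Mono S ?T"
        by (rule Mono_mix[OF _ _ \<iota>]) (use Mono_inj[OF h] Mono_image[OF h] in \<open>auto simp: inj_on_def\<close>)
      have "compose K (?e h) (incl K) = h"
        by (rule Mono_eqI[OF Mono_compose[OF iK eh] h]) (use K(1) in \<open>auto simp: compose_eq\<close>)
      then have "farr F S ?T (?e h) x = t ?T h" using R_HomD(4)[OF t S T' eh iK] tx by simp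
      moreover have "farr F T ?T (incl T) (t T h) = t ?T h"
        using R_HomD(4)[OF t T T' Mono_incl[OF TT] h] compose_incl_left[OF h] by simp
      ultimately show "farr F T ?T (incl T) (t T h) = farr F S ?T (?e h) x" by simp
    qed
    have "farr F S ?T (?e k) x = farr F S ?T (?e k') x"
      using kk V(1) by (intro supp[OF T' e(1)[OF k] e(1)[OF k']]) auto
    then have "farr F T ?T (incl T) (t T k) = farr F T ?T (incl T) (t T k')" using e(2)[OF k] e(2)[OF k'] by simp
    then show "t T k = t T k'"
      using inj_onD[OF E_inj_incl[OF F T T' TT]] R_HomD(3)[OF t T k] R_HomD(3)[OF t T k'] by blast
  qed
  then obtain s where s: "s \<in> Hom E (R_ob V) F" "pull V K (incl V) s = t" by blast
  have "compose V (incl K) (incl V) = incl V" using compose_incl_left[OF iV] .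
  then have "s S (incl V) = t S (incl K)" unfolding s(2)[symmetric] using S iK by simp
  then show ?thesis using s(1) tx by blast
qed

end

section \<open>The atomic topology\<close>

lemma nonempty_pair: "S \<noteq> {} \<Longrightarrow> \<exists>a b. (a, b) \<in> S"
  by auto

text \<open>Pullbacks of sieves are non-empty by the Ore condition.\<close>
lemma ore_grothendieck_topology:
  assumes C: "is_category C" and J: "\<And>c. c \<in> Ob C \<Longrightarrow> J c = atomic_topology C c"
    and ore: "\<And>c d e f h. c \<in> Ob C \<Longrightarrow> d \<in> Ob C \<Longrightarrow> e \<in> Ob C \<Longrightarrow> f \<in> Hom C e c \<Longrightarrow> h \<in> Hom C d c \<Longrightarrow>
      \<exists>x\<in>Ob C. \<exists>p\<in>Hom C x e. \<exists>q\<in>Hom C x d. cmp C x e c f p = cmp C x d c h q"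
  shows "grothendieck_topology C J"
proof -
  have J': "S \<in> J c \<longleftrightarrow> sieve C c S \<and> S \<noteq> {}" if "c \<in> Ob C" for c S
    using J[OF that] by (simp add: atomic_topology_def)
  have sD: "d \<in> Ob C" "f \<in> Hom C d c" "\<And>e g. e \<in> Ob C \<Longrightarrow> g \<in> Hom C e d \<Longrightarrow> (e, cmp C e d c f g) \<in> S"
    if "sieve C c S" "(d, f) \<in> S" for c S d f
    using that unfolding sieve_def by blast+
  show ?thesis unfolding grothendieck_topology_def
  proof (intro conjI ballI allI impI; (elim conjE)?)
    fix c assume c: "c \<in> Ob C"
    show "J c \<subseteq> {S. sieve C c S}" using J'[OF c] by blast
    have "sieve C c {(d, f). d \<in> Ob C \<and> f \<in> Hom C d c}"
      unfolding sieve_def using cat_cmp[OF C _ _ c] by auto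
    moreover have "(c, ident C c) \<in> {(d, f). d \<in> Ob C \<and> f \<in> Hom C d c}" using cat_ident[OF C c] c by simp
    ultimately show "{(d, f). d \<in> Ob C \<and> f \<in> Hom C d c} \<in> J c" unfolding J'[OF c] by blast
    fix S assume "S \<in> J c"
    then have S: "sieve C c S" "S \<noteq> {}" unfolding J'[OF c] by blast+
    { fix d h assume d: "d \<in> Ob C" and h: "h \<in> Hom C d c"
      let ?T = "{(e, g). e \<in> Ob C \<and> g \<in> Hom C e d \<and> (e, cmp C e d c h g) \<in> S}"
      have "(k, cmp C k e d g l) \<in> ?T"
        if e: "e \<in> Ob C" and g: "g \<in> Hom C e d" and in_S: "(e, cmp C e d c h g) \<in> S"
          and k: "k \<in> Ob C" and l: "l \<in> Hom C k e" for e g k l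
        using cat_cmp[OF C k e d l g] sD(3)[OF S(1) in_S k l] cat_assoc[OF C k e d c l g h] k by simp
      then have "sieve C d ?T" unfolding sieve_def by blast
      moreover obtain e f where ef: "(e, f) \<in> S" using nonempty_pair[OF S(2)] by blast
      obtain x p q where x: "x \<in> Ob C" and p: "p \<in> Hom C x e" and q: "q \<in> Hom C x d"
        and pq: "cmp C x e c f p = cmp C x d c h q"
        using ore[OF c d sD(1)[OF S(1) ef] sD(2)[OF S(1) ef] h] by blast
      have "(x, q) \<in> ?T" using sD(3)[OF S(1) ef x p] pq x q by simp
      ultimately show "?T \<in> J d" unfolding J'[OF d] by blast
    }
    fix T assume T: "sieve C c T"
      and cov: "\<forall>(d, h)\<in>S. {(e, g). e \<in> Ob C \<and> g \<in> Hom C e d \<and> (e, cmp C e d c h g) \<in> T} \<in> J d"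
    obtain e f where ef: "(e, f) \<in> S" using nonempty_pair[OF S(2)] by blast
    have "{(k, g). k \<in> Ob C \<and> g \<in> Hom C k e \<and> (k, cmp C k e c f g) \<in> T} \<in> J e" using cov ef by blast
    then have "T \<noteq> {}" unfolding J'[OF sD(1)[OF S(1) ef]] by blast
    then show "T \<in> J c" using T unfolding J'[OF c] by blast
  qed
qed

section \<open>The functor \<open>R\<close>: full faithfulness, density and the induced
  topology\<close>

context scott_cards
begin

abbreviation smalls :: "'u set set" where "smalls \<equiv> {V. small V}"
abbreviation R :: "('u set, 'u \<Rightarrow> 'u, 'u scott_ob, 'u scott_arr) func" where "R \<equiv> R_func lam \<nu>"

lemma Cop_simps [simp]:
  "Ob Cop = smalls" "Hom Cop V W = Mono W V" "ident Cop V = incl V" "cmp Cop V W U g f = compose U f g"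
  by (simp_all add: Setm_less_op_def Setm_less_def op_cat_def)

lemma op_Cop: "op_cat Cop = Setm smalls"
  by (simp add: Setm_less_op_def Setm_less_def)

lemma is_category_Cop: "is_category Cop"
  unfolding Setm_less_op_def Setm_less_def by (intro is_category_op is_category_Setm)

lemma R_simps: "fob R = R_ob"
  "farr R V W f = (\<lambda>S\<in>Collect large. \<lambda>h\<in>Mono V S. compose W h f)"
  by (simp_all add: R_func_def A_eq)

lemma R_arr_Hom:
  assumes f: "f \<in> Mono W V" shows "farr R V W f \<in> Hom E (R_ob V) (R_ob W)"
  unfolding R_simps
  by (rule R_Hom_restrictI) (simp_all add: Mono_compose[OF f] compose_assoc_Mono[OF f])

lemma E_cmp_R:
  assumes f: "f \<in> Mono V W" shows "cmp E (R_ob W) (R_ob V) F t (farr R W V f) = pull V W f t"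
  unfolding E_cmp pull_def
  by (rule restrict_ext) (auto simp: R_simps compose_def fun_eq_iff Mono_compose[OF f])

lemma R_functor: "is_functor Cop E R"
  unfolding is_functor_def
proof (intro conjI ballI)
  show "is_category Cop" "is_category E" by (rule is_category_Cop is_category_E)+
  fix V assume "V \<in> Ob Cop"
  then have V: "small V" by simp
  show "fob R V \<in> Ob E" unfolding R_simps by (rule R_ob_E[OF V])
  show "farr R V V (ident Cop V) = ident E (fob R V)"
    unfolding R_simps E_ident by (rule restrict_ext) (auto intro!: restrict_ext simp: compose_incl_r Mono_ext)
  fix W
  show "farr R V W f \<in> Hom E (fob R V) (fob R W)" if "f \<in> Hom Cop V W" for f
    using R_arr_Hom that by (simp add: R_simps(1))
  fix U f g assume f: "f \<in> Hom Cop V W" and g: "g \<in> Hom Cop W U"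
  show "farr R V U (cmp Cop V W U g f) = cmp E (fob R V) (fob R W) (fob R U) (farr R W U g) (farr R V W f)"
    unfolding R_simps E_cmp
  proof (rule restrict_ext)
    fix S assume S: "S \<in> Collect large"
    show "(\<lambda>h\<in>Mono V S. compose U h (cmp Cop V W U g f)) =
      compose (fob (R_ob V) S) ((\<lambda>S\<in>Collect large. \<lambda>h\<in>Mono W S. compose U h g) S) ((\<lambda>S\<in>Collect large. \<lambda>h\<in>Mono V S. compose W h f) S)"
      using S f g Mono_compose[of f W V] by (auto simp: compose_def[of "Mono V S"] compose_assoc_Mono[of g U W] intro!: restrict_ext)
  qed
qed

text \<open>A transformation \<open>t\<close> from \<open>R_ob V\<close> to \<open>R_ob W\<close> is
  determined by \<open>x = t S (incl V)\<close>, an injection from \<open>W\<close> to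
  \<open>S\<close>. By naturality, injections out of \<open>S\<close> that agree on \<open>V\<close>
  agree on the image of \<open>x\<close>; hence that image lies in \<open>V\<close> and
  \<open>x\<close> is the arrow sought.\<close>

lemma R_fully_faithful: "fully_faithful Cop E R"
  unfolding fully_faithful_def
proof (intro conjI R_functor ballI)
  fix V W assume "V \<in> Ob Cop" and "W \<in> Ob Cop"
  then have V: "small V" and W: "small W" by simp_all
  obtain S where S: "V \<subseteq> S" "|S| =o lam" using small_in_lam'[OF V] .
  note lS = lam_large[OF S(2)]
  have i: "incl V \<in> Mono V S" using S(1) by (rule Mono_incl)
  have ev: "farr R V W f S (incl V) = f" if f: "f \<in> Mono W V" for f
    using lS i compose_incl_left[OF f] by (simp add: R_simps)
  have "inj_on (farr R V W) (Mono W V)" by (rule inj_onI) (metis ev)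
  moreover have "t \<in> farr R V W ` Mono W V" if t: "t \<in> Hom E (R_ob V) (R_ob W)" for t
  proof -
    define x where "x = t S (incl V)"
    have x: "x \<in> Mono W S" using R_HomD(3)[OF t lS i] by (simp add: x_def)
    have "|S| <o \<nu>" using lS by (simp add: large_def)
    from room[OF this this] obtain \<iota> where \<iota>: "inj_on \<iota> S" "\<iota> ` S \<inter> S = {}" .
    \<comment> \<open>\<open>?g\<close> fixes \<open>V\<close> and moves every other point of
      \<open>S\<close> out of \<open>S\<close>, so it agrees with the inclusion exactly on
      \<open>V\<close>.\<close>
    let ?T = "S \<union> \<iota> ` S" and ?g = "\<lambda>s\<in>S. if s \<in> V then s else \<iota> s"
    have T: "large ?T" using lS by (intro large_Un[OF lS] card_of_image_ordLess) (simp add: large_def)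
    have ST: "incl S \<in> Mono S ?T" by (rule Mono_incl) blast
    have g: "?g \<in> Mono S ?T" by (rule Mono_mix[OF _ _ \<iota>]) auto
    have "compose V ?g (incl V) = compose V (incl S) (incl V)" using S(1) by (auto simp: compose_def fun_eq_iff)
    then have "farr (R_ob W) S ?T ?g x = farr (R_ob W) S ?T (incl S) x"
      unfolding x_def R_HomD(4)[OF t lS T g i] R_HomD(4)[OF t lS T ST i] by simp
    then have gx: "compose W ?g x = compose W (incl S) x" using x by simp
    have "x w \<in> V" if w: "w \<in> W" for w
    proof (rule ccontr)
      assume "x w \<notin> V"
      moreover have "x w \<in> S" using MonoD[OF x w] .
      ultimately have "\<iota> (x w) = x w" using fun_cong[OF gx, of w] w by (simp add: compose_eq)
      then show False using \<iota>(2) \<open>x w \<in> S\<close> by (metis disjoint_iff imageI)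
    qed
    then have x': "x \<in> Mono W V" using Mono_corestrict[OF x] by blast
    have "farr R V W x = t"
      by (rule R_Hom_uniq[OF R_ob_E[OF W] V S(1) lS R_arr_Hom[OF x'] t]) (simp only: ev[OF x'], rule x_def)
    then show ?thesis using x' by blast
  qed
  ultimately have "bij_betw (farr R V W) (Mono W V) (Hom E (R_ob V) (R_ob W))"
    using R_arr_Hom by (auto simp: bij_betw_def)
  then show "bij_betw (farr R V W) (Hom Cop V W) (Hom E (fob R V) (fob R W))" by (simp add: R_simps(1))
qed

lemma E_HomD:
  assumes "t \<in> Hom E F G"
  shows "t \<in> extensional (Collect large)" and "large S \<Longrightarrow> t S \<in> fob F S \<rightarrow>\<^sub>E fob G S"
    and "large S \<Longrightarrow> x \<in> fob F S \<Longrightarrow> t S x \<in> fob G S"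
    and "large S \<Longrightarrow> large T \<Longrightarrow> f \<in> Mono S T \<Longrightarrow> x \<in> fob F S \<Longrightarrow> t T (farr F S T f x) = farr G S T f (t S x)"
proof -
  note h = assms[unfolded E_Hom]
  show "t \<in> extensional (Collect large)" using h by blast
  show e: "t S \<in> fob F S \<rightarrow>\<^sub>E fob G S" if "large S" for S using h that by blast
  show "t S x \<in> fob G S" if "large S" "x \<in> fob F S" using e[OF that(1)] that(2) by (rule PiE_mem)
  show "t T (farr F S T f x) = farr G S T f (t S x)" if "large S" "large T" "f \<in> Mono S T" "x \<in> fob F S"
  proof -
    have "compose (fob F S) (t T) (farr F S T f) = compose (fob F S) (farr G S T f) (t S)" using h that by blast
    from fun_cong[OF this, of x] show ?thesis using that(4) by (simp add: compose_eq)
  qed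
qed

lemma E_Hom_restrictI:
  assumes F: "is_functor (Setm (Collect large)) (Set_cat \<nu>) F"
    and "\<And>S x. large S \<Longrightarrow> x \<in> fob F S \<Longrightarrow> t S x \<in> fob G S"
    and "\<And>S T f x. large S \<Longrightarrow> large T \<Longrightarrow> f \<in> Mono S T \<Longrightarrow> x \<in> fob F S \<Longrightarrow> t T (farr F S T f x) = farr G S T f (t S x)"
  shows "(\<lambda>S\<in>Collect large. \<lambda>x\<in>fob F S. t S x) \<in> Hom E F G"
  unfolding E_Hom
proof (intro conjI allI impI)
  fix S T f assume S: "large S" and T: "large T" and f: "f \<in> Mono S T"
  have Ff: "farr F S T f x \<in> fob F T" if "x \<in> fob F S" for x using setf_map[OF F _ _ f that] S T by simp
  show "compose (fob F S) ((\<lambda>S\<in>Collect large. \<lambda>x\<in>fob F S. t S x) T) (farr F S T f) =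
    compose (fob F S) (farr G S T f) ((\<lambda>S\<in>Collect large. \<lambda>x\<in>fob F S. t S x) S)"
    unfolding compose_def by (rule restrict_ext) (simp add: S T Ff assms(3)[OF S T f])
qed (use assms(2) in auto)

lemma E_Hom_eqI:
  assumes t: "t \<in> Hom E F G" and t': "t' \<in> Hom E F G"
    and eq: "\<And>S x. large S \<Longrightarrow> x \<in> fob F S \<Longrightarrow> t S x = t' S x"
  shows "t = t'"
proof (rule extensionalityI[OF E_HomD(1)[OF t] E_HomD(1)[OF t']])
  fix S assume "S \<in> Collect large"
  then have S: "large S" by simp
  show "t S = t' S"
    by (rule extensionalityI[of _ "fob F S"])
      (use E_HomD(2)[OF t S] E_HomD(2)[OF t' S] eq[OF S] in \<open>simp_all add: PiE_def\<close>)
qed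

text \<open>A single set \<open>S0\<close> of size \<open>lam\<close> gives a small family, with one
  member for each element of \<open>fob F S0\<close>. It suffices because an element over any large
  \<open>S\<close> is the image of one over \<open>S0\<close>: its small support embeds in
  \<open>S0\<close>.\<close>

lemma R_dense: "dense_functor \<nu> Cop E R"
  unfolding dense_functor_def
proof (intro conjI R_functor ballI)
  fix F assume F: "F \<in> Ob E"
  note Ff = E_functor[OF F]
  have "small ({} :: 'u set)" by (rule small_finite) simp
  then obtain S0 :: "'u set" where S0: "|S0| =o lam" using small_in_lam' by blast
  note l0 = lam_large[OF S0]
  have "\<exists>p. fst p \<subseteq> S0 \<and> small (fst p) \<and> snd p \<in> Hom E (R_ob (fst p)) F \<and> snd p S0 (incl (fst p)) = x"
    if "x \<in> fob F S0" for x
    using R_Hom_exists[OF F l0 that] by (metis fst_conv snd_conv)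
  then obtain p where p: "\<And>x. x \<in> fob F S0 \<Longrightarrow> fst (p x) \<subseteq> S0 \<and> small (fst (p x)) \<and>
    snd (p x) \<in> Hom E (R_ob (fst (p x))) F \<and> snd (p x) S0 (incl (fst (p x))) = x" by metis
  let ?P = "p ` fob F S0"
  show "\<exists>P. P \<subseteq> {(V, f). V \<in> Ob Cop \<and> f \<in> Hom E (fob R V) F} \<and> |P| <o \<nu> \<and>
        jointly_epi E F ((\<lambda>(V, f). (fob R V, f)) ` P)"
  proof (intro exI[of _ ?P] conjI)
    show "?P \<subseteq> {(V, f). V \<in> Ob Cop \<and> f \<in> Hom E (fob R V) F}"
      unfolding case_prod_beta R_simps(1) using p by (intro image_subsetI) simp
    show "|?P| <o \<nu>" using setf_card[OF Ff, of S0] l0 by (intro card_of_image_ordLess) simp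
    show "jointly_epi E F ((\<lambda>(V, f). (fob R V, f)) ` ?P)"
      unfolding jointly_epi_def
    proof (intro ballI impI)
      fix Z g h assume Z: "Z \<in> Ob E" and g: "g \<in> Hom E F Z" and h: "h \<in> Hom E F Z"
        and eq: "\<forall>(d, f)\<in>(\<lambda>(V, f). (fob R V, f)) ` ?P. cmp E d F Z g f = cmp E d F Z h f"
      have eq0: "g S0 x = h S0 x" if x: "x \<in> fob F S0" for x
      proof -
        let ?V = "fst (p x)" and ?t = "snd (p x)"
        have "(R_ob ?V, ?t) \<in> (\<lambda>(V, f). (fob R V, f)) ` ?P"
          using x by (intro image_eqI[of _ _ "p x"]) (simp_all add: case_prod_beta R_simps(1))
        then have "cmp E (R_ob ?V) F Z g ?t = cmp E (R_ob ?V) F Z h ?t" using eq by blast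
        from fun_cong[OF this, of S0] have "compose (Mono ?V S0) (g S0) (?t S0) = compose (Mono ?V S0) (h S0) (?t S0)"
          using l0 by (simp add: E_cmp)
        from fun_cong[OF this, of "incl ?V"] show ?thesis using p[OF x] by (simp add: compose_eq Mono_incl)
      qed
      show "g = h"
      proof (rule E_Hom_eqI[OF g h])
        fix S x assume S: "large S" and x: "x \<in> fob F S"
        obtain V t where V: "V \<subseteq> S" "small V" and t: "t \<in> Hom E (R_ob V) F" "t S (incl V) = x"
          using R_Hom_exists[OF F S x] by blast
        \<comment> \<open>\<open>j\<close> places the support in \<open>S0\<close>, and
          \<open>m\<close> extends the inverse of \<open>j\<close> to an injection from
          \<open>S0\<close> to \<open>S\<close>; then \<open>x\<close> is the image under
          \<open>m\<close> of the value of \<open>t\<close> at \<open>j\<close>.\<close>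
        have V0: "|V| \<le>o |S0|" using small_large[OF V(2)] l0 ordLess_imp_ordLeq unfolding large_def by blast
        then obtain j where j: "inj_on j V" "j ` V \<subseteq> S0" using card_of_ordLeq[of V S0] by blast
        have j': "restrict j V \<in> Mono V S0" using j by (intro Mono_restrictI) auto
        obtain n where n: "n \<in> Mono (restrict j V ` V) V" "compose V n (restrict j V) = incl V"
          using Mono_inverse[OF j'] .
        have jV: "restrict j V ` V \<subseteq> S0" using Mono_image[OF j'] .
        have sj: "small (restrict j V ` V)" using V(2) by (rule card_of_image_ordLess)
        obtain m where m: "m \<in> Mono S0 S" "\<And>v. v \<in> restrict j V ` V \<Longrightarrow> m v = n v"
          using Mono_extend[OF Mono_mono[OF n(1) V(1)] sj jV _ lam_le_large[OF S0 S]] S unfolding large_def by blast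
        have "compose V m (restrict j V) = incl V"
        proof (rule Mono_eqI[OF Mono_compose[OF j' m(1)] Mono_incl[OF V(1)]])
          fix v assume v: "v \<in> V"
          then show "compose V m (restrict j V) v = incl V v"
            using fun_cong[OF n(2), of v] m(2)[of "j v"] by (simp add: compose_eq)
        qed
        then have x': "x = farr F S0 S m (t S0 (restrict j V))"
          using R_HomD(4)[OF t(1) l0 S m(1) j'] t(2) by simp
        have "t S0 (restrict j V) \<in> fob F S0" by (rule R_HomD(3)[OF t(1) l0 j'])
        then show "g S x = h S x" unfolding x'
          using E_HomD(4)[OF g l0 S m(1)] E_HomD(4)[OF h l0 S m(1)] eq0 by simp
      qed
    qed
  qed
qed

text \<open>Elements of a constant functor have empty support. The two-element one is the test
  object for the empty sieve.\<close>

lemma const_E: fixes X :: "('u \<Rightarrow> 'u) set" assumes X: "|X| <o \<nu>"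
  shows "\<lparr>fob = (\<lambda>S. X), farr = (\<lambda>S T f. incl X)\<rparr> \<in> Ob E"
proof -
  have f: "is_functor (Setm (Collect large)) (Set_cat \<nu>) \<lparr>fob = (\<lambda>S. X), farr = (\<lambda>S T f. incl X)\<rparr>"
    unfolding set_functor_iff using X by simp
  show ?thesis unfolding E_Ob A_eq
  proof (intro conjI f small_supports_preserve[unfolded A_eq])
  fix S :: "'u set" and x assume "x \<in> fob \<lparr>fob = (\<lambda>S. X), farr = (\<lambda>S T f. incl X)\<rparr> S"
  then have "x \<in> X" by simp
  then show "\<exists>V. V \<subseteq> S \<and> small V \<and> (\<forall>T m. large T \<and> m \<in> Mono T S \<and> V \<subseteq> m ` T \<longrightarrow>
    x \<in> farr \<lparr>fob = (\<lambda>S. X), farr = (\<lambda>S T f. incl X)\<rparr> T S m ` fob \<lparr>fob = (\<lambda>S. X), farr = (\<lambda>S T f. incl X)\<rparr> T)"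
    using small_finite[of "{}"] by (intro exI[of _ "{}"]) auto
  qed (simp add: inj_on_def)
qed

text \<open>By \<open>pull_inj\<close>, a single arrow of a sieve is already sent to an epimorphism
  onto \<open>R_ob V\<close>. The empty sieve fails because \<open>R_ob V\<close> has points, so the
  constant functor with two values receives two different transformations from it.\<close>

lemma induced_eq_atomic:
  assumes V: "V \<in> Ob Cop"
  shows "induced_topology Cop E R V = atomic_topology Cop V"
proof -
  have V': "small V" using V by simp
  have "jointly_epi E (fob R V) ((\<lambda>(d, f). (fob R d, farr R d V f)) ` S) \<longleftrightarrow> S \<noteq> {}" if S: "sieve Cop V S" for S
  proof
    assume epi: "jointly_epi E (fob R V) ((\<lambda>(d, f). (fob R d, farr R d V f)) ` S)"
    show "S \<noteq> {}"
    proof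
      assume "S = {}"
      then have all_eq: "g = h" if "Z \<in> Ob E" "g \<in> Hom E (R_ob V) Z" "h \<in> Hom E (R_ob V) Z" for Z g h
        using epi that unfolding jointly_epi_def R_simps(1) by blast
      obtain a b :: "'u \<Rightarrow> 'u" where ab: "a \<noteq> b" by (rule obtain_distinct)
      let ?Z = "\<lparr>fob = (\<lambda>S. {a, b}), farr = (\<lambda>S T f. incl {a, b})\<rparr> :: 'u scott_ob"
      have Z: "?Z \<in> Ob E" by (intro const_E small_\<nu> small_finite) simp
      let ?t = "\<lambda>c. \<lambda>S\<in>Collect large. \<lambda>k\<in>Mono V S. c"
      have t: "?t c \<in> Hom E (R_ob V) ?Z" if "c \<in> {a, b}" for c
        by (rule R_Hom_restrictI) (use that in auto)
      obtain S0 where S0: "V \<subseteq> S0" "|S0| =o lam" using small_in_lam'[OF V'] .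
      have "?t a S0 (incl V) = ?t b S0 (incl V)" using all_eq[OF Z t[of a] t[of b]] by simp
      then show False using ab lam_large[OF S0(2)] Mono_incl[OF S0(1)] by simp
    qed
  next
    assume "S \<noteq> {}"
    then obtain W f where Wf: "(W, f) \<in> S" using nonempty_pair[of S] by blast
    then have W: "small W" and f: "f \<in> Mono V W" using S unfolding sieve_def by auto
    show "jointly_epi E (fob R V) ((\<lambda>(d, f). (fob R d, farr R d V f)) ` S)"
      unfolding jointly_epi_def R_simps(1)
    proof (intro ballI impI)
      fix Z g h assume g: "g \<in> Hom E (R_ob V) Z" and h: "h \<in> Hom E (R_ob V) Z"
        and "\<forall>(d, f)\<in>(\<lambda>(d, f). (R_ob d, farr R d V f)) ` S. cmp E d (R_ob V) Z g f = cmp E d (R_ob V) Z h f"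
      then have "cmp E (R_ob W) (R_ob V) Z g (farr R W V f) = cmp E (R_ob W) (R_ob V) Z h (farr R W V f)"
        using Wf by fastforce
      then have "pull V W f g = pull V W f h" unfolding E_cmp_R[OF f] .
      then show "g = h" using pull_inj[OF f W g h] by blast
    qed
  qed
  then show ?thesis unfolding induced_topology_def atomic_topology_def by blast
qed

lemma induced_grothendieck: "grothendieck_topology Cop (induced_topology Cop E R)"
proof (rule ore_grothendieck_topology[OF is_category_Cop])
  show "induced_topology Cop E R c = atomic_topology Cop c" if "c \<in> Ob Cop" for c using that by (rule induced_eq_atomic)
  fix V W U f h assume "V \<in> Ob Cop" "W \<in> Ob Cop" "U \<in> Ob Cop" and f: "f \<in> Hom Cop U V" and h: "h \<in> Hom Cop W V"
  then have s: "small U" "small W" and f': "f \<in> Mono V U" and h': "h \<in> Mono V W" by simp_all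
  obtain X p q where "small X" "p \<in> Mono U X" "q \<in> Mono W X" "compose V p f = compose V q h"
    using small_amalgam[OF f' h' s] .
  then show "\<exists>x\<in>Ob Cop. \<exists>p\<in>Hom Cop x U. \<exists>q\<in>Hom Cop x W. cmp Cop x U V f p = cmp Cop x W V h q"
    unfolding Cop_simps by blast
qed

subsection \<open>Atomic sheaves\<close>

text \<open>A non-empty sieve contains the sieve generated by any of its arrows \<open>f\<close>,
  and for that one a matching family amounts to a single \<open>x\<close> in \<open>fob X W\<close>
  whose images under injections agreeing along \<open>f\<close> coincide. The Ore condition carries
  the solution from one arrow of a sieve to all the others.\<close>

lemma atomic_sheaf_iff:
  assumes X: "is_functor (Setm smalls) (Set_cat \<nu>) X"
  shows "is_sheaf Cop (atomic_topology Cop) X \<longleftrightarrow>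
    (\<forall>V W f x. small V \<longrightarrow> small W \<longrightarrow> f \<in> Mono V W \<longrightarrow> x \<in> fob X W \<longrightarrow>
      (\<forall>U g g'. small U \<longrightarrow> g \<in> Mono W U \<longrightarrow> g' \<in> Mono W U \<longrightarrow> compose V g f = compose V g' f \<longrightarrow>
        farr X W U g x = farr X W U g' x) \<longrightarrow>
      (\<exists>!y. y \<in> fob X V \<and> farr X V W f y = x))"
  (is "?L \<longleftrightarrow> ?Q")
proof
  have Xm: "farr X V W f x \<in> fob X W" if "small V" "small W" "f \<in> Mono V W" "x \<in> fob X V" for V W f x
    using setf_map[OF X _ _ that(3,4)] that by simp
  have Xc: "farr X W U g (farr X V W f x) = farr X V U (compose V g f) x"
    if "small V" "small W" "small U" "f \<in> Mono V W" "g \<in> Mono W U" "x \<in> fob X V" for V W U f g x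
    using setf_cmp[OF X _ _ _ that(4-6)] that by simp
  {
    assume L: ?L
    show ?Q
    proof (intro allI impI)
      fix V W f x assume V: "small V" and W: "small W" and f: "f \<in> Mono V W" and x: "x \<in> fob X W"
        and inv: "\<forall>U g g'. small U \<longrightarrow> g \<in> Mono W U \<longrightarrow> g' \<in> Mono W U \<longrightarrow> compose V g f = compose V g' f \<longrightarrow>
          farr X W U g x = farr X W U g' x"
      \<comment> \<open>The sieve generated by \<open>f\<close>, read as an arrow from
        \<open>W\<close> to \<open>V\<close> in the opposite category. \<open>e\<close> chooses a
        factorization through \<open>f\<close>, and \<open>inv\<close> makes \<xi> independent of
        that choice.\<close>
      define S where "S = {(U, h). small U \<and> (\<exists>g\<in>Mono W U. h = compose V g f)}"
      have SD: "(U, h) \<in> S \<longleftrightarrow> small U \<and> (\<exists>g\<in>Mono W U. h = compose V g f)" for U h by (simp add: S_def)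
      define e where "e U h = (SOME g. g \<in> Mono W U \<and> h = compose V g f)" for U h
      define \<xi> where "\<xi> U h = farr X W U (e U h) x" for U h
      have e: "e U h \<in> Mono W U \<and> h = compose V (e U h) f" if "(U, h) \<in> S" for U h
      proof -
        have "\<exists>g. g \<in> Mono W U \<and> h = compose V g f" using that SD by blast
        from someI_ex[OF this] show ?thesis unfolding e_def .
      qed
      have \<xi>: "\<xi> U (compose V g f) = farr X W U g x" if "small U" "g \<in> Mono W U" for U g
      proof -
        have "(U, compose V g f) \<in> S" using that SD by blast
        from e[OF this] show ?thesis unfolding \<xi>_def using inv that by metis
      qed
      have "(Y, cmp Cop Y U V h k) \<in> S" if Uh: "(U, h) \<in> S" and Y: "Y \<in> Ob Cop" and k: "k \<in> Hom Cop Y U" for U h Y k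
      proof -
        have "cmp Cop Y U V h k = compose V (compose W k (e U h)) f"
          using e[OF Uh] compose_assoc_Mono[OF f, of k "e U h"] by simp
        moreover have "compose W k (e U h) \<in> Mono W Y" using Mono_compose[OF conjunct1[OF e[OF Uh]]] k by simp
        ultimately show ?thesis using Y SD by auto
      qed
      moreover have "S \<subseteq> {(d, f). d \<in> Ob Cop \<and> f \<in> Hom Cop d V}" using SD Mono_compose[OF f] by auto
      ultimately have sieve: "sieve Cop V S" unfolding sieve_def by blast
      have WS: "(W, f) \<in> S" using SD W Mono_incl[of W W] compose_incl_left[OF f] by (metis order_refl)
      have at: "S \<in> atomic_topology Cop V" using sieve WS by (auto simp: atomic_topology_def)
      have mem: "\<forall>(U, h)\<in>S. \<xi> U h \<in> fob X U"
        using Xm[OF W _ _ x] e SD unfolding \<xi>_def by blast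
      have "farr X U Y k (\<xi> U h) = \<xi> Y (cmp Cop Y U V h k)"
        if Uh: "(U, h) \<in> S" and Y: "Y \<in> Ob Cop" and k: "k \<in> Hom Cop Y U" for U h Y k
      proof -
        have eU: "e U h \<in> Mono W U" and h: "h = compose V (e U h) f" using e[OF Uh] by blast+
        have ke: "compose W k (e U h) \<in> Mono W Y" using Mono_compose[OF eU] k by simp
        have "cmp Cop Y U V h k = compose V (compose W k (e U h)) f"
          using h compose_assoc_Mono[OF f, of k "e U h"] by simp
        then have "\<xi> Y (cmp Cop Y U V h k) = farr X W Y (compose W k (e U h)) x" using \<xi>[OF _ ke] Y by simp
        also have "\<dots> = farr X U Y k (\<xi> U h)" unfolding \<xi>_def using Xc[OF W _ _ eU _ x] Uh SD Y k by simp
        finally show ?thesis by simp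
      qed
      then have match: "\<forall>(U, h)\<in>S. \<forall>Y\<in>Ob Cop. \<forall>k\<in>Hom Cop Y U. farr X U Y k (\<xi> U h) = \<xi> Y (cmp Cop Y U V h k)"
        by blast
      have ex1: "\<exists>!y. y \<in> fob X V \<and> (\<forall>(U, h)\<in>S. farr X V U h y = \<xi> U h)"
      proof -
        have "V \<in> Ob Cop" using V by simp
        from L[unfolded is_sheaf_def, THEN bspec, OF this, THEN bspec, OF at, THEN spec[of _ \<xi>], THEN mp, OF conjI[OF mem match]]
        show ?thesis .
      qed
      have "(\<forall>(U, h)\<in>S. farr X V U h y = \<xi> U h) \<longleftrightarrow> farr X V W f y = x" if y: "y \<in> fob X V" for y
      proof
        assume all: "\<forall>(U, h)\<in>S. farr X V U h y = \<xi> U h"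
        have "\<xi> W f = x"
          using \<xi>[OF W Mono_incl[of W W]] compose_incl_left[OF f] setf_ident[OF X _ x] W by simp
        then show "farr X V W f y = x" using all WS by blast
      next
        assume fy: "farr X V W f y = x"
        have "farr X V U h y = \<xi> U h" if Uh: "(U, h) \<in> S" for U h
        proof -
          have "small U" using Uh SD by blast
          then show "farr X V U h y = \<xi> U h"
            unfolding \<xi>_def using Xc[OF V W _ f _ y, of U "e U h"] fy e[OF Uh] by simp
        qed
        then show "\<forall>(U, h)\<in>S. farr X V U h y = \<xi> U h" by blast
      qed
      then show "\<exists>!y. y \<in> fob X V \<and> farr X V W f y = x" using ex1 by (metis (mono_tags, lifting))
    qed
  }
  assume Q: ?Q
  \<comment> \<open>Both elements solve the descent problem for the same element of
    \<open>fob X W\<close>, and the solution is unique.\<close>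
  have inj: "y = y'" if "small V" "small W" "f \<in> Mono V W" "y \<in> fob X V" "y' \<in> fob X V" "farr X V W f y = farr X V W f y'"
    for V W f y y'
  proof -
    have "\<forall>U g g'. small U \<longrightarrow> g \<in> Mono W U \<longrightarrow> g' \<in> Mono W U \<longrightarrow> compose V g f = compose V g' f \<longrightarrow>
        farr X W U g (farr X V W f y) = farr X W U g' (farr X V W f y)"
      using Xc[OF that(1,2) _ that(3) _ that(4)] by simp
    then have "\<exists>!z. z \<in> fob X V \<and> farr X V W f z = farr X V W f y"
      using Q that(1-3) Xm[OF that(1-4)] by blast
    then show ?thesis by (rule ex1_unique) (use that in simp_all)
  qed
  show ?L unfolding is_sheaf_def
  proof (intro ballI allI impI)
    fix V S \<xi> assume "V \<in> Ob Cop" and "S \<in> atomic_topology Cop V"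
      and h: "(\<forall>(d, f)\<in>S. \<xi> d f \<in> fob X d) \<and>
        (\<forall>(d, f)\<in>S. \<forall>e\<in>Ob Cop. \<forall>g\<in>Hom Cop e d. farr X d e g (\<xi> d f) = \<xi> e (cmp Cop e d V f g))"
    then have V: "small V" and S: "sieve Cop V S" "S \<noteq> {}" by (auto simp: atomic_topology_def)
    have SD: "small W" "f \<in> Mono V W" if "(W, f) \<in> S" for W f using S(1) that unfolding sieve_def by auto
    have mem: "\<xi> W f \<in> fob X W" if "(W, f) \<in> S" for W f using h that by blast
    have match: "farr X W U g (\<xi> W f) = \<xi> U (compose V g f)" if "(W, f) \<in> S" "small U" "g \<in> Mono W U" for W f U g
    proof -
      have "\<forall>e\<in>Ob Cop. \<forall>g\<in>Hom Cop e W. farr X W e g (\<xi> W f) = \<xi> e (cmp Cop e W V f g)" using h that(1) by blast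
      then show ?thesis using that(2,3) by simp
    qed
    obtain W0 f0 where W0: "(W0, f0) \<in> S" using nonempty_pair[OF S(2)] by blast
    note W0' = SD[OF W0]
    have "\<forall>U g g'. small U \<longrightarrow> g \<in> Mono W0 U \<longrightarrow> g' \<in> Mono W0 U \<longrightarrow> compose V g f0 = compose V g' f0 \<longrightarrow>
        farr X W0 U g (\<xi> W0 f0) = farr X W0 U g' (\<xi> W0 f0)"
      using match[OF W0] by simp
    then have "\<exists>!y. y \<in> fob X V \<and> farr X V W0 f0 y = \<xi> W0 f0" using Q V W0' mem[OF W0] by blast
    then obtain y where y: "y \<in> fob X V" "farr X V W0 f0 y = \<xi> W0 f0" by blast
    show "\<exists>!y. y \<in> fob X V \<and> (\<forall>(d, f)\<in>S. farr X V d f y = \<xi> d f)"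
    proof (rule ex1I[of _ y])
      have "farr X V W f y = \<xi> W f" if Wf: "(W, f) \<in> S" for W f
      proof -
        note Wf' = SD[OF Wf]
        \<comment> \<open>The conditions at \<open>f\<close> and at \<open>f0\<close> are compared
          over an amalgam \<open>U\<close>, where the injectivity of the transition map along
          \<open>q\<close> applies.\<close>
        obtain U p q where U: "small U" and p: "p \<in> Mono W0 U" and q: "q \<in> Mono W U" and pq: "compose V p f0 = compose V q f"
          using small_amalgam[OF W0'(2) Wf'(2) W0'(1) Wf'(1)] .
        have "farr X W U q (farr X V W f y) = farr X W0 U p (farr X V W0 f0 y)"
          using Xc[OF V Wf'(1) U Wf'(2) q y(1)] Xc[OF V W0'(1) U W0'(2) p y(1)] pq by simp
        also have "\<dots> = farr X W U q (\<xi> W f)" using match[OF W0 U p] match[OF Wf U q] y(2) pq by simp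
        finally show ?thesis
          using inj[OF Wf'(1) U q Xm[OF V Wf' y(1)] mem[OF Wf]] by blast
      qed
      then show "y \<in> fob X V \<and> (\<forall>(d, f)\<in>S. farr X V d f y = \<xi> d f)" using y(1) by blast
      fix y' assume y': "y' \<in> fob X V \<and> (\<forall>(d, f)\<in>S. farr X V d f y' = \<xi> d f)"
      then have "farr X V W0 f0 y' = farr X V W0 f0 y" using W0 y(2) by auto
      then show "y' = y" using inj[OF V W0'] y' y(1) by blast
    qed
  qed
qed

end

section \<open>The functor to atomic sheaves\<close>

context scott_cards
begin

abbreviation ShC :: "(('u set, 'u \<Rightarrow> 'u, 'x set, 'x \<Rightarrow> 'x) func, 'u set \<Rightarrow> 'x \<Rightarrow> 'x) category" where
  "ShC \<equiv> Sh_atomic \<kappa> \<nu>"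

lemma Sh_Ob: "X \<in> Ob ShC \<longleftrightarrow> is_functor (Setm smalls) (Set_cat \<nu>) X \<and> is_sheaf Cop (atomic_topology Cop) X"
  by (simp add: Sh_atomic_def Sh_def full_subcat_def functor_cat_def op_Cop)

lemma Sh_functor: "X \<in> Ob ShC \<Longrightarrow> is_functor (Setm smalls) (Set_cat \<nu>) X"
  unfolding Sh_Ob by blast

lemma Sh_Hom: "t \<in> Hom ShC X Y \<longleftrightarrow> t \<in> extensional smalls \<and>
    (\<forall>V. small V \<longrightarrow> t V \<in> fob X V \<rightarrow>\<^sub>E fob Y V) \<and>
    (\<forall>V W f. small V \<longrightarrow> small W \<longrightarrow> f \<in> Mono V W \<longrightarrow>
       compose (fob X V) (t W) (farr X V W f) = compose (fob X V) (farr Y V W f) (t V))"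
  by (auto simp: Sh_atomic_def Sh_def full_subcat_def functor_cat_def op_Cop nat_trans_def)

lemma Sh_ident: "ident ShC X = (\<lambda>V\<in>smalls. incl (fob X V))"
  and Sh_cmp: "cmp ShC X Y Z s t = (\<lambda>V\<in>smalls. compose (fob X V) (s V) (t V))"
  by (simp_all add: Sh_atomic_def Sh_def full_subcat_def functor_cat_def op_Cop)

lemma is_category_Sh: "is_category ShC"
  unfolding Sh_atomic_def Sh_def op_Cop
  by (intro is_category_full_subcat is_category_functor_cat is_category_Setm is_category_Set_cat)

lemma Sh_HomD:
  assumes "t \<in> Hom ShC X Y"
  shows "t \<in> extensional smalls" and "small V \<Longrightarrow> t V \<in> fob X V \<rightarrow>\<^sub>E fob Y V"
    and "small V \<Longrightarrow> x \<in> fob X V \<Longrightarrow> t V x \<in> fob Y V"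
    and "small V \<Longrightarrow> small W \<Longrightarrow> f \<in> Mono V W \<Longrightarrow> x \<in> fob X V \<Longrightarrow> t W (farr X V W f x) = farr Y V W f (t V x)"
proof -
  note h = assms[unfolded Sh_Hom]
  show "t \<in> extensional smalls" using h by blast
  show e: "t V \<in> fob X V \<rightarrow>\<^sub>E fob Y V" if "small V" for V using h that by blast
  show "t V x \<in> fob Y V" if "small V" "x \<in> fob X V" using e[OF that(1)] that(2) by (rule PiE_mem)
  show "t W (farr X V W f x) = farr Y V W f (t V x)" if "small V" "small W" "f \<in> Mono V W" "x \<in> fob X V"
  proof -
    have "compose (fob X V) (t W) (farr X V W f) = compose (fob X V) (farr Y V W f) (t V)" using h that by blast
    from fun_cong[OF this, of x] show ?thesis using that(4) by (simp add: compose_eq)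
  qed
qed

lemma Sh_Hom_restrictI:
  assumes X: "is_functor (Setm smalls) (Set_cat \<nu>) X"
    and "\<And>V x. small V \<Longrightarrow> x \<in> fob X V \<Longrightarrow> t V x \<in> fob Y V"
    and "\<And>V W f x. small V \<Longrightarrow> small W \<Longrightarrow> f \<in> Mono V W \<Longrightarrow> x \<in> fob X V \<Longrightarrow> t W (farr X V W f x) = farr Y V W f (t V x)"
  shows "(\<lambda>V\<in>smalls. \<lambda>x\<in>fob X V. t V x) \<in> Hom ShC X Y"
  unfolding Sh_Hom
proof (intro conjI allI impI)
  fix V W :: "'u set" and f assume V: "small V" and W: "small W" and f: "f \<in> Mono V W"
  have Xf: "farr X V W f x \<in> fob X W" if "x \<in> fob X V" for x using setf_map[OF X _ _ f that] V W by simp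
  show "compose (fob X V) ((\<lambda>V\<in>smalls. \<lambda>x\<in>fob X V. t V x) W) (farr X V W f) =
    compose (fob X V) (farr Y V W f) ((\<lambda>V\<in>smalls. \<lambda>x\<in>fob X V. t V x) V)"
    unfolding compose_def by (rule restrict_ext) (simp add: V W Xf assms(3)[OF V W f])
qed (use assms(2) in auto)

lemma Sh_Hom_eqI:
  assumes t: "t \<in> Hom ShC X Y" and t': "t' \<in> Hom ShC X Y"
    and eq: "\<And>V x. small V \<Longrightarrow> x \<in> fob X V \<Longrightarrow> t V x = t' V x"
  shows "t = t'"
proof (rule extensionalityI[OF Sh_HomD(1)[OF t] Sh_HomD(1)[OF t']])
  fix V assume "V \<in> smalls"
  then have V: "small V" by simp
  show "t V = t' V"
    by (rule extensionalityI[of _ "fob X V"])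
      (use Sh_HomD(2)[OF t V] Sh_HomD(2)[OF t' V] eq[OF V] in \<open>simp_all add: PiE_def\<close>)
qed

lemma Sh_iso:
  assumes X: "X \<in> Ob ShC" and Y: "Y \<in> Ob ShC" and t: "t \<in> Hom ShC X Y"
    and bij: "\<And>V. small V \<Longrightarrow> bij_betw (t V) (fob X V) (fob Y V)"
  shows "is_iso ShC X Y t"
proof -
  let ?i = "\<lambda>V. inv_into (fob X V) (t V)"
  let ?s = "\<lambda>V\<in>smalls. \<lambda>y\<in>fob Y V. ?i V y"
  have i: "?i V y \<in> fob X V" "t V (?i V y) = y" if "small V" "y \<in> fob Y V" for V y
    using bij[OF that(1)] that(2) by (simp_all add: bij_betw_def inv_into_into f_inv_into_f)
  have i': "?i V (t V x) = x" if "small V" "x \<in> fob X V" for V x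
    using bij[OF that(1)] that(2) by (simp add: bij_betw_def)
  have s: "?s \<in> Hom ShC Y X"
  proof (rule Sh_Hom_restrictI[OF Sh_functor[OF Y]])
    show "?i V x \<in> fob X V" if "small V" "x \<in> fob Y V" for V x using i(1)[OF that] .
    fix V W f x assume V: "small V" and W: "small W" and f: "f \<in> Mono V W" and x: "x \<in> fob Y V"
    have "farr X V W f (?i V x) \<in> fob X W"
      using setf_map[OF Sh_functor[OF X] _ _ f i(1)[OF V x]] V W by simp
    moreover have "t W (farr X V W f (?i V x)) = farr Y V W f x"
      using Sh_HomD(4)[OF t V W f i(1)[OF V x]] i(2)[OF V x] by simp
    ultimately show "?i W (farr Y V W f x) = farr X V W f (?i V x)" using i'[OF W] by metis
  qed
  show ?thesis unfolding is_iso_def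
  proof (intro conjI t bexI[OF _ s])
    show "cmp ShC X Y X ?s t = ident ShC X"
      unfolding Sh_cmp Sh_ident
    proof (rule restrict_ext)
      fix V assume "V \<in> smalls"
      then have V: "small V" by simp
      show "compose (fob X V) (?s V) (t V) = incl (fob X V)"
        unfolding compose_def by (rule restrict_ext) (simp add: V i'[OF V] Sh_HomD(3)[OF t V])
    qed
    show "cmp ShC Y X Y t ?s = ident ShC Y"
      unfolding Sh_cmp Sh_ident
    proof (rule restrict_ext)
      fix V assume "V \<in> smalls"
      then have V: "small V" by simp
      show "compose (fob Y V) (t V) (?s V) = incl (fob Y V)"
        unfolding compose_def by (rule restrict_ext) (simp add: V i(2)[OF V])
    qed
  qed
qed

abbreviation Ph where "Ph \<equiv> Phi \<kappa> lam \<nu>"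

lemma Phi_ob: "fob (fob Ph F) V = Hom E (R_ob V) F"
  and Phi_ob_arr: "f \<in> Mono V W \<Longrightarrow> farr (fob Ph F) V W f = (\<lambda>t\<in>Hom E (R_ob V) F. pull V W f t)"
  and Phi_arr: "farr Ph F G s = (\<lambda>V\<in>smalls. \<lambda>t\<in>Hom E (R_ob V) F. cmp E (R_ob V) F G s t)"
  by (simp_all add: Phi_def hom_func_def R_simps(1) E_cmp_R)

lemma pull_cmp:
  assumes f: "f \<in> Mono V W" and g: "g \<in> Mono W U" and t: "t \<in> Hom E (R_ob V) F"
  shows "pull W U g (pull V W f t) = pull V U (compose V g f) t"
proof (rule R_Hom_eqI[OF pull_Hom[OF g pull_Hom[OF f t]] pull_Hom[OF Mono_compose[OF f g] t]])
  fix T k assume T: "large T" and k: "k \<in> Mono U T"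
  show "pull W U g (pull V W f t) T k = pull V U (compose V g f) t T k"
    using T k Mono_compose[OF g k] compose_assoc_Mono[OF f, of k g] by simp
qed

lemma pull_ident: assumes t: "t \<in> Hom E (R_ob V) F" shows "pull V V (incl V) t = t"
proof (rule R_Hom_eqI[OF pull_Hom[OF Mono_incl[OF order_refl] t] t])
  fix T k assume T: "large T" and k: "k \<in> Mono V T"
  show "pull V V (incl V) t T k = t T k" using T k compose_incl_r[OF Mono_ext[OF k]] by simp
qed

text \<open>The value of \<open>t\<close> at an arbitrary injection is the value of a transported
  transformation at an inclusion, so that representatives of an element may be taken over subsets of
  \<open>S\<close>.\<close>

lemma pull_corestrict:
  assumes S: "large S" and k: "k \<in> Mono V S" and t: "t \<in> Hom E (R_ob V) F"
  shows "k \<in> Mono V (k ` V)" and "pull V (k ` V) k t \<in> Hom E (R_ob (k ` V)) F"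
    and "pull V (k ` V) k t S (incl (k ` V)) = t S k"
proof -
  show k': "k \<in> Mono V (k ` V)" using Mono_corestrict[OF k] by blast
  show "pull V (k ` V) k t \<in> Hom E (R_ob (k ` V)) F" by (rule pull_Hom[OF k' t])
  show "pull V (k ` V) k t S (incl (k ` V)) = t S k"
    using S Mono_incl[OF Mono_image[OF k]] compose_incl_left[OF k'] by simp
qed

text \<open>Evaluation at an inclusion into a set of size \<open>lam\<close> is injective, which
  bounds the hom-sets. The sheaf condition is an instance of \<open>pull_descend\<close>, once its
  question about large targets is reduced to small ones.\<close>

lemma Phi_Sh:
  assumes F: "F \<in> Ob E" shows "fob Ph F \<in> Ob ShC"
proof -
  note Ff = E_functor[OF F]
  have fn: "is_functor (Setm smalls) (Set_cat \<nu>) (fob Ph F)"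
    unfolding set_functor_iff Phi_ob
  proof (intro conjI ballI)
    fix V :: "'u set" assume "V \<in> smalls"
    then have V: "small V" by simp
    obtain S where S: "V \<subseteq> S" "|S| =o lam" using small_in_lam'[OF V] .
    note l = lam_large[OF S(2)]
    have "|Hom E (R_ob V) F| \<le>o |fob F S|"
    proof (rule card_of_ordLeqI[where f = "\<lambda>t. t S (incl V)"])
      show "inj_on (\<lambda>t. t S (incl V)) (Hom E (R_ob V) F)"
        by (rule inj_onI) (rule R_Hom_uniq[OF F V S(1) l])
      show "t S (incl V) \<in> fob F S" if "t \<in> Hom E (R_ob V) F" for t
        using R_HomD(3)[OF that l Mono_incl[OF S(1)]] .
    qed
    then show "|Hom E (R_ob V) F| <o \<nu>" using setf_card[OF Ff, of S] l ordLeq_ordLess_trans by blast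
    show "farr (fob Ph F) V V (incl V) t = t" if t: "t \<in> Hom E (R_ob V) F" for t
      using t pull_ident[OF t] by (simp add: Phi_ob_arr[OF Mono_incl[OF order_refl]])
    fix W
    show "farr (fob Ph F) V W f \<in> Hom E (R_ob V) F \<rightarrow>\<^sub>E Hom E (R_ob W) F" if f: "f \<in> Mono V W" for f
      unfolding Phi_ob_arr[OF f] using pull_Hom[OF f] by simp
    fix U f g t assume f: "f \<in> Mono V W" and g: "g \<in> Mono W U" and t: "t \<in> Hom E (R_ob V) F"
    show "farr (fob Ph F) V U (compose V g f) t = farr (fob Ph F) W U g (farr (fob Ph F) V W f t)"
      unfolding Phi_ob_arr[OF f] Phi_ob_arr[OF g] Phi_ob_arr[OF Mono_compose[OF f g]]
      using t pull_Hom[OF f t] pull_cmp[OF f g t] by simp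
  qed
  have "is_sheaf Cop (atomic_topology Cop) (fob Ph F)"
    unfolding atomic_sheaf_iff[OF fn] Phi_ob
  proof (intro allI impI)
    fix V W f t assume V: "small V" and W: "small W" and f: "f \<in> Mono V W" and t: "t \<in> Hom E (R_ob W) F"
      and inv: "\<forall>U g g'. small U \<longrightarrow> g \<in> Mono W U \<longrightarrow> g' \<in> Mono W U \<longrightarrow> compose V g f = compose V g' f \<longrightarrow>
        farr (fob Ph F) W U g t = farr (fob Ph F) W U g' t"
    have "\<exists>s\<in>Hom E (R_ob V) F. pull V W f s = t"
    proof (rule pull_descend[OF f W t])
      fix T k k' assume T: "large T" and k: "k \<in> Mono W T" and k': "k' \<in> Mono W T" and eq: "compose V k f = compose V k' f"
      \<comment> \<open>\<open>k\<close> and \<open>k'\<close> factor through the small union of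
        their images, where the hypothesis \<open>inv\<close> on small targets can be used.\<close>
      let ?U = "k ` W \<union> k' ` W"
      have U: "small ?U" "?U \<subseteq> T" using W Mono_image[OF k] Mono_image[OF k'] by (auto intro: small_Un card_of_image_ordLess)
      have kU: "k \<in> Mono W ?U" "k' \<in> Mono W ?U" using Mono_corestrict[OF k] Mono_corestrict[OF k'] by blast+
      have "farr (fob Ph F) W ?U k t = farr (fob Ph F) W ?U k' t" using inv U(1) kU eq by blast
      then have p: "pull W ?U k t = pull W ?U k' t" using t by (simp add: Phi_ob_arr[OF kU(1)] Phi_ob_arr[OF kU(2)])
      show "t T k = t T k'"
        using fun_cong[OF fun_cong[OF p, of T], of "incl ?U"] T Mono_incl[OF U(2)]
          compose_incl_left[OF kU(1)] compose_incl_left[OF kU(2)] by simp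
    qed
    then obtain s where s: "s \<in> Hom E (R_ob V) F" "pull V W f s = t" by blast
    show "\<exists>!s. s \<in> Hom E (R_ob V) F \<and> farr (fob Ph F) V W f s = t"
    proof (rule ex1I[of _ s])
      show "s \<in> Hom E (R_ob V) F \<and> farr (fob Ph F) V W f s = t" using s by (simp add: Phi_ob_arr[OF f])
      fix s' assume s': "s' \<in> Hom E (R_ob V) F \<and> farr (fob Ph F) V W f s' = t"
      then have "pull V W f s' = t" unfolding Phi_ob_arr[OF f] by (metis restrict_apply')
      then show "s' = s" using pull_inj[OF f W conjunct1[OF s'] s(1)] s(2) by simp
    qed
  qed
  then show ?thesis unfolding Sh_Ob using fn by blast
qed

lemma cmp_R_apply:
  assumes "large S" and "k \<in> Mono V S"
  shows "cmp E (R_ob V) F G s t S k = s S (t S k)"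
  using assms by (simp add: E_cmp compose_eq)

lemma cmp_R_Hom:
  assumes F: "F \<in> Ob E" and G: "G \<in> Ob E" and V: "small V" and s: "s \<in> Hom E F G" and t: "t \<in> Hom E (R_ob V) F"
  shows "cmp E (R_ob V) F G s t \<in> Hom E (R_ob V) G"
  by (rule cat_cmp[OF is_category_E R_ob_E[OF V] F G t s])

lemma Phi_functor: "is_functor E ShC Ph"
  unfolding is_functor_def
proof (intro conjI ballI)
  show "is_category E" "is_category ShC" by (rule is_category_E is_category_Sh)+
  fix F assume F: "F \<in> Ob E"
  show "fob Ph F \<in> Ob ShC" by (rule Phi_Sh[OF F])
  show "farr Ph F F (ident E F) = ident ShC (fob Ph F)"
    unfolding Phi_arr Sh_ident Phi_ob
  proof (intro restrict_ext)
    fix V t assume "V \<in> smalls" and t: "t \<in> Hom E (R_ob V) F"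
    then show "cmp E (R_ob V) F F (ident E F) t = t" using cat_idl[OF is_category_E R_ob_E F t] by simp
  qed
  fix G assume G: "G \<in> Ob E"
  show "farr Ph F G s \<in> Hom ShC (fob Ph F) (fob Ph G)" if s: "s \<in> Hom E F G" for s
    unfolding Phi_arr Phi_ob[symmetric]
  proof (rule Sh_Hom_restrictI[OF Sh_functor[OF Phi_Sh[OF F]]]; unfold Phi_ob)
    show "cmp E (R_ob V) F G s t \<in> Hom E (R_ob V) G" if "small V" "t \<in> Hom E (R_ob V) F" for V t
      by (rule cmp_R_Hom[OF F G that(1) s that(2)])
    fix V W f t assume V: "small V" and W: "small W" and f: "f \<in> Mono V W" and t: "t \<in> Hom E (R_ob V) F"
    note st = cmp_R_Hom[OF F G V s t]
    have "cmp E (R_ob W) F G s (pull V W f t) = pull V W f (cmp E (R_ob V) F G s t)"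
    proof (rule R_Hom_eqI[OF cmp_R_Hom[OF F G W s pull_Hom[OF f t]] pull_Hom[OF f st]])
      fix T k assume T: "large T" and k: "k \<in> Mono W T"
      show "cmp E (R_ob W) F G s (pull V W f t) T k = pull V W f (cmp E (R_ob V) F G s t) T k"
        using cmp_R_apply[OF T k] cmp_R_apply[OF T Mono_compose[OF f k]] T k by simp
    qed
    then show "cmp E (R_ob W) F G s (farr (fob Ph F) V W f t) = farr (fob Ph G) V W f (cmp E (R_ob V) F G s t)"
      using t st by (simp add: Phi_ob_arr[OF f])
  qed
  fix H s r assume H: "H \<in> Ob E" and s: "s \<in> Hom E F G" and r: "r \<in> Hom E G H"
  show "farr Ph F H (cmp E F G H r s) = cmp ShC (fob Ph F) (fob Ph G) (fob Ph H) (farr Ph G H r) (farr Ph F G s)"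
    unfolding Phi_arr Sh_cmp Phi_ob
  proof (rule restrict_ext)
    fix V assume "V \<in> smalls"
    then have V: "small V" by simp
    show "(\<lambda>t\<in>Hom E (R_ob V) F. cmp E (R_ob V) F H (cmp E F G H r s) t) =
      compose (Hom E (R_ob V) F) ((\<lambda>V\<in>smalls. \<lambda>t\<in>Hom E (R_ob V) G. cmp E (R_ob V) G H r t) V)
        ((\<lambda>V\<in>smalls. \<lambda>t\<in>Hom E (R_ob V) F. cmp E (R_ob V) F G s t) V)"
      unfolding compose_def
      by (rule restrict_ext) (simp add: V cmp_R_Hom[OF F G V s] cat_assoc[OF is_category_E R_ob_E[OF V] F G H _ s r])
  qed
qed

text \<open>Each element of \<open>fob F S\<close> is the value \<open>t S (incl V)\<close> of a
  transformation out of some \<open>R_ob V\<close>, so a map of sheaves prescribes where that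
  element must go. This gives uniqueness and, after a check of independence, existence.\<close>

lemma Phi_fully_faithful: "fully_faithful E ShC Ph"
  unfolding fully_faithful_def
proof (intro conjI Phi_functor ballI)
  fix F G assume F: "F \<in> Ob E" and G: "G \<in> Ob E"
  note Ff = E_functor[OF F]
  have "inj_on (farr Ph F G) (Hom E F G)"
  proof (rule inj_onI)
    fix s s' assume s: "s \<in> Hom E F G" and s': "s' \<in> Hom E F G" and eq: "farr Ph F G s = farr Ph F G s'"
    show "s = s'"
    proof (rule E_Hom_eqI[OF s s'])
      fix S x assume S: "large S" and x: "x \<in> fob F S"
      obtain V t where V: "V \<subseteq> S" "small V" and t: "t \<in> Hom E (R_ob V) F" and tx: "t S (incl V) = x"
        using R_Hom_exists[OF F S x] by blast
      have "cmp E (R_ob V) F G s t = cmp E (R_ob V) F G s' t"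
        using fun_cong[OF fun_cong[OF eq, of V], of t] V(2) t by (simp add: Phi_arr)
      from fun_cong[OF fun_cong[OF this, of S], of "incl V"] show "s S x = s' S x"
        using cmp_R_apply[OF S Mono_incl[OF V(1)]] tx by simp
    qed
  qed
  moreover have "\<phi> \<in> farr Ph F G ` Hom E F G" if \<phi>: "\<phi> \<in> Hom ShC (fob Ph F) (fob Ph G)" for \<phi>
  proof -
    have \<phi>H: "\<phi> V t \<in> Hom E (R_ob V) G" if "small V" "t \<in> Hom E (R_ob V) F" for V t
      using Sh_HomD(3)[OF \<phi> that(1)] that(2) by (simp add: Phi_ob)
    have \<phi>p: "\<phi> W (pull V W f t) = pull V W f (\<phi> V t)" if "small V" "small W" "f \<in> Mono V W" "t \<in> Hom E (R_ob V) F" for V W f t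
      using Sh_HomD(4)[OF \<phi> that(1-3)] that(4) \<phi>H[OF that(1,4)] by (simp add: Phi_ob Phi_ob_arr[OF that(3)])
    \<comment> \<open>Two representatives of one element become equal when pulled to
      \<open>V \<union> V'\<close>, as they have the same value at its inclusion; \<phi> commutes
      with pulling, so the prescribed images agree.\<close>
    have wd: "\<phi> V t S (incl V) = \<phi> V' t' S (incl V')"
      if S: "large S" and V: "V \<subseteq> S" "small V" and V': "V' \<subseteq> S" "small V'" and t: "t \<in> Hom E (R_ob V) F"
        and t': "t' \<in> Hom E (R_ob V') F" and eq: "t S (incl V) = t' S (incl V')" for S V V' t t'
    proof -
      let ?K = "V \<union> V'"
      have K: "small ?K" "?K \<subseteq> S" using V V' by (auto intro: small_Un)
      have i: "incl V \<in> Mono V ?K" "incl V' \<in> Mono V' ?K" "incl ?K \<in> Mono ?K S" using K by (auto intro!: Mono_incl)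
      note ii = compose_incl_left[OF i(1)] compose_incl_left[OF i(2)]
      have "pull V ?K (incl V) t = pull V' ?K (incl V') t'"
        by (rule R_Hom_uniq[OF F K S pull_Hom[OF i(1) t] pull_Hom[OF i(2) t']]) (simp only: pull_apply[OF S i(3)] ii eq)
      then have "pull V ?K (incl V) (\<phi> V t) = pull V' ?K (incl V') (\<phi> V' t')"
        using \<phi>p[OF V(2) K(1) i(1) t] \<phi>p[OF V'(2) K(1) i(2) t'] by simp
      from fun_cong[OF fun_cong[OF this, of S], of "incl ?K"] show ?thesis
        unfolding pull_apply[OF S i(3)] ii .
    qed
    have "\<exists>p. fst p \<subseteq> S \<and> small (fst p) \<and> snd p \<in> Hom E (R_ob (fst p)) F \<and> snd p S (incl (fst p)) = x"
      if "large S" "x \<in> fob F S" for S x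
      using R_Hom_exists[OF F that] by (metis fst_conv snd_conv)
    then obtain p where p: "\<And>S x. large S \<Longrightarrow> x \<in> fob F S \<Longrightarrow> fst (p S x) \<subseteq> S \<and> small (fst (p S x)) \<and>
      snd (p S x) \<in> Hom E (R_ob (fst (p S x))) F \<and> snd (p S x) S (incl (fst (p S x))) = x" by metis
    define r where "r S x = \<phi> (fst (p S x)) (snd (p S x)) S (incl (fst (p S x)))" for S x
    \<comment> \<open>From inclusions to every \<open>k\<close>, by replacing \<open>V\<close> with
      the image of \<open>k\<close>. This form yields both the naturality of \<open>r\<close> and
      the recovery of \<phi>.\<close>
    have r: "r S (t S k) = \<phi> V t S k" if S: "large S" and V: "small V" and k: "k \<in> Mono V S" and t: "t \<in> Hom E (R_ob V) F" for S V k t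
    proof -
      note c = pull_corestrict[OF S k t]
      have kV: "small (k ` V)" "k ` V \<subseteq> S" using V Mono_image[OF k] by (auto intro: card_of_image_ordLess)
      note x = R_HomD(3)[OF t S k]
      note q = p[OF S x]
      have "r S (t S k) = \<phi> (k ` V) (pull V (k ` V) k t) S (incl (k ` V))"
        unfolding r_def by (rule wd[OF S _ _ kV(2,1) _ c(2)]) (use q c(3) in auto)
      also have "\<dots> = pull V (k ` V) k (\<phi> V t) S (incl (k ` V))" using \<phi>p[OF V kV(1) c(1) t] by simp
      also have "\<dots> = \<phi> V t S k" by (rule pull_corestrict(3)[OF S k \<phi>H[OF V t]])
      finally show ?thesis .
    qed
    let ?s = "\<lambda>S\<in>Collect large. \<lambda>x\<in>fob F S. r S x"
    have s: "?s \<in> Hom E F G"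
    proof (rule E_Hom_restrictI[OF Ff])
      show "r S x \<in> fob G S" if S: "large S" and x: "x \<in> fob F S" for S x
        unfolding r_def using p[OF S x] R_HomD(3)[OF \<phi>H S Mono_incl] by blast
      fix S T g x assume S: "large S" and T: "large T" and g: "g \<in> Mono S T" and x: "x \<in> fob F S"
      obtain V t where V: "V \<subseteq> S" "small V" and t: "t \<in> Hom E (R_ob V) F" and tx: "t S (incl V) = x"
        using R_Hom_exists[OF F S x] by blast
      note i = Mono_incl[OF V(1)]
      have "r T (farr F S T g x) = r T (t T (compose V g (incl V)))"
        using R_HomD(4)[OF t S T g i] tx by simp
      also have "\<dots> = \<phi> V t T (compose V g (incl V))" by (rule r[OF T V(2) Mono_compose[OF i g] t])
      also have "\<dots> = farr G S T g (\<phi> V t S (incl V))" using R_HomD(4)[OF \<phi>H[OF V(2) t] S T g i] by simp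
      also have "\<phi> V t S (incl V) = r S x" using r[OF S V(2) i t] tx by simp
      finally show "r T (farr F S T g x) = farr G S T g (r S x)" .
    qed
    have "farr Ph F G ?s = \<phi>"
    proof (rule Sh_Hom_eqI[OF func_arr[OF Phi_functor F G s] \<phi>])
      fix V t assume V: "small V" and "t \<in> fob (fob Ph F) V"
      then have t: "t \<in> Hom E (R_ob V) F" by (simp add: Phi_ob)
      have "cmp E (R_ob V) F G ?s t = \<phi> V t"
      proof (rule R_Hom_eqI[OF cmp_R_Hom[OF F G V s t] \<phi>H[OF V t]])
        fix T k assume T: "large T" and k: "k \<in> Mono V T"
        show "cmp E (R_ob V) F G ?s t T k = \<phi> V t T k"
          using cmp_R_apply[OF T k] r[OF T V k t] T R_HomD(3)[OF t T k] by simp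
      qed
      then show "farr Ph F G ?s V t = \<phi> V t" using V t by (simp add: Phi_arr)
    qed
    then show ?thesis using s by blast
  qed
  ultimately show "bij_betw (farr Ph F G) (Hom E F G) (Hom ShC (fob Ph F) (fob Ph G))"
    using func_arr[OF Phi_functor F G] by (auto simp: bij_betw_def)
qed

end

section \<open>Extending an atomic sheaf to large sets\<close>

locale atomic_sheaf = scott_cards \<kappa> lam \<nu> for \<kappa> lam \<nu> :: "'u rel" +
  fixes X :: "('u set, 'u \<Rightarrow> 'u, 'x set, 'x \<Rightarrow> 'x) func"
  assumes X_Sh: "X \<in> Ob ShC"
begin

lemmas X_functor = Sh_functor[OF X_Sh]

lemma X_map: "small V \<Longrightarrow> small W \<Longrightarrow> f \<in> Mono V W \<Longrightarrow> x \<in> fob X V \<Longrightarrow> farr X V W f x \<in> fob X W"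
  using setf_map[OF X_functor] by simp

lemma X_cmp: "small V \<Longrightarrow> small W \<Longrightarrow> small U \<Longrightarrow> f \<in> Mono V W \<Longrightarrow> g \<in> Mono W U \<Longrightarrow> x \<in> fob X V \<Longrightarrow>
    farr X W U g (farr X V W f x) = farr X V U (compose V g f) x"
  using setf_cmp[OF X_functor] by simp

lemma X_ident: "small V \<Longrightarrow> x \<in> fob X V \<Longrightarrow> farr X V V (incl V) x = x"
  using setf_ident[OF X_functor] by simp

lemma X_descend:
  assumes "small V" "small W" "f \<in> Mono V W" "x \<in> fob X W"
    and "\<And>U g g'. small U \<Longrightarrow> g \<in> Mono W U \<Longrightarrow> g' \<in> Mono W U \<Longrightarrow> compose V g f = compose V g' f \<Longrightarrow>
      farr X W U g x = farr X W U g' x"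
  shows "\<exists>!y. y \<in> fob X V \<and> farr X V W f y = x"
proof -
  have sh: "is_sheaf Cop (atomic_topology Cop) X" using X_Sh unfolding Sh_Ob by blast
  show ?thesis
    by (rule sh[unfolded atomic_sheaf_iff[OF X_functor], rule_format]) (rule assms; assumption)+
qed

lemma X_inj:
  assumes f: "small V" "small W" "f \<in> Mono V W" and y: "y \<in> fob X V" "y' \<in> fob X V"
    and eq: "farr X V W f y = farr X V W f y'"
  shows "y = y'"
proof -
  have "\<exists>!z. z \<in> fob X V \<and> farr X V W f z = farr X V W f y"
    by (rule X_descend[OF f X_map[OF f y(1)]]) (simp add: X_cmp[OF f(1,2) _ f(3) _ y(1)])
  then show ?thesis by (rule ex1_unique) (use y eq in simp_all)
qed

text \<open>\<open>X\<close> extends to large sets by \<open>T \<mapsto> colim X(V)\<close> over the small subsets \<open>V\<close> of \<open>T\<close>; a pair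
  \<open>(V, x)\<close> stands for the class of \<open>x \<in> X(V)\<close>.\<close>
definition germs :: "'u set \<Rightarrow> ('u set \<times> 'x) set" where "germs T = (SIGMA V : smallsub T. fob X V)"

text \<open>Equality in the colimit is agreement at some common stage. The transition maps of an
  atomic sheaf are injective, so it can be tested at the least common stage.\<close>

definition germ_eq :: "'u set \<times> 'x \<Rightarrow> 'u set \<times> 'x \<Rightarrow> bool" where
  "germ_eq p q \<longleftrightarrow> (let K = fst p \<union> fst q in
    farr X (fst p) K (incl (fst p)) (snd p) = farr X (fst q) K (incl (fst q)) (snd q))"

lemma germs_iff: "(V, x) \<in> germs T \<longleftrightarrow> V \<subseteq> T \<and> small V \<and> x \<in> fob X V"
  by (auto simp: germs_def smallsub_def)

lemma incl_cmp:
  assumes "V \<subseteq> K" shows "compose V (incl K) (incl V) = incl V"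
  using compose_incl_left[OF Mono_incl[OF assms]] .

lemma X_incl_cmp:
  assumes "small V" "small K" "small L" "V \<subseteq> K" "K \<subseteq> L" "x \<in> fob X V"
  shows "farr X K L (incl K) (farr X V K (incl V) x) = farr X V L (incl V) x"
  using X_cmp[OF assms(1-3) Mono_incl[OF assms(4)] Mono_incl[OF assms(5)] assms(6)] incl_cmp[OF assms(4)] by simp

text \<open>By \<open>X_inj\<close> the comparison may be made in any small set containing both
  \<open>V\<close> and \<open>W\<close>; transitivity and transport along injections both depend on
  this freedom.\<close>

lemma germ_eq_iff:
  assumes V: "small V" "x \<in> fob X V" and W: "small W" "y \<in> fob X W" and K: "small K" "V \<subseteq> K" "W \<subseteq> K"
  shows "germ_eq (V, x) (W, y) \<longleftrightarrow> farr X V K (incl V) x = farr X W K (incl W) y"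
proof -
  let ?U = "V \<union> W"
  have U: "small ?U" "?U \<subseteq> K" "V \<subseteq> ?U" "W \<subseteq> ?U" using V W K small_Un by blast+
  have "farr X ?U K (incl ?U) (farr X V ?U (incl V) x) = farr X V K (incl V) x"
    by (rule X_incl_cmp[OF V(1) U(1) K(1) U(3,2) V(2)])
  moreover have "farr X ?U K (incl ?U) (farr X W ?U (incl W) y) = farr X W K (incl W) y"
    by (rule X_incl_cmp[OF W(1) U(1) K(1) U(4,2) W(2)])
  ultimately have "farr X V ?U (incl V) x = farr X W ?U (incl W) y \<longleftrightarrow> farr X V K (incl V) x = farr X W K (incl W) y"
    using X_inj[OF U(1) K(1) Mono_incl[OF U(2)] X_map[OF V(1) U(1) Mono_incl[OF U(3)] V(2)]
        X_map[OF W(1) U(1) Mono_incl[OF U(4)] W(2)]] by metis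
  then show ?thesis by (simp add: germ_eq_def Let_def)
qed

lemma germ_eq_refl: "germ_eq p p"
  and germ_eq_sym: "germ_eq p q \<Longrightarrow> germ_eq q p"
  by (simp_all add: germ_eq_def Let_def Un_commute)

lemma germ_eq_trans:
  assumes "p \<in> germs T" "q \<in> germs T" "r \<in> germs T" and pq: "germ_eq p q" and qr: "germ_eq q r"
  shows "germ_eq p r"
proof -
  obtain V x W y U z where e: "p = (V, x)" "q = (W, y)" "r = (U, z)" by (metis surj_pair)
  then have V: "small V" "x \<in> fob X V" and W: "small W" "y \<in> fob X W" and U: "small U" "z \<in> fob X U"
    using assms by (simp_all add: germs_iff)
  let ?K = "V \<union> W \<union> U"
  have K: "small ?K" "V \<subseteq> ?K" "W \<subseteq> ?K" "U \<subseteq> ?K" using V W U small_Un by blast+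
  show ?thesis
    using pq qr unfolding e germ_eq_iff[OF V W K(1-3)] germ_eq_iff[OF W U K(1,3,4)] germ_eq_iff[OF V U K(1,2,4)] by simp
qed

lemma germs_card: assumes T: "|T| <o \<nu>" shows "|germs T| <o \<nu>"
proof -
  have "|\<Union>V\<in>smallsub T. Pair V ` fob X V| <o \<nu>"
    using setf_card[OF X_functor] by (intro \<nu>_UN smallsub_\<nu>[OF T] card_of_image_ordLess) (simp add: smallsub_def)
  moreover have "(\<Union>V\<in>smallsub T. Pair V ` fob X V) = germs T" by (auto simp: germs_def)
  ultimately show ?thesis by simp
qed

text \<open>Objects of the topos have values in sets of functions on \<open>'u\<close>, whereas
  germs may live in another type. There are fewer than \<nu> classes of germs, so they fit into the
  required type; \<open>code T\<close> is some map separating exactly the classes.\<close>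

definition code :: "'u set \<Rightarrow> 'u set \<times> 'x \<Rightarrow> 'u \<Rightarrow> 'u" where
  "code T = (SOME c. \<forall>p\<in>germs T. \<forall>q\<in>germs T. c p = c q \<longleftrightarrow> germ_eq p q)"

lemma code_eq:
  assumes T: "|T| <o \<nu>" and p: "p \<in> germs T" and q: "q \<in> germs T"
  shows "code T p = code T q \<longleftrightarrow> germ_eq p q"
proof -
  let ?c = "\<lambda>p. {q \<in> germs T. germ_eq p q}"
  have "|?c ` germs T| <o \<nu>" by (rule card_of_image_ordLess[OF germs_card[OF T]])
  from room[OF T this] obtain \<iota> where \<iota>: "inj_on \<iota> (?c ` germs T)" "\<iota> ` ?c ` germs T \<inter> T = {}" .
  \<comment> \<open>A class is coded by the constant function at an element of \<open>'u\<close>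
    that names it.\<close>
  have "(\<lambda>_. \<iota> (?c p)) = (\<lambda>_ :: 'u. \<iota> (?c q)) \<longleftrightarrow> germ_eq p q" if p: "p \<in> germs T" and q: "q \<in> germs T" for p q
  proof
    assume "(\<lambda>_. \<iota> (?c p)) = (\<lambda>_ :: 'u. \<iota> (?c q))"
    then have "\<iota> (?c p) = \<iota> (?c q)" by (rule fun_cong)
    then have "?c p = ?c q" using p q by (intro inj_onD[OF \<iota>(1)] imageI)
    then show "germ_eq p q" using q germ_eq_refl[of q] by blast
  next
    assume pq: "germ_eq p q"
    have "?c p = ?c q"
      using germ_eq_trans[OF p q _ pq] germ_eq_trans[OF q p _ germ_eq_sym[OF pq]] by blast
    then show "(\<lambda>_. \<iota> (?c p)) = (\<lambda>_ :: 'u. \<iota> (?c q))" by simp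
  qed
  then have "\<exists>c :: _ \<Rightarrow> 'u \<Rightarrow> 'u. \<forall>p\<in>germs T. \<forall>q\<in>germs T. c p = c q \<longleftrightarrow> germ_eq p q"
    by (intro exI[of _ "\<lambda>p _. \<iota> (?c p)"]) blast
  from someI_ex[OF this] show ?thesis using p q unfolding code_def by blast
qed

definition push :: "('u \<Rightarrow> 'u) \<Rightarrow> 'u set \<times> 'x \<Rightarrow> 'u set \<times> 'x" where
  "push g = (\<lambda>(V, x). (g ` V, farr X V (g ` V) (restrict g V) x))"

lemma restrict_Mono_image:
  assumes "g \<in> Mono T U" and "V \<subseteq> T"
  shows "restrict g V \<in> Mono V (g ` V)"
  using Mono_corestrict[OF Mono_restrict[OF assms], of "g ` V"] by auto

lemma push_germs:
  assumes g: "g \<in> Mono T U" and p: "p \<in> germs T"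
  shows "push g p \<in> germs U"
proof -
  obtain V x where e: "p = (V, x)" by (metis surj_pair)
  then have V: "V \<subseteq> T" "small V" "x \<in> fob X V" using p by (simp_all add: germs_iff)
  have "g ` V \<subseteq> U" using Mono_image[OF g] V(1) by blast
  then show ?thesis
    using X_map[OF V(2) _ restrict_Mono_image[OF g V(1)] V(3)] card_of_image_ordLess[OF V(2), of g]
    by (simp add: e push_def germs_iff)
qed

lemma push_ident:
  assumes "p \<in> germs T" shows "push (incl T) p = p"
proof -
  obtain V x where e: "p = (V, x)" by (metis surj_pair)
  then have V: "V \<subseteq> T" "small V" "x \<in> fob X V" using assms by (simp_all add: germs_iff)
  have "restrict (incl T) V = incl V" "incl T ` V = V" using V(1) by (auto simp: Int_absorb1)
  then show ?thesis using X_ident[OF V(2,3)] by (simp add: e push_def)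
qed

lemma push_cmp:
  assumes f: "f \<in> Mono S T" and g: "g \<in> Mono T U" and p: "p \<in> germs S"
  shows "push (compose S g f) p = push g (push f p)"
proof -
  obtain V x where e: "p = (V, x)" by (metis surj_pair)
  then have V: "V \<subseteq> S" "small V" "x \<in> fob X V" using p by (simp_all add: germs_iff)
  have fV: "f ` V \<subseteq> T" using Mono_image[OF f] V(1) by blast
  have s: "small (f ` V)" "small (g ` f ` V)" by (intro card_of_image_ordLess V(2))+
  have im: "compose S g f ` V = g ` f ` V" using V(1) by (auto simp: compose_def image_iff)
  have "compose V (restrict g (f ` V)) (restrict f V) = restrict (compose S g f) V"
    unfolding compose_def using V(1) by (intro restrict_ext) auto
  then have "farr X (f ` V) (g ` f ` V) (restrict g (f ` V)) (farr X V (f ` V) (restrict f V) x) =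
      farr X V (g ` f ` V) (restrict (compose S g f) V) x"
    using X_cmp[OF V(2) s restrict_Mono_image[OF f V(1)] restrict_Mono_image[OF g fV] V(3)] by simp
  then show ?thesis by (simp add: e push_def im)
qed

text \<open>One direction makes the action on classes well defined, the other makes it injective.
  Both hold because \<open>g\<close> restricts to an injection from the union of the two sets onto
  its image, along which the transition map of \<open>X\<close> is injective.\<close>

lemma push_germ_eq:
  assumes g: "g \<in> Mono T U" and p: "p \<in> germs T" and q: "q \<in> germs T"
  shows "germ_eq (push g p) (push g q) \<longleftrightarrow> germ_eq p q"
proof -
  obtain V x W y where e: "p = (V, x)" "q = (W, y)" by (metis surj_pair)
  then have V: "V \<subseteq> T" "small V" "x \<in> fob X V" and W: "W \<subseteq> T" "small W" "y \<in> fob X W"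
    using p q by (simp_all add: germs_iff)
  let ?K = "V \<union> W"
  have K: "small ?K" "V \<subseteq> ?K" "W \<subseteq> ?K" "?K \<subseteq> T" using V W small_Un by blast+
  have gK: "small (g ` ?K)" by (rule card_of_image_ordLess[OF K(1)])
  note rK = restrict_Mono_image[OF g K(4)]
  have step: "farr X (g ` Z) (g ` ?K) (incl (g ` Z)) (farr X Z (g ` Z) (restrict g Z) z) =
      farr X ?K (g ` ?K) (restrict g ?K) (farr X Z ?K (incl Z) z)"
    if Z: "Z \<subseteq> ?K" "small Z" and z: "z \<in> fob X Z" for Z z
  proof -
    have ZT: "Z \<subseteq> T" using Z K by blast
    note rZ = restrict_Mono_image[OF g ZT]
    have gZ: "small (g ` Z)" "g ` Z \<subseteq> g ` ?K" using Z by (auto intro: card_of_image_ordLess)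
    have "compose Z (incl (g ` Z)) (restrict g Z) = compose Z (restrict g ?K) (incl Z)"
      unfolding compose_def using Z(1) by (intro restrict_ext) auto
    then show ?thesis
      using X_cmp[OF Z(2) gZ(1) gK rZ Mono_incl[OF gZ(2)] z] X_cmp[OF Z(2) K(1) gK Mono_incl[OF Z(1)] rK z] by simp
  qed
  have mem: "farr X Z (g ` Z) (restrict g Z) z \<in> fob X (g ` Z)" "small (g ` Z)" "g ` Z \<subseteq> g ` ?K"
    if Z: "Z \<subseteq> ?K" "small Z" and z: "z \<in> fob X Z" for Z z
  proof -
    show s: "small (g ` Z)" by (rule card_of_image_ordLess[OF Z(2)])
    have "Z \<subseteq> T" using Z K by blast
    then show "farr X Z (g ` Z) (restrict g Z) z \<in> fob X (g ` Z)" by (rule X_map[OF Z(2) s restrict_Mono_image[OF g] z])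
    show "g ` Z \<subseteq> g ` ?K" using Z(1) by (rule image_mono)
  qed
  note mV = mem[OF K(2) V(2,3)] and mW = mem[OF K(3) W(2,3)]
  have "germ_eq (push g p) (push g q) \<longleftrightarrow>
      farr X ?K (g ` ?K) (restrict g ?K) (farr X V ?K (incl V) x) = farr X ?K (g ` ?K) (restrict g ?K) (farr X W ?K (incl W) y)"
    unfolding e push_def prod.case germ_eq_iff[OF mV(2,1) mW(2,1) gK mV(3) mW(3)]
      step[OF K(2) V(2,3)] step[OF K(3) W(2,3)] ..
  also have "\<dots> \<longleftrightarrow> farr X V ?K (incl V) x = farr X W ?K (incl W) y"
    using X_inj[OF K(1) gK rK X_map[OF V(2) K(1) Mono_incl[OF K(2)] V(3)] X_map[OF W(2) K(1) Mono_incl[OF K(3)] W(3)]]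
    by metis
  also have "\<dots> \<longleftrightarrow> germ_eq p q" unfolding e germ_eq_iff[OF V(2,3) W(2,3) K(1-3)] ..
  finally show ?thesis .
qed

text \<open>On arrows a representative is picked by \<open>inv_into\<close>; \<open>ext_farr\<close>
  shows that any other gives the same class.\<close>

definition ext :: "'u scott_ob" where
  "ext = \<lparr>fob = (\<lambda>T. code T ` germs T),
    farr = (\<lambda>T U g. \<lambda>z\<in>code T ` germs T. code U (push g (inv_into (germs T) (code T) z)))\<rparr>"

lemma ext_fob: "fob ext T = code T ` germs T"
  by (simp add: ext_def)

lemma ext_farr:
  assumes T: "|T| <o \<nu>" and U: "|U| <o \<nu>" and g: "g \<in> Mono T U" and p: "p \<in> germs T"
  shows "farr ext T U g (code T p) = code U (push g p)"
proof -
  let ?q = "inv_into (germs T) (code T) (code T p)"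
  have q: "?q \<in> germs T" "code T ?q = code T p" using p by (simp_all add: inv_into_into f_inv_into_f)
  then have "germ_eq ?q p" using code_eq[OF T q(1) p] by simp
  then have "germ_eq (push g ?q) (push g p)" using push_germ_eq[OF g q(1) p] by simp
  then have "code U (push g ?q) = code U (push g p)"
    using code_eq[OF U push_germs[OF g q(1)] push_germs[OF g p]] by simp
  then show ?thesis using p by (simp add: ext_def)
qed

lemma ext_functor: "is_functor (Setm (Collect large)) (Set_cat \<nu>) ext"
  unfolding set_functor_iff
proof (intro conjI ballI)
  fix S assume "S \<in> Collect large"
  then have S: "|S| <o \<nu>" by (simp add: large_def)
  show "|fob ext S| <o \<nu>" unfolding ext_fob by (rule card_of_image_ordLess[OF germs_card[OF S]])
  show "farr ext S S (incl S) x = x" if x: "x \<in> fob ext S" for x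
  proof -
    obtain p where p: "p \<in> germs S" "x = code S p" using x unfolding ext_fob by blast
    show ?thesis unfolding p(2) ext_farr[OF S S Mono_incl[OF order_refl] p(1)] push_ident[OF p(1)] ..
  qed
  fix T assume "T \<in> Collect large"
  then have T: "|T| <o \<nu>" by (simp add: large_def)
  show "farr ext S T f \<in> fob ext S \<rightarrow>\<^sub>E fob ext T" if f: "f \<in> Mono S T" for f
  proof -
    have "farr ext S T f (code S p) \<in> fob ext T" if "p \<in> germs S" for p
      unfolding ext_farr[OF S T f that] ext_fob using push_germs[OF f that] by blast
    moreover have "farr ext S T f \<in> extensional (fob ext S)" by (simp add: ext_def)
    ultimately show ?thesis unfolding ext_fob PiE_def by blast
  qed
  fix U f g x assume "U \<in> Collect large" and f: "f \<in> Mono S T" and g: "g \<in> Mono T U" and x: "x \<in> fob ext S"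
  then have U: "|U| <o \<nu>" by (simp add: large_def)
  obtain p where p: "p \<in> germs S" "x = code S p" using x unfolding ext_fob by blast
  show "farr ext S U (compose S g f) x = farr ext T U g (farr ext S T f x)"
    unfolding p(2) ext_farr[OF S U Mono_compose[OF f g] p(1)] ext_farr[OF S T f p(1)]
      ext_farr[OF T U g push_germs[OF f p(1)]] push_cmp[OF f g p(1)] ..
qed

text \<open>The class of \<open>(V, y)\<close> is supported in \<open>V\<close>, and the injectivity
  on arrows comes from \<open>push_germ_eq\<close>.\<close>

lemma ext_E: "ext \<in> Ob E"
  unfolding E_Ob A_eq
proof (intro conjI ext_functor small_supports_preserve[unfolded A_eq])
  fix S T m assume "large S" and "large T" and m: "m \<in> Mono S T"
  then have S: "|S| <o \<nu>" and T: "|T| <o \<nu>" by (simp_all add: large_def)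
  show "inj_on (farr ext S T m) (fob ext S)"
  proof (rule inj_onI)
    fix x y assume x: "x \<in> fob ext S" and y: "y \<in> fob ext S" and eq: "farr ext S T m x = farr ext S T m y"
    obtain p where p: "p \<in> germs S" "x = code S p" using x unfolding ext_fob by blast
    obtain q where q: "q \<in> germs S" "y = code S q" using y unfolding ext_fob by blast
    have "germ_eq (push m p) (push m q)"
      using eq ext_farr[OF S T m p(1)] ext_farr[OF S T m q(1)] code_eq[OF T push_germs[OF m p(1)] push_germs[OF m q(1)]]
      unfolding p(2) q(2) by simp
    then show "x = y" unfolding p(2) q(2) using push_germ_eq[OF m p(1) q(1)] code_eq[OF S p(1) q(1)] by simp
  qed
next
  fix S x assume lS: "large S" and "x \<in> fob ext S"
  then obtain V y where p: "(V, y) \<in> germs S" "x = code S (V, y)" unfolding ext_fob by force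
  then have V: "V \<subseteq> S" "small V" "y \<in> fob X V" by (simp_all add: germs_iff)
  show "\<exists>V. V \<subseteq> S \<and> small V \<and> (\<forall>T m. large T \<and> m \<in> Mono T S \<and> V \<subseteq> m ` T \<longrightarrow> x \<in> farr ext T S m ` fob ext T)"
  proof (intro exI[of _ V] conjI V allI impI; elim conjE)
    fix T m assume T: "large T" and m: "m \<in> Mono T S" and Vm: "V \<subseteq> m ` T"
    \<comment> \<open>When \<open>V\<close> lies in the image of \<open>m\<close>, the element
      \<open>y\<close> is moved along the inverse of \<open>m\<close> to the inverse image of
      \<open>V\<close>; \<open>push m\<close> sends the resulting germ back to
      \<open>(V, y)\<close>.\<close>
    let ?n = "\<lambda>v\<in>V. inv_into T m v"
    have mn: "m (inv_into T m v) = v" and nT: "inv_into T m v \<in> T" if "v \<in> V" for v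
      using Vm that by (auto simp: f_inv_into_f inv_into_into)
    let ?W = "?n ` V"
    have W: "small ?W" by (rule card_of_image_ordLess[OF V(2)])
    have WT: "?W \<subseteq> T" using nT by auto
    have n: "?n \<in> Mono V ?W"
      by (rule Mono_restrictI) (auto intro!: inj_onI dest: arg_cong[where f = m] simp: mn)
    have mW: "m ` ?W = V" using mn by (auto simp: image_iff)
    have rm: "restrict m ?W \<in> Mono ?W V" using restrict_Mono_image[OF m WT] unfolding mW .
    have "compose V (restrict m ?W) ?n = incl V"
      unfolding compose_def by (rule restrict_ext) (simp add: mn)
    then have "farr X ?W V (restrict m ?W) (farr X V ?W ?n y) = y"
      using X_cmp[OF V(2) W V(2) n rm V(3)] X_ident[OF V(2,3)] by simp
    then have "push m (?W, farr X V ?W ?n y) = (V, y)" unfolding push_def prod.case mW by simp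
    moreover have g: "(?W, farr X V ?W ?n y) \<in> germs T" using W WT X_map[OF V(2) W n V(3)] by (simp add: germs_iff)
    ultimately have "farr ext T S m (code T (?W, farr X V ?W ?n y)) = x"
      using ext_farr[OF _ _ m g] T lS p(2) by (simp add: large_def)
    then show "x \<in> farr ext T S m ` fob ext T" unfolding ext_fob using g by blast
  qed
qed

text \<open>The comparison map from \<open>fob X V\<close> to the transformations from
  \<open>R_ob V\<close> to \<open>ext\<close>: \<open>x\<close> is moved along \<open>k\<close> to
  the image of \<open>k\<close>, a small subset of \<open>T\<close> and so a place for a
  germ.\<close>

definition unit :: "'u set \<Rightarrow> 'x \<Rightarrow> 'u scott_arr" where
  "unit V x = (\<lambda>T\<in>Collect large. \<lambda>k\<in>Mono V T. code T (k ` V, farr X V (k ` V) k x))"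

lemma unit_germ:
  assumes V: "small V" and x: "x \<in> fob X V" and k: "k \<in> Mono V T"
  shows "(k ` V, farr X V (k ` V) k x) \<in> germs T"
  using X_map[OF V card_of_image_ordLess[OF V] Mono_corestrict[OF k order_refl] x] Mono_image[OF k]
    card_of_image_ordLess[OF V, of k] by (simp add: germs_iff)

lemma unit_Hom:
  assumes V: "small V" and x: "x \<in> fob X V"
  shows "unit V x \<in> Hom E (R_ob V) ext"
  unfolding unit_def
proof (rule R_Hom_restrictI)
  show "code T (k ` V, farr X V (k ` V) k x) \<in> fob ext T" if "large T" "k \<in> Mono V T" for T k
    unfolding ext_fob using unit_germ[OF V x that(2)] by blast
  fix S T g k assume "large S" and "large T" and g: "g \<in> Mono S T" and k: "k \<in> Mono V S"
  then have S: "|S| <o \<nu>" and T: "|T| <o \<nu>" by (simp_all add: large_def)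
  have kV: "k ` V \<subseteq> S" using Mono_image[OF k] .
  have s: "small (k ` V)" "small (g ` k ` V)" by (intro card_of_image_ordLess V)+
  have im: "compose V g k ` V = g ` k ` V" by (auto simp: compose_def image_iff)
  have "compose V (restrict g (k ` V)) k = compose V g k"
    unfolding compose_def by (rule restrict_ext) simp
  then have "farr X (k ` V) (g ` k ` V) (restrict g (k ` V)) (farr X V (k ` V) k x) = farr X V (g ` k ` V) (compose V g k) x"
    using X_cmp[OF V s Mono_corestrict[OF k order_refl] restrict_Mono_image[OF g kV] x] by simp
  then show "code T (compose V g k ` V, farr X V (compose V g k ` V) (compose V g k) x) =
      farr ext S T g (code S (k ` V, farr X V (k ` V) k x))"
    unfolding ext_farr[OF S T g unit_germ[OF V x k]] push_def prod.case im by simp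
qed

lemma unit_incl:
  assumes T: "large T" and V: "V \<subseteq> T" "small V" and x: "x \<in> fob X V"
  shows "unit V x T (incl V) = code T (V, x)"
  using T V X_ident[OF V(2) x] by (simp add: unit_def Mono_incl)

text \<open>The two germs live on the images of \<open>W\<close> and of \<open>V\<close>; the first
  contains the second, so they are compared there.\<close>

lemma unit_natural:
  assumes V: "small V" and W: "small W" and f: "f \<in> Mono V W" and x: "x \<in> fob X V"
  shows "unit W (farr X V W f x) = pull V W f (unit V x)"
proof -
  note fx = X_map[OF V W f x]
  show ?thesis
  proof (rule R_Hom_eqI[OF unit_Hom[OF W fx] pull_Hom[OF f unit_Hom[OF V x]]])
    fix T k assume T: "large T" and k: "k \<in> Mono W T"
    then have T': "|T| <o \<nu>" by (simp add: large_def)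
    note fk = Mono_compose[OF f k]
    have k': "k \<in> Mono W (k ` W)" by (rule Mono_corestrict[OF k order_refl])
    have fk': "compose V k f \<in> Mono V (compose V k f ` V)" by (rule Mono_corestrict[OF fk order_refl])
    have s: "small (k ` W)" "small (compose V k f ` V)" by (intro card_of_image_ordLess W V)+
    have sub: "compose V k f ` V \<subseteq> k ` W" using MonoD[OF f] by (auto simp: compose_def)
    have e: "farr X W (k ` W) k (farr X V W f x) = farr X V (k ` W) (compose V k f) x"
      by (rule X_cmp[OF V W s(1) f k' x])
    have e': "farr X (compose V k f ` V) (k ` W) (incl (compose V k f ` V)) (farr X V (compose V k f ` V) (compose V k f) x) =
        farr X V (k ` W) (compose V k f) x"
      using X_cmp[OF V s(2,1) fk' Mono_incl[OF sub] x] compose_incl_left[OF fk'] by simp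
    note gW = unit_germ[OF W fx k] and gV = unit_germ[OF V x fk]
    have "germ_eq (k ` W, farr X W (k ` W) k (farr X V W f x)) (compose V k f ` V, farr X V (compose V k f ` V) (compose V k f) x)"
    proof (subst germ_eq_iff[of _ _ _ _ "k ` W"])
      show "farr X (k ` W) (k ` W) (incl (k ` W)) (farr X W (k ` W) k (farr X V W f x)) =
        farr X (compose V k f ` V) (k ` W) (incl (compose V k f ` V)) (farr X V (compose V k f ` V) (compose V k f) x)"
        using X_ident[OF s(1), of "farr X W (k ` W) k (farr X V W f x)"] gW e e' by (simp add: germs_iff)
    qed (use gW gV s sub in \<open>simp_all add: germs_iff\<close>)
    then show "unit W (farr X V W f x) T k = pull V W f (unit V x) T k"
      using T k fk code_eq[OF T' gW gV] by (simp add: unit_def)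
  qed
qed

text \<open>Injectivity is seen by evaluating at an inclusion. For surjectivity, the value of
  \<open>t\<close> at \<open>incl V\<close> is a germ on some \<open>W\<close>, and naturality of
  \<open>t\<close> provides the invariance under which the sheaf condition brings this germ down to
  \<open>V\<close>.\<close>

lemma unit_bij:
  assumes V: "small V"
  shows "bij_betw (unit V) (fob X V) (Hom E (R_ob V) ext)"
proof -
  obtain T where T: "V \<subseteq> T" "|T| =o lam" using small_in_lam'[OF V] .
  note lT = lam_large[OF T(2)]
  then have T': "|T| <o \<nu>" by (simp add: large_def)
  have "inj_on (unit V) (fob X V)"
  proof (rule inj_onI)
    fix x y assume x: "x \<in> fob X V" and y: "y \<in> fob X V" and "unit V x = unit V y"
    then have "code T (V, x) = code T (V, y)" using unit_incl[OF lT T(1) V x] unit_incl[OF lT T(1) V y] by simp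
    then have "germ_eq (V, x) (V, y)" using code_eq[OF T', of "(V, x)" "(V, y)"] T(1) V x y by (simp add: germs_iff)
    then show "x = y" using germ_eq_iff[OF V x V y V order_refl order_refl] X_ident[OF V x] X_ident[OF V y] by simp
  qed
  moreover have "t \<in> unit V ` fob X V" if t: "t \<in> Hom E (R_ob V) ext" for t
  proof -
    note i = Mono_incl[OF T(1)]
    obtain W y where p: "(W, y) \<in> germs T" "t T (incl V) = code T (W, y)"
      using R_HomD(3)[OF t lT i] unfolding ext_fob by force
    then have W: "W \<subseteq> T" "small W" "y \<in> fob X W" by (simp_all add: germs_iff)
    let ?K = "V \<union> W"
    have K: "small ?K" "?K \<subseteq> T" "V \<subseteq> ?K" "W \<subseteq> ?K" using V W T(1) small_Un by blast+
    \<comment> \<open>The germ is moved to \<open>V \<union> W\<close>, so that descent along the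
      inclusion of \<open>V\<close> can be asked for.\<close>
    define z where "z = farr X W ?K (incl W) y"
    have z: "z \<in> fob X ?K" unfolding z_def by (rule X_map[OF W(2) K(1) Mono_incl[OF K(4)] W(3)])
    have gz: "(?K, z) \<in> germs T" using K z by (simp add: germs_iff)
    have "germ_eq (?K, z) (W, y)"
      unfolding germ_eq_iff[OF K(1) z W(2,3) K(1) order_refl K(4)] X_ident[OF K(1) z] by (rule z_def)
    then have tz: "t T (incl V) = code T (?K, z)" using code_eq[OF T' gz p(1)] p(2) by simp
    have "\<exists>!x. x \<in> fob X V \<and> farr X V ?K (incl V) x = z"
    proof (rule X_descend[OF V K(1) Mono_incl[OF K(3)] z])
      fix U g g' assume U: "small U" and g: "g \<in> Mono ?K U" and g': "g' \<in> Mono ?K U"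
        and eq: "compose V g (incl V) = compose V g' (incl V)"
      obtain T2 where T2: "U \<subseteq> T2" "|T2| =o lam" using small_in_lam'[OF U] .
      note lT2 = lam_large[OF T2(2)]
      then have T2': "|T2| <o \<nu>" "lam \<le>o |T2|" by (simp_all add: large_def)
      \<comment> \<open>Naturality of \<open>t\<close> only concerns large sets, so an injection
        into the small \<open>U\<close> is extended to one from \<open>T\<close> to a set of size
        \<open>lam\<close> around \<open>U\<close>.\<close>
      have step: "\<exists>G\<in>Mono T T2. (\<forall>v\<in>?K. G v = h v) \<and> (h ` ?K, farr X ?K (h ` ?K) h z) \<in> germs T2 \<and>
          farr ext T T2 G (code T (?K, z)) = code T2 (h ` ?K, farr X ?K (h ` ?K) h z)" if h: "h \<in> Mono ?K U" for h
      proof -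
        have h2: "h \<in> Mono ?K T2" by (rule Mono_mono[OF h T2(1)])
        obtain G where G: "G \<in> Mono T T2" "\<And>v. v \<in> ?K \<Longrightarrow> G v = h v"
          using Mono_extend[OF h2 K(1,2) T2'(2) lam_le_large[OF T(2) lT2]] by metis
        have r: "restrict G ?K = h"
          by (rule Mono_eqI[OF Mono_restrict[OF G(1) K(2)] h]) (simp add: G(2))
        have im: "G ` ?K = h ` ?K" using G(2) by (rule image_cong[OF refl])
        have "push G (?K, z) = (h ` ?K, farr X ?K (h ` ?K) h z)" unfolding push_def prod.case r im ..
        then show ?thesis
          using G push_germs[OF G(1) gz] ext_farr[OF T' T2'(1) G(1) gz] by (intro bexI[OF _ G(1)]) simp
      qed
      obtain G where G: "G \<in> Mono T T2" "\<forall>v\<in>?K. G v = g v" "(g ` ?K, farr X ?K (g ` ?K) g z) \<in> germs T2"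
        "farr ext T T2 G (code T (?K, z)) = code T2 (g ` ?K, farr X ?K (g ` ?K) g z)" using step[OF g] by blast
      obtain G' where G': "G' \<in> Mono T T2" "\<forall>v\<in>?K. G' v = g' v" "(g' ` ?K, farr X ?K (g' ` ?K) g' z) \<in> germs T2"
        "farr ext T T2 G' (code T (?K, z)) = code T2 (g' ` ?K, farr X ?K (g' ` ?K) g' z)" using step[OF g'] by blast
      have "compose V G (incl V) = compose V G' (incl V)"
        unfolding compose_def
      proof (rule restrict_ext)
        fix v assume v: "v \<in> V"
        then show "G (incl V v) = G' (incl V v)"
          using fun_cong[OF eq, of v] G(2) G'(2) by (simp add: compose_eq)
      qed
      then have "farr ext T T2 G (t T (incl V)) = farr ext T T2 G' (t T (incl V))"
        using R_HomD(4)[OF t lT lT2 G(1) i] R_HomD(4)[OF t lT lT2 G'(1) i] by simp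
      then have ge: "germ_eq (g ` ?K, farr X ?K (g ` ?K) g z) (g' ` ?K, farr X ?K (g' ` ?K) g' z)"
        unfolding tz G(4) G'(4) code_eq[OF T2'(1) G(3) G'(3)] .
      \<comment> \<open>Back from germs over \<open>T2\<close> to elements of
        \<open>fob X U\<close>: both germs live on subsets of the small set \<open>U\<close>, so
        they may be compared in it.\<close>
      have inU: "farr X (h ` ?K) U (incl (h ` ?K)) (farr X ?K (h ` ?K) h z) = farr X ?K U h z"
        "small (h ` ?K)" "h ` ?K \<subseteq> U" "farr X ?K (h ` ?K) h z \<in> fob X (h ` ?K)" if h: "h \<in> Mono ?K U" for h
      proof -
        show s: "small (h ` ?K)" by (rule card_of_image_ordLess[OF K(1)])
        show hU: "h ` ?K \<subseteq> U" by (rule Mono_image[OF h])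
        have h': "h \<in> Mono ?K (h ` ?K)" by (rule Mono_corestrict[OF h order_refl])
        show "farr X ?K (h ` ?K) h z \<in> fob X (h ` ?K)" by (rule X_map[OF K(1) s h' z])
        show "farr X (h ` ?K) U (incl (h ` ?K)) (farr X ?K (h ` ?K) h z) = farr X ?K U h z"
          using X_cmp[OF K(1) s U h' Mono_incl[OF hU] z] compose_incl_left[OF h'] by simp
      qed
      note ig = inU[OF g] and ig' = inU[OF g']
      show "farr X ?K U g z = farr X ?K U g' z"
        using ge unfolding germ_eq_iff[OF ig(2,4) ig'(2,4) U ig(3) ig'(3)] ig(1) ig'(1) .
    qed
    then obtain x where x: "x \<in> fob X V" "farr X V ?K (incl V) x = z" by blast
    have "germ_eq (V, x) (?K, z)"
      unfolding germ_eq_iff[OF V x(1) K(1) z K(1,3) order_refl] X_ident[OF K(1) z] by (rule x(2))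
    then have "code T (V, x) = code T (?K, z)"
      using code_eq[OF T' _ gz, of "(V, x)"] T(1) V x(1) by (simp add: germs_iff)
    then have "unit V x = t"
      by (intro R_Hom_uniq[OF ext_E V T(1) lT unit_Hom[OF V x(1)] t]) (simp add: unit_incl[OF lT T(1) V x(1)] tz)
    then show ?thesis using x(1) by blast
  qed
  ultimately show ?thesis using unit_Hom[OF V] by (auto simp: bij_betw_def)
qed

end

section \<open>Comparing two bounds\<close>

lemma set_functor_subset:
  assumes F: "is_functor (Setm P) (Set_cat \<nu>) F" and Q: "Q \<subseteq> P"
  shows "is_functor (Setm Q) (Set_cat \<nu>) F"
  unfolding set_functor_iff
  by (intro conjI ballI)
    (simp_all add: setf_card[OF F] setf_hom[OF F] setf_ident[OF F] setf_cmp[OF F] subsetD[OF Q])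

context scott_cards
begin

text \<open>\<open>ext\<close> is the preimage of \<open>X\<close>, and the maps
  \<open>unit V\<close> form the isomorphism.\<close>

lemma Phi_ess_surj: "ess_surj E ShC Ph"
  unfolding ess_surj_def
proof
  fix X :: "('u set, 'u \<Rightarrow> 'u, 'u scott_arr set, 'u scott_arr \<Rightarrow> 'u scott_arr) func" assume X: "X \<in> Ob ShC"
  interpret atomic_sheaf \<kappa> lam \<nu> X by unfold_locales (rule X)
  let ?t = "\<lambda>V\<in>smalls. \<lambda>x\<in>fob X V. unit V x"
  have t: "?t \<in> Hom ShC X (fob Ph ext)"
  proof (rule Sh_Hom_restrictI[OF X_functor])
    show "unit V x \<in> fob (fob Ph ext) V" if "small V" "x \<in> fob X V" for V x
      unfolding Phi_ob by (rule unit_Hom[OF that])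
    show "unit W (farr X V W f x) = farr (fob Ph ext) V W f (unit V x)"
      if "small V" "small W" "f \<in> Mono V W" "x \<in> fob X V" for V W f x
      using unit_natural[OF that] unit_Hom[OF that(1,4)] by (simp add: Phi_ob_arr[OF that(3)])
  qed
  have "is_iso ShC X (fob Ph ext) ?t"
  proof (rule Sh_iso[OF X Phi_Sh[OF ext_E] t])
    fix V :: "'u set" assume V: "small V"
    have "bij_betw (?t V) (fob X V) (Hom E (R_ob V) ext) \<longleftrightarrow> bij_betw (unit V) (fob X V) (Hom E (R_ob V) ext)"
      by (rule bij_betw_cong) (simp add: V)
    then show "bij_betw (?t V) (fob X V) (fob (fob Ph ext) V)" unfolding Phi_ob using unit_bij[OF V] by simp
  qed
  then obtain s where "is_iso ShC (fob Ph ext) X s" by (rule iso_inverse)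
  then show "\<exists>F\<in>Ob E. \<exists>u. is_iso ShC (fob Ph F) X u" using ext_E by blast
qed

end

locale scott_cards_le = scott_cards \<kappa> lam \<nu> + L: scott_cards \<kappa> lam' \<nu>
  for \<kappa> lam lam' \<nu> :: "'u rel" +
  assumes lam_lam': "lam \<le>o lam'"
begin

abbreviation "K \<equiv> restrict_ge lam' \<nu>"

lemma large_mono: "L.large S \<Longrightarrow> large S"
  unfolding large_def L.large_def using lam_lam' ordLeq_transitive by blast

lemma incl_functor: "is_functor L.A A id_func"
  unfolding is_functor_def A_eq L.A_eq using large_mono by (simp add: is_category_Setm)

lemma K_fob [simp]: "fob K F = F"
  by (simp add: restrict_ge_def restriction_def)

lemma K_farr: "farr K F G t = restrict t (Collect L.large)"
  by (simp add: restrict_ge_def restriction_def L.A_eq)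

text \<open>Preservation over the bound \<open>lam'\<close> is deduced from injectivity and small
  supports, which \<open>F\<close> has on all sets of size at least \<open>lam\<close>.\<close>

lemma restrict_E: assumes F: "F \<in> Ob E" shows "F \<in> Ob L.E"
proof -
  note Ff = E_functor[OF F]
  have F': "is_functor (Setm (Collect L.large)) (Set_cat \<nu>) F"
    by (rule set_functor_subset[OF Ff]) (use large_mono in blast)
  show ?thesis unfolding L.E_Ob L.A_eq
  proof (intro conjI F' L.small_supports_preserve[unfolded L.A_eq])
    show "inj_on (farr F S T m) (fob F S)" if "L.large S" "L.large T" "m \<in> Mono S T" for S T m
      using E_inj[OF F] large_mono that by blast
    fix S x assume "L.large S" and x: "x \<in> fob F S"
    then have S: "large S" using large_mono by blast
    obtain V t where V: "V \<subseteq> S" "small V" and t: "t \<in> Hom E (R_ob V) F" "t S (incl V) = x"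
      using R_Hom_exists[OF F S x] by blast
    show "\<exists>V. V \<subseteq> S \<and> small V \<and> (\<forall>T m. L.large T \<and> m \<in> Mono T S \<and> V \<subseteq> m ` T \<longrightarrow> x \<in> farr F T S m ` fob F T)"
    proof (intro exI[of _ V] conjI V allI impI; elim conjE)
      fix T m assume "L.large T" and m: "m \<in> Mono T S" and Vm: "V \<subseteq> m ` T"
      then have T: "large T" using large_mono by blast
      let ?k = "\<lambda>v\<in>V. inv_into T m v"
      have mk: "m (inv_into T m v) = v" and kT: "inv_into T m v \<in> T" if "v \<in> V" for v
        using Vm that by (auto simp: f_inv_into_f inv_into_into)
      have k: "?k \<in> Mono V T"
        by (rule Mono_restrictI) (auto intro!: inj_onI dest: arg_cong[where f = m] simp: mk kT)
      have "compose V m ?k = incl V" unfolding compose_def by (rule restrict_ext) (simp add: mk)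
      then have "farr F T S m (t T ?k) = x" using R_HomD(4)[OF t(1) T S m k] t(2) by simp
      then show "x \<in> farr F T S m ` fob F T" using R_HomD(3)[OF t(1) T k] by blast
    qed
  qed
qed

lemma K_Hom: assumes t: "t \<in> Hom E F G" shows "restrict t (Collect L.large) \<in> Hom L.E F G"
  using t large_mono unfolding E_Hom L.E_Hom by simp

lemma K_functor: "is_functor E L.E K"
  unfolding is_functor_def K_fob K_farr
proof (intro conjI ballI)
  show "is_category E" "is_category L.E" by (rule is_category_E L.is_category_E)+
  fix F
  show "F \<in> Ob L.E" if "F \<in> Ob E" using restrict_E[OF that] .
  show "restrict (ident E F) (Collect L.large) = ident L.E F"
    unfolding E_ident L.E_ident using large_mono by (intro restrict_ext) simp
  fix G
  show "restrict s (Collect L.large) \<in> Hom L.E F G" if "s \<in> Hom E F G" for s by (rule K_Hom[OF that])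
  fix H s r
  show "restrict (cmp E F G H r s) (Collect L.large) = cmp L.E F G H (restrict r (Collect L.large)) (restrict s (Collect L.large))"
    unfolding E_cmp L.E_cmp using large_mono by (intro restrict_ext) simp
qed

lemma restrict_pull:
  assumes "f \<in> Mono V W"
  shows "restrict (pull V W f t) (Collect L.large) = L.pull V W f (restrict t (Collect L.large))"
  unfolding pull_def L.pull_def using large_mono by (intro restrict_ext) simp

text \<open>A morphism \<open>R\<^sub>V \<rightarrow> F\<close> is an element over some large set invariant under the injections fixing
  \<open>V\<close>, and this condition only involves targets which are at least as large.\<close>
lemma restrict_R_Hom_bij:
  assumes F: "F \<in> Ob E" and V: "small V"
  shows "bij_betw (\<lambda>t. restrict t (Collect L.large)) (Hom E (R_ob V) F) (Hom L.E (R_ob V) F)"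
proof -
  obtain T where T: "V \<subseteq> T" "|T| =o lam'" using L.small_in_lam'[OF V] .
  note lT' = L.lam_large[OF T(2)]
  note lT = large_mono[OF lT'] and i = Mono_incl[OF T(1)]
  let ?r = "\<lambda>t. restrict t (Collect L.large)"
  have "inj_on ?r (Hom E (R_ob V) F)"
  proof (rule inj_onI)
    fix t t' assume t: "t \<in> Hom E (R_ob V) F" and t': "t' \<in> Hom E (R_ob V) F" and eq: "?r t = ?r t'"
    have "t T = t' T" using fun_cong[OF eq, of T] lT' by simp
    then show "t = t'" using R_Hom_uniq[OF F V T(1) lT t t'] by simp
  qed
  moreover have "t \<in> ?r ` Hom E (R_ob V) F" if t: "t \<in> Hom L.E (R_ob V) F" for t
  proof -
    \<comment> \<open>\<open>T\<close> has size \<open>lam'\<close>, possibly more than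
      \<open>lam\<close>. The support lemma over arbitrary large sets supplies the values of
      \<open>s\<close> on the sets of size between the two bounds.\<close>
    have "\<exists>s\<in>Hom E (R_ob V) F. s T (incl V) = t T (incl V)"
    proof (rule R_Hom_yoneda[OF F lT T(1) V L.R_HomD(3)[OF t lT' i]])
      fix U g h assume U: "large U" and g: "g \<in> Mono T U" and h: "h \<in> Mono T U" and gh: "\<forall>v\<in>V. g v = h v"
      have "lam' \<le>o |U|" using Mono_card[OF g] lT' ordLeq_transitive unfolding L.large_def by blast
      then have U': "L.large U" using U unfolding large_def L.large_def by blast
      have "compose V g (incl V) = compose V h (incl V)"
        unfolding compose_def by (rule restrict_ext) (simp add: gh)
      then show "farr F T U g (t T (incl V)) = farr F T U h (t T (incl V))"
        using L.R_HomD(4)[OF t lT' U' g i] L.R_HomD(4)[OF t lT' U' h i] by simp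
    qed
    then obtain s where s: "s \<in> Hom E (R_ob V) F" "s T (incl V) = t T (incl V)" by blast
    have "?r s = t"
      by (rule L.R_Hom_uniq[OF restrict_E[OF F] V T(1) lT' K_Hom[OF s(1)] t]) (simp add: lT' s(2))
    then show ?thesis using s(1) by blast
  qed
  ultimately show ?thesis using K_Hom by (auto simp: bij_betw_def)
qed

text \<open>The isomorphism of sheaves cuts a transformation down to the sets of size at least
  \<open>lam'\<close>; its components are bijective by \<open>restrict_R_Hom_bij\<close>.\<close>

lemma Phi_restrict: "nat_isomorphic E ShC Ph (comp_func L.Ph K)"
proof (rule nat_isomorphicI[of _ _ _ _ "\<lambda>F. \<lambda>V\<in>smalls. \<lambda>t\<in>fob (fob Ph F) V. restrict t (Collect L.large)"])
  have \<theta>: "(\<lambda>V\<in>smalls. \<lambda>t\<in>fob (fob Ph F) V. restrict t (Collect L.large)) \<in> Hom ShC (fob Ph F) (fob L.Ph F)" if F: "F \<in> Ob E" for F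
  proof (rule Sh_Hom_restrictI[OF Sh_functor[OF Phi_Sh[OF F]]])
    show "restrict t (Collect L.large) \<in> fob (fob L.Ph F) V" if "t \<in> fob (fob Ph F) V" for V t
      using that unfolding Phi_ob L.Phi_ob by (rule K_Hom)
    show "restrict (farr (fob Ph F) V W f t) (Collect L.large) = farr (fob L.Ph F) V W f (restrict t (Collect L.large))"
      if f: "f \<in> Mono V W" and t: "t \<in> fob (fob Ph F) V" for V W f t
      using t K_Hom restrict_pull[OF f] unfolding Phi_ob_arr[OF f] L.Phi_ob_arr[OF f] Phi_ob by simp
  qed
  show "is_iso ShC (fob Ph F) (fob (comp_func L.Ph K) F) (\<lambda>V\<in>smalls. \<lambda>t\<in>fob (fob Ph F) V. restrict t (Collect L.large))"
    if F: "F \<in> Ob E" for F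
    unfolding comp_func_simps K_fob
  proof (rule Sh_iso[OF Phi_Sh[OF F] L.Phi_Sh[OF restrict_E[OF F]] \<theta>[OF F]])
    fix V :: "'u set" assume V: "small V"
    have "bij_betw ((\<lambda>V\<in>smalls. \<lambda>t\<in>fob (fob Ph F) V. restrict t (Collect L.large)) V) (Hom E (R_ob V) F) (Hom L.E (R_ob V) F) \<longleftrightarrow>
      bij_betw (\<lambda>t. restrict t (Collect L.large)) (Hom E (R_ob V) F) (Hom L.E (R_ob V) F)"
      by (rule bij_betw_cong) (simp add: V Phi_ob)
    then show "bij_betw ((\<lambda>V\<in>smalls. \<lambda>t\<in>fob (fob Ph F) V. restrict t (Collect L.large)) V) (fob (fob Ph F) V) (fob (fob L.Ph F) V)"
      using restrict_R_Hom_bij[OF F V] by (simp add: Phi_ob L.Phi_ob)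
  qed
  fix F G s assume F: "F \<in> Ob E" and G: "G \<in> Ob E" and s: "s \<in> Hom E F G"
  show "cmp ShC (fob Ph F) (fob Ph G) (fob (comp_func L.Ph K) G)
      (\<lambda>V\<in>smalls. \<lambda>t\<in>fob (fob Ph G) V. restrict t (Collect L.large)) (farr Ph F G s) =
    cmp ShC (fob Ph F) (fob (comp_func L.Ph K) F) (fob (comp_func L.Ph K) G)
      (farr (comp_func L.Ph K) F G s) (\<lambda>V\<in>smalls. \<lambda>t\<in>fob (fob Ph F) V. restrict t (Collect L.large))"
    unfolding Sh_cmp comp_func_simps K_fob K_farr Phi_arr L.Phi_arr Phi_ob
  proof (rule restrict_ext)
    fix V :: "'u set" assume "V \<in> smalls"
    then have V: "small V" by simp
    have "restrict (cmp E (R_ob V) F G s t) (Collect L.large) =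
        cmp L.E (R_ob V) F G (restrict s (Collect L.large)) (restrict t (Collect L.large))" for t
      unfolding E_cmp L.E_cmp using large_mono by (intro restrict_ext) simp
    then show "compose (Hom E (R_ob V) F)
        ((\<lambda>V\<in>smalls. \<lambda>t\<in>Hom E (R_ob V) G. restrict t (Collect L.large)) V)
        ((\<lambda>V\<in>smalls. \<lambda>t\<in>Hom E (R_ob V) F. cmp E (R_ob V) F G s t) V) =
      compose (Hom E (R_ob V) F)
        ((\<lambda>V\<in>smalls. \<lambda>t\<in>Hom L.E (R_ob V) F. cmp L.E (R_ob V) F G (restrict s (Collect L.large)) t) V)
        ((\<lambda>V\<in>smalls. \<lambda>t\<in>Hom E (R_ob V) F. restrict t (Collect L.large)) V)"
      unfolding compose_def by (intro restrict_ext) (simp add: V cmp_R_Hom[OF F G V s] K_Hom)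
  qed
qed

text \<open>Restriction is an equivalence by comparison with the two equivalences to sheaves. Its
  quasi-inverse \<open>G\<close> is the direct image, and the triangle for \<open>G\<close> follows
  from the one for restriction by whiskering with \<open>G\<close> and replacing
  \<open>comp_func K G\<close> by the identity.\<close>

lemma comparison:
  "\<exists>dir_im. geometric_morphism L.E E K dir_im \<and> is_equivalence L.E E dir_im \<and> is_equivalence E L.E K \<and>
    nat_isomorphic L.E ShC (comp_func Ph dir_im) L.Ph \<and> nat_isomorphic E ShC (comp_func L.Ph K) Ph"
proof -
  have P'K: "is_functor E ShC (comp_func L.Ph K)" by (rule comp_func_functor[OF K_functor L.Phi_functor])
  have iso: "nat_isomorphic E ShC (comp_func L.Ph K) Ph"
    by (rule nat_isomorphic_sym[OF Phi_functor P'K Phi_restrict])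
  note K = equivalence_two_of_three[OF Phi_fully_faithful Phi_ess_surj L.Phi_fully_faithful K_functor iso]
  obtain G where G: "is_functor L.E E G" "nat_isomorphic E E (comp_func G K) id_func"
    "nat_isomorphic L.E L.E (comp_func K G) id_func" using ess_surj_inverse[OF K] .
  have "is_functor L.E L.E id_func"
    using L.is_category_E cat_ident[OF L.is_category_E] cat_cmp[OF L.is_category_E] by (simp add: is_functor_def)
  note KG = nat_isomorphic_whisker_left[OF G(3) comp_func_functor[OF G(1) K_functor] this L.Phi_functor]
  have "nat_isomorphic L.E ShC (comp_func Ph G) (comp_func L.Ph (comp_func K G))"
    using nat_isomorphic_whisker_right[OF Phi_restrict G(1)] by (simp add: comp_func_assoc)
  then have "nat_isomorphic L.E ShC (comp_func Ph G) L.Ph"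
    using nat_isomorphic_trans[OF comp_func_functor[OF G(1) Phi_functor]
        comp_func_functor[OF comp_func_functor[OF G(1) K_functor] L.Phi_functor] L.Phi_functor _ KG[unfolded comp_func_id]]
    by blast
  moreover have "geometric_morphism L.E E K G"
    unfolding geometric_morphism_def
    by (intro conjI fully_faithful_adjunction[OF K(1) G(1,3)] fully_faithful_ess_surj_preserves_finite_limits[OF K])
  moreover have "is_equivalence L.E E G" unfolding is_equivalence_def using G K_functor by blast
  ultimately show ?thesis using is_equivalenceI[OF K] iso by blast
qed

end

theorem corollary4p8:
  fixes \<kappa> lam \<nu> :: "'u rel"
  assumes "Cinfinite \<kappa>" and "regularCard \<kappa>" and "Card_order lam" and "\<kappa> \<le>o lam"
    and "universe \<kappa> \<nu>" and "lam <o \<nu>"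
  shows "fully_faithful (Setm_less_op \<kappa>) (S_Setm_ge \<kappa> lam \<nu>) (R_func lam \<nu>)
    \<and> dense_functor \<nu> (Setm_less_op \<kappa>) (S_Setm_ge \<kappa> lam \<nu>) (R_func lam \<nu>)
    \<and> grothendieck_topology (Setm_less_op \<kappa>)
        (induced_topology (Setm_less_op \<kappa>) (S_Setm_ge \<kappa> lam \<nu>) (R_func lam \<nu>))
    \<and> (\<forall>V\<in>Ob (Setm_less_op \<kappa>).
        induced_topology (Setm_less_op \<kappa>) (S_Setm_ge \<kappa> lam \<nu>) (R_func lam \<nu>) V =
        atomic_topology (Setm_less_op \<kappa>) V)
    \<and> is_equivalence (S_Setm_ge \<kappa> lam \<nu>) (Sh_atomic \<kappa> \<nu>) (Phi \<kappa> lam \<nu>)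
    \<and> (\<forall>lam' :: 'u rel. Card_order lam' \<and> lam \<le>o lam' \<and> lam' <o \<nu> \<longrightarrow>
        is_functor (Setm_ge lam' \<nu>) (Setm_ge lam \<nu>) id_func
        \<and> (\<exists>dir_im.
            geometric_morphism (S_Setm_ge \<kappa> lam' \<nu>) (S_Setm_ge \<kappa> lam \<nu>)
              (restrict_ge lam' \<nu>) dir_im
            \<and> is_equivalence (S_Setm_ge \<kappa> lam' \<nu>) (S_Setm_ge \<kappa> lam \<nu>) dir_im
            \<and> is_equivalence (S_Setm_ge \<kappa> lam \<nu>) (S_Setm_ge \<kappa> lam' \<nu>) (restrict_ge lam' \<nu>)
            \<and> nat_isomorphic (S_Setm_ge \<kappa> lam' \<nu>) (Sh_atomic \<kappa> \<nu>)
                (comp_func (Phi \<kappa> lam \<nu>) dir_im) (Phi \<kappa> lam' \<nu>)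
            \<and> nat_isomorphic (S_Setm_ge \<kappa> lam \<nu>) (Sh_atomic \<kappa> \<nu>)
                (comp_func (Phi \<kappa> lam' \<nu>) (restrict_ge lam' \<nu>)) (Phi \<kappa> lam \<nu>)))"
proof -
  interpret scott_cards \<kappa> lam \<nu> by unfold_locales (fact assms)+
  show ?thesis
  proof (intro conjI ballI allI impI; (elim conjE)?)
    show "fully_faithful Cop E R" by (rule R_fully_faithful)
    show "dense_functor \<nu> Cop E R" by (rule R_dense)
    show "grothendieck_topology Cop (induced_topology Cop E R)" by (rule induced_grothendieck)
    show "induced_topology Cop E R V = atomic_topology Cop V" if "V \<in> Ob Cop" for V
      by (rule induced_eq_atomic[OF that])
    show "is_equivalence E ShC Ph" by (rule is_equivalenceI[OF Phi_fully_faithful Phi_ess_surj])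
    fix lam' :: "'u rel" assume lam': "Card_order lam'" "lam \<le>o lam'" "lam' <o \<nu>"
    interpret M: scott_cards_le \<kappa> lam lam' \<nu>
      by unfold_locales (use assms lam' ordLeq_transitive in blast)+
    show "is_functor M.L.A A id_func" by (rule M.incl_functor)
    show "\<exists>dir_im. geometric_morphism M.L.E E M.K dir_im \<and> is_equivalence M.L.E E dir_im \<and> is_equivalence E M.L.E M.K \<and>
        nat_isomorphic M.L.E ShC (comp_func Ph dir_im) M.L.Ph \<and> nat_isomorphic E ShC (comp_func M.L.Ph M.K) Ph"
      by (rule M.comparison)
  qed
qed

end
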